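(* Let $n\ge 3$ be an integer and, for $k\ge 1$, let $S_{nk}:\mathbb{R}^2\to\mathbb{R}^2$ be the dilation which maps $V_n=(\pi/2n,\pi/2n)$ to $0$ and expands distances by $\zeta_n k^2$, i.e. $S_{nk}(X)=\zeta_n k^2 (X-V_n)$, where $\zeta_n=2(n-1)\cot(\pi/2n)$. Let $Q_n$ be the convex quadrilateral with vertices $$v_1=\Big(-\frac1n,1-\frac1n\Big),\quad v_2=\Big(1-\frac1n,-\frac1n\Big),\quad v_3=(a_n,a_n),\quad v_4=(\mu_na_n,\mu_na_n),$$ where $$a_n=\frac12-\frac1{2n},\qquad \mu_n=\frac12-\frac{\tan^2(\pi/2n)}{2}.$$ If $n$ is held fixed and $k\to\infty$, then the closure of $S_{nk}(O(W_{nk}))$ converges to $Q_n$ in the Hausdorff metric. Moreover, every compact subset of the interior of $Q_n$ is contained in $S_{nk}(O(W_{nk}))$ for all $k$ sufficiently large (depending on $n$ and the compact set).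
   Context: The parameter space of obtuse triangles is $\Delta=\{(x_1,x_2)\in\mathbb{R}^2: x_1>0,\ x_2>0,\ x_1+x_2<\pi/2\}$; the point $(x_1,x_2)$ represents the obtuse triangle (up to similarity) whose two small angles are $x_1$ and $x_2$ radians. Its sides are labelled $1,2,3$, where side $j$ is opposite the angle $x_j$ for $j=1,2$, and side $3$ is the longest side. A periodic billiard path in a triangle (unit speed motion, equal-angle reflections off the interiors of the sides, never hitting a vertex, closing up) has as its combinatorial type the periodic sequence of labels of the successive sides it hits. A finite word $W$ in $\{1,2,3\}$ is identified with the infinite periodic word obtained by repeating $W$. The orbit tile $O(W)\subset\Delta$ is the set of points whose corresponding triangle has a periodic billiard path of combinatorial type $W$. The words $W_{nk}$ ($n=3,4,5,\ldots$, $k=0,1,2,\ldots$): exponents and juxtaposition denote repetition and concatenation of words. Put $$h=2(32)^{n-2},\quad H=2(32)^{n-1},\quad v=1(31)^{n-2},\quad u=1(31)^{n-1}.$$ Then $W_{nk}$ is the concatenation of the following four words, in this order: $$(h\,3\,v\,3)^{k+1}\,h\,3\,v;\qquad H\,3\,v\,(3\,h\,3\,v)^{k}\,3\,h;\qquad u\,3\,(h\,3\,v\,3)^{k}\,H;\qquad (v\,3\,h\,3)^{k+1}\,u .$$ For example $W_{30}=232313132323131\ 2323231313232\ 13131323232\ 1313232313131$, of length $52$. *)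

theory Defs
  imports "HOL-Analysis.Analysis"
begin

definition obtuse_params :: "(real \<times> real) set" where
  "obtuse_params = {(x1, x2). x1 > 0 \<and> x2 > 0 \<and> x1 + x2 < pi / 2}"

text \<open>
  The representative, in the complex plane, of the similarity class of triangles with small
  angles \<open>x1, x2\<close>: vertex \<open>j\<close> carries the angle \<open>x\<^sub>j\<close> (\<open>j = 1, 2\<close>), vertex 3 the obtuse angle, and
  the longest side is \<open>[0, 1]\<close>.  The apex is placed by the law of sines; \<open>tri_vertex_apex\<close> below
  shows that the angles at 0 and 1 are \<open>x1\<close> and \<open>x2\<close>.
\<close>

definition tri_vertex :: "real \<times> real \<Rightarrow> nat \<Rightarrow> complex" where
  "tri_vertex x j =
     (if j = 1 then 0
      else if j = 2 then 1
      else complex_of_real (sin (snd x) / sin (fst x + snd x)) * cis (fst x))"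

lemma tri_vertex_apex:
  assumes "x \<in> obtuse_params"
  defines "b \<equiv> sin (snd x) / sin (fst x + snd x)" and "a \<equiv> sin (fst x) / sin (fst x + snd x)"
  shows "a > 0" and "b > 0"
    and "tri_vertex x 3 - tri_vertex x 1 = complex_of_real b * cis (fst x)"
    and "tri_vertex x 3 - tri_vertex x 2 = complex_of_real a * cis (pi - snd x)"
proof -
  have x: "fst x > 0" "snd x > 0" "fst x + snd x < pi / 2"
    using assms(1) by (auto simp: obtuse_params_def)
  have s: "sin (fst x + snd x) > 0" "sin (fst x) > 0" "sin (snd x) > 0"
    using x by (auto intro!: sin_gt_zero)
  show "a > 0" "b > 0" using s by (simp_all add: a_def b_def)
  show "tri_vertex x 3 - tri_vertex x 1 = complex_of_real b * cis (fst x)"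
    by (simp add: tri_vertex_def b_def)
  have "b * cos (fst x) - 1 = - (a * cos (snd x))"
    using s by (simp add: a_def b_def field_simps sin_add)
  moreover have "b * sin (fst x) = a * sin (snd x)"
    by (simp add: a_def b_def)
  ultimately show "tri_vertex x 3 - tri_vertex x 2 = complex_of_real a * cis (pi - snd x)"
    by (simp add: tri_vertex_def b_def [symmetric] complex_eq_iff)
qed

text \<open>Side \<open>j\<close> joins the two vertices other than \<open>j\<close>.\<close>

definition side_start :: "real \<times> real \<Rightarrow> nat \<Rightarrow> complex" where
  "side_start x j = tri_vertex x (if j = 1 then 2 else if j = 2 then 3 else 1)"

definition side_end :: "real \<times> real \<Rightarrow> nat \<Rightarrow> complex" where
  "side_end x j = tri_vertex x (if j = 1 then 3 else if j = 2 then 1 else 2)"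

definition side_interior :: "real \<times> real \<Rightarrow> nat \<Rightarrow> complex set" where
  "side_interior x j = open_segment (side_start x j) (side_end x j)"

definition reflect_along :: "complex \<Rightarrow> complex \<Rightarrow> complex" where
  "reflect_along d w = (2 * (w \<bullet> d) / (d \<bullet> d)) *\<^sub>R d - w"

text \<open>
  A billiard path is recorded by its successive bounce points \<open>p i\<close>, the point \<open>p i\<close> lying in the
  interior of side \<open>s i\<close>; between bounces the path runs along the segment from \<open>p i\<close> to
  \<open>p (Suc i)\<close>, which stays in the triangle by convexity, with unit velocity
  \<open>sgn (p (Suc i) - p i)\<close>.  At a bounce the velocity is reflected along the side (equal angles).
  Periodicity of the path is not tied to any period of the label sequence \<open>s\<close>.
\<close>

definition periodic_billiard_path ::
    "real \<times> real \<Rightarrow> (nat \<Rightarrow> nat) \<Rightarrow> (nat \<Rightarrow> complex) \<Rightarrow> bool" where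
  "periodic_billiard_path x s p \<longleftrightarrow>
     (\<forall>i. s i \<in> {1, 2, 3} \<and> p i \<in> side_interior x (s i) \<and> p (Suc i) \<noteq> p i) \<and>
     (\<forall>i. sgn (p (Suc (Suc i)) - p (Suc i)) =
          reflect_along (side_end x (s (Suc i)) - side_start x (s (Suc i)))
            (sgn (p (Suc i) - p i))) \<and>
     (\<exists>N>0. \<forall>i. p (i + N) = p i)"

definition periodic_word :: "nat list \<Rightarrow> nat \<Rightarrow> nat" where
  "periodic_word W i = W ! (i mod length W)"

definition orbit_tile :: "nat list \<Rightarrow> (real \<times> real) set" where
  "orbit_tile W = {x \<in> obtuse_params. \<exists>p. periodic_billiard_path x (periodic_word W) p}"

definition word_pow :: "nat list \<Rightarrow> nat \<Rightarrow> nat list" where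
  "word_pow w m = concat (replicate m w)"

definition word_h :: "nat \<Rightarrow> nat list" where
  "word_h n = [2] @ word_pow [3, 2] (n - 2)"

definition word_H :: "nat \<Rightarrow> nat list" where
  "word_H n = [2] @ word_pow [3, 2] (n - 1)"

definition word_v :: "nat \<Rightarrow> nat list" where
  "word_v n = [1] @ word_pow [3, 1] (n - 2)"

definition word_u :: "nat \<Rightarrow> nat list" where
  "word_u n = [1] @ word_pow [3, 1] (n - 1)"

definition word_W :: "nat \<Rightarrow> nat \<Rightarrow> nat list" where
  "word_W n k =
     (let h = word_h n; H = word_H n; v = word_v n; u = word_u n in
       (word_pow (h @ [3] @ v @ [3]) (k + 1) @ h @ [3] @ v) @
       (H @ [3] @ v @ word_pow ([3] @ h @ [3] @ v) k @ [3] @ h) @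
       (u @ [3] @ word_pow (h @ [3] @ v @ [3]) k @ H) @
       (word_pow (v @ [3] @ h @ [3]) (k + 1) @ u))"

lemma word_W_3_0:
  "word_W 3 0 =
     [2,3,2,3,1,3,1,3,2,3,2,3,1,3,1] @ [2,3,2,3,2,3,1,3,1,3,2,3,2] @
     [1,3,1,3,1,3,2,3,2,3,2] @ [1,3,1,3,2,3,2,3,1,3,1,3,1]"
  by (simp add: word_W_def word_h_def word_H_def word_v_def word_u_def word_pow_def
      numeral_eq_Suc Let_def)

text \<open>
  The Hausdorff distance, with values in \<open>[0, \<infinity>]\<close> so that no boundedness or nonemptiness is
  needed for it to be meaningful: the distance of the empty set to a nonempty set is \<open>\<infinity>\<close>.  The
  instance for \<open>real \<times> real\<close> uses the Euclidean distance.
\<close>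

definition hausdorff_dist :: "'a::metric_space set \<Rightarrow> 'a set \<Rightarrow> ennreal" where
  "hausdorff_dist A B =
     max (SUP a\<in>A. INF b\<in>B. ennreal (dist a b)) (SUP b\<in>B. INF a\<in>A. ennreal (dist a b))"

definition V_pt :: "nat \<Rightarrow> real \<times> real" where
  "V_pt n = (pi / (2 * real n), pi / (2 * real n))"

definition zeta :: "nat \<Rightarrow> real" where
  "zeta n = 2 * (real n - 1) * cot (pi / (2 * real n))"

definition S_map :: "nat \<Rightarrow> nat \<Rightarrow> real \<times> real \<Rightarrow> real \<times> real" where
  "S_map n k X = (zeta n * (real k)\<^sup>2) *\<^sub>R (X - V_pt n)"

definition a_coef :: "nat \<Rightarrow> real" where
  "a_coef n = 1 / 2 - 1 / (2 * real n)"

definition mu_coef :: "nat \<Rightarrow> real" where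
  "mu_coef n = 1 / 2 - (tan (pi / (2 * real n)))\<^sup>2 / 2"

definition Q_quad :: "nat \<Rightarrow> (real \<times> real) set" where
  "Q_quad n = convex hull
     {(- 1 / real n, 1 - 1 / real n), (1 - 1 / real n, - 1 / real n),
      (a_coef n, a_coef n), (mu_coef n * a_coef n, mu_coef n * a_coef n)}"

end

theory Submission
  imports Defs
begin

text \<open>
  \<^bold>\<open>Unfolding.\<close>  If the triangle is reflected in the side that is hit, instead of the path, then a
  billiard path becomes a straight line that crosses the successive images of the sides.  The
  reflections of one period of the word compose to a translation by a vector \<open>d\<close>.  Hence a periodic
  path exists iff some line in direction \<open>d\<close> has the left endpoints of all crossed sides (the tops)
  on its left and the right endpoints (the bottoms) on its right (\<open>orbit_tile_iff\<close>): the tile is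
  described by comparing heights \<open>wedge d z\<close> of vertices.

  \<^bold>\<open>The zigzag.\<close>  Crossing the sides 2 and 3 in turn rotates the triangle about its vertex 1, and
  crossing 1 and 3 rotates it about vertex 2.  So the unfolding is a row of fans, whose pivots are
  joined by images of the longest side, of length 1, into a zigzag of tops and bottoms.  It falls
  into four parts, one for each of the four subwords (\<open>strip_word_W\<close>), which meet at the wide fans of
  the blocks \<open>H\<close> and \<open>u\<close>.  At the point \<open>V\<close> with both angles \<open>pi / (2 * n)\<close> the four parts are
  parallel and, but for the wide ones, all fans are congruent.  A displacement of order \<open>1 / k\<^sup>2\<close> of the angles turns the
  fans inside a part and the parts against each other by angles which, over a length of order \<open>k\<close>,
  move the vertices by \<open>1 / k\<close>.  As \<open>d\<close> has length of order \<open>k\<close>, the values of \<open>wedge d\<close> have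
  limits, which are affine functions of the rescaled displacement.

  \<^bold>\<open>Eight vertices.\<close>  Those limits are computed in \<open>critical_heights\<close> for eight vertices at the ends
  of the parts: the tops \<open>T1\<close>, \<open>T2\<close> and bottoms \<open>B1\<close>, \<open>B2\<close>, which are the pivots of the wide fans,
  and the apexes \<open>C1\<close>, \<open>C2\<close> (tops) and \<open>C3\<close>, \<open>C4\<close> (bottoms) next to them.  The four conditions that
  \<open>T1\<close> lies above \<open>B1\<close>, \<open>T2\<close> above \<open>B2\<close>, \<open>C1\<close> above \<open>C3\<close> and \<open>C2\<close> above \<open>C4\<close> become, in the limit,
  the four inequalities of the quadrilateral (\<open>Q_quad_eq\<close>).

  \<^bold>\<open>The tile is not larger.\<close>  Every limit of rescaled points of the tiles satisfies the weak forms
  of these inequalities (\<open>limit_in_Q\<close>), once the rescaled tiles are known to be bounded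
  (\<open>tiles_bounded\<close>).  Boundedness has two steps.  Since all bottom pivots of a part lie within
  distance 1 of the line, the part can hardly bend or be inclined, which gives a first estimate
  (\<open>coarse_confinement\<close>); then the heights of \<open>T1\<close>, \<open>B1\<close>, \<open>C1\<close>, \<open>C3\<close> improve it
  (\<open>gap_not_large\<close>).

  \<^bold>\<open>The tile is not smaller.\<close>  Over the interior of the quadrilateral, each part of the zigzag
  descends from start to end, in its tops and in its bottoms, and the vertices inside a fan do not
  lie closer to the line than those at its ends (\<open>fan_shape\<close>).  So the eight critical vertices are
  the only ones that matter (\<open>descending_in_tile\<close>), and all the required comparisons between them
  follow from the four strict inequalities (\<open>eventually_in_tile\<close>).  Compactness then gives both
  assertions of the theorem.
\<close>

section \<open>Unfolding a billiard path\<close>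

text \<open>
  For a direction \<open>w\<close>, this is the height of \<open>z\<close> above the line through 0 in direction \<open>w\<close>, times
  the length of \<open>w\<close>.
\<close>

definition wedge :: "complex \<Rightarrow> complex \<Rightarrow> real" where
  "wedge w z = Im (cnj w * z)"

lemma wedge_alt: "wedge w z = Re w * Im z - Im w * Re z"
  by (simp add: wedge_def)

lemma wedge_add_right: "wedge w (z + y) = wedge w z + wedge w y"
  and wedge_diff_right: "wedge w (z - y) = wedge w z - wedge w y"
  and wedge_add_left: "wedge (w + v) z = wedge w z + wedge v z"
  and wedge_diff_left: "wedge (w - v) z = wedge w z - wedge v z"
  and wedge_minus_right: "wedge w (- z) = - wedge w z"
  and wedge_minus_left: "wedge (- w) z = - wedge w z"
  and wedge_scaleR_right: "wedge w (r *\<^sub>R z) = r * wedge w z"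
  and wedge_scaleR_left: "wedge (r *\<^sub>R w) z = r * wedge w z"
  and wedge_self [simp]: "wedge w w = 0"
  and wedge_zero_left [simp]: "wedge 0 z = 0"
  and wedge_zero_right [simp]: "wedge w 0 = 0"
  by (simp_all add: wedge_alt algebra_simps)

definition refl_coef :: "real \<times> real \<Rightarrow> nat \<Rightarrow> complex" where
  "refl_coef x j = (if j = 1 then cis (- 2 * snd x) else if j = 2 then cis (2 * fst x) else 1)"

definition refl_lin :: "real \<times> real \<Rightarrow> nat \<Rightarrow> complex \<Rightarrow> complex" where
  "refl_lin x j w = refl_coef x j * cnj w"

text \<open>
  The reflection in the line that carries side \<open>j\<close>.  That line contains the point 1 (vertex 2) for
  \<open>j = 1\<close> and the point 0 (vertex 1) otherwise, and \<open>refl_coef\<close> is the square of its unit direction.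
\<close>

definition side_refl :: "real \<times> real \<Rightarrow> nat \<Rightarrow> complex \<Rightarrow> complex" where
  "side_refl x j z = (let p = (if j = 1 then 1 else 0) in p + refl_lin x j (z - p))"

lemma norm_refl_coef [simp]: "cmod (refl_coef x j) = 1"
  by (simp add: refl_coef_def)

lemma refl_lin_invol [simp]: "refl_lin x j (refl_lin x j w) = w"
  by (simp add: refl_lin_def refl_coef_def flip: cis_cnj mult.assoc) (simp add: cis_mult cis_cnj)

lemma refl_lin_add: "refl_lin x j (w + z) = refl_lin x j w + refl_lin x j z"
  and refl_lin_diff: "refl_lin x j (w - z) = refl_lin x j w - refl_lin x j z"
  and refl_lin_scaleR: "refl_lin x j (r *\<^sub>R w) = r *\<^sub>R refl_lin x j w"
  and norm_refl_lin: "cmod (refl_lin x j w) = cmod w"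
  by (simp_all add: refl_lin_def algebra_simps norm_mult)

lemma wedge_mult_unit: "cmod u = 1 \<Longrightarrow> wedge (u * w) (u * z) = wedge w z"
proof -
  assume "cmod u = 1"
  hence "cnj u * u = 1" by (simp add: complex_norm_square[symmetric] mult.commute)
  hence "cnj (u * w) * (u * z) = cnj w * z"
    by (metis (no_types, lifting) complex_cnj_mult mult.assoc mult.commute mult.left_neutral)
  thus ?thesis by (simp only: wedge_def)
qed

lemma wedge_cnj: "wedge (cnj w) (cnj z) = - wedge w z"
  by (simp add: wedge_alt)

lemma wedge_refl_lin: "wedge (refl_lin x j w) (refl_lin x j z) = - wedge w z"
  by (simp add: refl_lin_def wedge_mult_unit wedge_cnj)

lemma side_refl_diff: "side_refl x j z - side_refl x j y = refl_lin x j (z - y)"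
  by (simp add: side_refl_def Let_def refl_lin_diff)

lemma obtuse_paramsD:
  assumes "x \<in> obtuse_params"
  shows "fst x > 0" "snd x > 0" "fst x + snd x < pi / 2"
    "sin (fst x) > 0" "sin (snd x) > 0" "sin (fst x + snd x) > 0"
proof -
  show x: "fst x > 0" "snd x > 0" "fst x + snd x < pi / 2"
    using assms by (auto simp: obtuse_params_def)
  show "sin (fst x) > 0" "sin (snd x) > 0" "sin (fst x + snd x) > 0"
    using x by (auto intro!: sin_gt_zero)
qed

definition leg1 :: "real \<times> real \<Rightarrow> real" where
  "leg1 x = sin (fst x) / sin (fst x + snd x)"

definition leg2 :: "real \<times> real \<Rightarrow> real" where
  "leg2 x = sin (snd x) / sin (fst x + snd x)"

lemma apex_from_1: "tri_vertex x 3 = complex_of_real (leg2 x) * cis (fst x)"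
  by (simp add: tri_vertex_def leg2_def)

lemma apex_from_2:
  assumes "x \<in> obtuse_params"
  shows "tri_vertex x 3 = 1 - complex_of_real (leg1 x) * cis (- snd x)"
proof -
  have "tri_vertex x 3 - tri_vertex x 2 = complex_of_real (leg1 x) * cis (pi - snd x)"
    using tri_vertex_apex(4)[OF assms] by (simp add: leg1_def)
  moreover have "cis (pi - snd x) = - cis (- snd x)"
    by (simp add: complex_eq_iff)
  ultimately show ?thesis by (simp add: tri_vertex_def algebra_simps)
qed

lemma apex_Im_pos:
  assumes "x \<in> obtuse_params" shows "Im (tri_vertex x 3) > 0"
  using obtuse_paramsD[OF assms] by (simp add: tri_vertex_def)

lemma reflect_along_scale:
  assumes "r \<noteq> 0" shows "reflect_along (r *\<^sub>R d) w = reflect_along d w"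
  using assms by (cases "d = 0") (simp_all add: reflect_along_def field_simps)

lemma reflect_along_cis: "reflect_along (cis t) w = cis (2 * t) * cnj w"
proof (rule complex_eqI)
  have n: "cis t \<bullet> cis t = 1" by (simp add: inner_complex_def power2_eq_square[symmetric])
  show "Re (reflect_along (cis t) w) = Re (cis (2 * t) * cnj w)"
    by (simp add: reflect_along_def n inner_complex_def cos_double_cos sin_double power2_eq_square)
       (simp add: algebra_simps)
  show "Im (reflect_along (cis t) w) = Im (cis (2 * t) * cnj w)"
    by (simp add: reflect_along_def n inner_complex_def cos_double_sin sin_double power2_eq_square)
       (simp add: algebra_simps)
qed

lemma reflect_along_side:
  assumes x: "x \<in> obtuse_params" and j: "j \<in> {1, 2, 3}"
  shows "reflect_along (side_end x j - side_start x j) w = refl_lin x j w"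
proof -
  note p = obtuse_paramsD[OF x]
  have 1: "side_end x 1 - side_start x 1 = (- leg1 x) *\<^sub>R cis (- snd x)"
    using apex_from_2[OF x] by (simp add: side_end_def side_start_def tri_vertex_def scaleR_conv_of_real)
  have 2: "side_end x 2 - side_start x 2 = (- leg2 x) *\<^sub>R cis (fst x)"
    using apex_from_1[of x] by (simp add: side_end_def side_start_def tri_vertex_def scaleR_conv_of_real)
  have 3: "side_end x 3 - side_start x 3 = cis 0"
    by (simp add: side_end_def side_start_def tri_vertex_def)
  have l: "- leg1 x \<noteq> 0" "- leg2 x \<noteq> 0" using p by (auto simp: leg1_def leg2_def)
  consider "j = 1" | "j = 2" | "j = 3" using j by auto
  then show ?thesis
  proof cases
    case 1
    show ?thesis unfolding 1 \<open>side_end x 1 - side_start x 1 = _\<close>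
      by (subst reflect_along_scale[OF l(1)]) (simp add: reflect_along_cis refl_lin_def refl_coef_def)
  next
    case 2
    show ?thesis unfolding 2 \<open>side_end x 2 - side_start x 2 = _\<close>
      by (subst reflect_along_scale[OF l(2)]) (simp add: reflect_along_cis refl_lin_def refl_coef_def)
  next
    case 3
    show ?thesis unfolding 3 \<open>side_end x 3 - side_start x 3 = _\<close>
      by (simp only: reflect_along_cis) (simp add: refl_lin_def refl_coef_def)
  qed
qed

lemma side_refl_fixes:
  assumes x: "x \<in> obtuse_params" and j: "j \<in> {1, 2, 3}"
  shows "side_refl x j (side_start x j) = side_start x j"
    and "side_refl x j (side_end x j) = side_end x j"
proof -
  have c1: "refl_lin x 1 (complex_of_real r * cis (- snd x)) = complex_of_real r * cis (- snd x)" for r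
    by (simp add: refl_lin_def refl_coef_def cis_cnj cis_mult)
  have c2: "refl_lin x 2 (complex_of_real r * cis (fst x)) = complex_of_real r * cis (fst x)" for r
    by (simp add: refl_lin_def refl_coef_def cis_cnj cis_mult)
  have m: "refl_lin x i (- w) = - refl_lin x i w" for i w by (simp add: refl_lin_def)
  have z: "refl_lin x i 0 = 0" for i by (simp add: refl_lin_def)
  have "side_refl x j (side_start x j) = side_start x j \<and> side_refl x j (side_end x j) = side_end x j"
  proof -
    consider "j = 1" | "j = 2" | "j = 3" using j by auto
    then show ?thesis
    proof cases
      case 1
      have "tri_vertex x 2 = 1" by (simp add: tri_vertex_def)
      then show ?thesis using apex_from_2[OF x] c1[of "leg1 x"]
        by (simp add: 1 side_start_def side_end_def side_refl_def Let_def m z)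
    next
      case 2
      have "tri_vertex x 1 = 0" by (simp add: tri_vertex_def)
      then show ?thesis using apex_from_1[of x] c2[of "leg2 x"]
        by (simp add: 2 side_start_def side_end_def side_refl_def Let_def m z)
    next
      case 3
      then show ?thesis
        by (simp add: side_start_def side_end_def side_refl_def tri_vertex_def refl_lin_def refl_coef_def)
    qed
  qed
  thus "side_refl x j (side_start x j) = side_start x j"
    and "side_refl x j (side_end x j) = side_end x j" by auto
qed

lemma side_refl_affine:
  "side_refl x j (y + t *\<^sub>R (z - y)) = side_refl x j y + t *\<^sub>R (side_refl x j z - side_refl x j y)"
proof -
  have "side_refl x j (y + t *\<^sub>R (z - y)) - side_refl x j y = t *\<^sub>R (side_refl x j z - side_refl x j y)"
    by (simp add: side_refl_diff refl_lin_scaleR)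
  thus ?thesis by (simp only: diff_eq_eq add.commute)
qed

lemma side_interior_iff:
  assumes x: "x \<in> obtuse_params" and j: "j \<in> {1, 2, 3}"
  shows "p \<in> side_interior x j \<longleftrightarrow>
    (\<exists>t. 0 < t \<and> t < 1 \<and> p = side_start x j + t *\<^sub>R (side_end x j - side_start x j))"
proof -
  have "side_start x j \<noteq> side_end x j"
  proof -
    have "tri_vertex x 3 \<noteq> 0" "tri_vertex x 3 \<noteq> 1" using apex_Im_pos[OF x] by auto
    moreover have "tri_vertex x (Suc 0) = 0" "tri_vertex x 2 = 1" by (simp_all add: tri_vertex_def)
    ultimately show ?thesis using j by (auto simp: side_start_def side_end_def)
  qed
  thus ?thesis by (auto simp: side_interior_def in_segment algebra_simps)
qed

text \<open>
  With the vertices numbered counterclockwise, \<open>side_start\<close> and \<open>side_end\<close> run through the boundary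
  counterclockwise too, so a segment that enters through a side has \<open>side_start\<close> on its left.
\<close>

lemma cross_through_triangle:
  assumes x: "x \<in> obtuse_params" and ij: "i \<in> {1, 2, 3}" "j \<in> {1, 2, 3}" "i \<noteq> j"
    and p: "p \<in> side_interior x i" and q: "q \<in> side_interior x j"
  shows "wedge (q - p) (side_start x i - p) > 0" "wedge (q - p) (side_end x i - p) < 0"
proof -
  define A where "A = tri_vertex x 3"
  have A: "Im A > 0" using apex_Im_pos[OF x] by (simp add: A_def)
  obtain t where t: "0 < t" "t < 1" "p = side_start x i + t *\<^sub>R (side_end x i - side_start x i)"
    using p side_interior_iff[OF x ij(1)] by auto
  obtain r where r: "0 < r" "r < 1" "q = side_start x j + r *\<^sub>R (side_end x j - side_start x j)"
    using q side_interior_iff[OF x ij(2)] by auto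
  have v: "tri_vertex x 1 = 0" "tri_vertex x 2 = 1" "tri_vertex x (Suc 0) = 0" by (simp_all add: tri_vertex_def)
  define m where "m = (if j = (if i = 3 then 1 else i + 1) then r else 1 - r)"
  have m: "m > 0" using r by (simp add: m_def)
  have c: "wedge (q - p) (side_start x i - p) = t * m * Im A
      \<and> wedge (q - p) (side_end x i - p) = - ((1 - t) * m * Im A)"
    using ij unfolding t(3) r(3) m_def
    by (auto simp: side_start_def side_end_def v A_def[symmetric] wedge_alt algebra_simps)
  show "wedge (q - p) (side_start x i - p) > 0" "wedge (q - p) (side_end x i - p) < 0"
    using c t(1,2) m A by simp_all
qed

text \<open>
  The isometry that carries the triangle to the place where it lies, in the unfolding, just before
  the side \<open>s i\<close> is crossed; \<open>unf_lin\<close> is its linear part.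
\<close>

primrec unf :: "real \<times> real \<Rightarrow> (nat \<Rightarrow> nat) \<Rightarrow> nat \<Rightarrow> complex \<Rightarrow> complex" where
  "unf x s 0 = id"
| "unf x s (Suc i) = unf x s i \<circ> side_refl x (s i)"

primrec unf_lin :: "real \<times> real \<Rightarrow> (nat \<Rightarrow> nat) \<Rightarrow> nat \<Rightarrow> complex \<Rightarrow> complex" where
  "unf_lin x s 0 = id"
| "unf_lin x s (Suc i) = unf_lin x s i \<circ> refl_lin x (s i)"

lemma unf_diff: "unf x s i z - unf x s i y = unf_lin x s i (z - y)"
  by (induction i arbitrary: z y) (simp_all add: side_refl_diff)

lemma norm_unf_lin: "cmod (unf_lin x s i w) = cmod w"
  by (induction i arbitrary: w) (simp_all add: norm_refl_lin)

lemma unf_lin_diff: "unf_lin x s i (w - z) = unf_lin x s i w - unf_lin x s i z"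
  by (induction i arbitrary: w z) (simp_all add: refl_lin_diff)

lemma unf_lin_scaleR: "unf_lin x s i (r *\<^sub>R w) = r *\<^sub>R unf_lin x s i w"
  by (induction i arbitrary: w) (simp_all add: refl_lin_scaleR)

lemma unf_lin_inj: "unf_lin x s i w = unf_lin x s i z \<Longrightarrow> w = z"
  using norm_unf_lin[of x s i "w - z"] by (simp add: unf_lin_diff)

lemma unf_lin_sgn: "unf_lin x s i (sgn w) = sgn (unf_lin x s i w)"
  by (simp add: sgn_div_norm unf_lin_scaleR norm_unf_lin)

lemma wedge_unf_lin:
  "wedge (unf_lin x s i w) (unf_lin x s i z) = (if even i then wedge w z else - wedge w z)"
  by (induction i arbitrary: w z) (simp_all add: wedge_refl_lin)

lemma unf_affine:
  "unf x s i (y + t *\<^sub>R (z - y)) = unf x s i y + t *\<^sub>R (unf x s i z - unf x s i y)"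
proof -
  have "unf x s i (y + t *\<^sub>R (z - y)) - unf x s i y = t *\<^sub>R (unf x s i z - unf x s i y)"
    by (simp add: unf_diff unf_lin_scaleR)
  thus ?thesis by (simp only: diff_eq_eq add.commute)
qed

text \<open>
  Which endpoint of a side lies to the left of the path depends on the orientation of the image of
  the triangle, which changes at every crossing.
\<close>

definition side_left :: "real \<times> real \<Rightarrow> bool \<Rightarrow> nat \<Rightarrow> complex" where
  "side_left x b j = (if b then side_start x j else side_end x j)"

definition end_left :: "real \<times> real \<Rightarrow> (nat \<Rightarrow> nat) \<Rightarrow> nat \<Rightarrow> complex" where
  "end_left x s i = unf x s i (side_left x (odd i) (s i))"

definition end_right :: "real \<times> real \<Rightarrow> (nat \<Rightarrow> nat) \<Rightarrow> nat \<Rightarrow> complex" where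
  "end_right x s i = unf x s i (side_left x (even i) (s i))"

lemma unf_Suc_fixes:
  assumes x: "x \<in> obtuse_params" and j: "s i \<in> {1, 2, 3}"
  shows "unf x s (Suc i) (side_left x b (s i)) = unf x s i (side_left x b (s i))"
  using side_refl_fixes[OF x j] by (simp add: side_left_def)

lemma side_refl_interior:
  assumes x: "x \<in> obtuse_params" and j: "j \<in> {1, 2, 3}" and p: "p \<in> side_interior x j"
  shows "side_refl x j p = p"
  using p side_refl_fixes[OF x j] by (auto simp: side_interior_iff[OF x j] side_refl_affine)

lemma unf_segment_sides:
  assumes x: "x \<in> obtuse_params" and s: "\<And>i. s i \<in> {1, 2, 3}" "s i \<noteq> s (Suc i)"
    and p: "p \<in> side_interior x (s i)" and q: "q \<in> side_interior x (s (Suc i))"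
  defines "w \<equiv> unf x s (Suc i) q - unf x s i p"
  shows "wedge w (end_left x s i - unf x s i p) > 0"
    and "wedge w (end_right x s i - unf x s i p) < 0"
    and "w = unf_lin x s (Suc i) (q - p)"
proof -
  have P: "unf x s i p = unf x s (Suc i) p" using side_refl_interior[OF x s(1) p] by simp
  show w: "w = unf_lin x s (Suc i) (q - p)"
    unfolding w_def P unf_diff ..
  have e: "unf x s i (side_left x b (s i)) - unf x s i p
      = unf_lin x s (Suc i) (side_left x b (s i) - p)" for b
    unfolding P unf_Suc_fixes[of x s i b, OF x s(1), symmetric] unf_diff ..
  note c = cross_through_triangle[OF x s(1) s(1) s(2) p q]
  show "wedge w (end_left x s i - unf x s i p) > 0"
    unfolding end_left_def e unfolding w wedge_unf_lin using c by (simp add: side_left_def)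
  show "wedge w (end_right x s i - unf x s i p) < 0"
    unfolding end_right_def e unfolding w wedge_unf_lin using c by (simp add: side_left_def)
qed

lemma billiard_path_direction:
  assumes x: "x \<in> obtuse_params" and s: "\<And>i. s i \<noteq> s (Suc i)"
    and path: "periodic_billiard_path x s p"
  obtains D where "D \<noteq> 0" "\<And>i. sgn (unf x s (Suc i) (p (Suc i)) - unf x s i (p i)) = D"
proof -
  have p: "\<And>i. s i \<in> {1, 2, 3}" "\<And>i. p i \<in> side_interior x (s i)" "\<And>i. p (Suc i) \<noteq> p i"
    and r: "\<And>i. sgn (p (Suc (Suc i)) - p (Suc i)) =
          reflect_along (side_end x (s (Suc i)) - side_start x (s (Suc i))) (sgn (p (Suc i) - p i))"
    using path unfolding periodic_billiard_path_def by blast+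
  define w where "w i = unf x s (Suc i) (p (Suc i)) - unf x s i (p i)" for i
  have w: "w i = unf_lin x s (Suc i) (p (Suc i) - p i)" for i
    unfolding w_def by (rule unf_segment_sides(3)[where s=s and i=i and p="p i" and q="p (Suc i)", OF x p(1) s p(2) p(2)])
  have "sgn (w (Suc i)) = sgn (w i)" for i
  proof -
    have "sgn (w (Suc i)) = unf_lin x s (Suc (Suc i)) (sgn (p (Suc (Suc i)) - p (Suc i)))"
      unfolding w unf_lin_sgn ..
    also have "\<dots> = unf_lin x s (Suc (Suc i)) (refl_lin x (s (Suc i)) (sgn (p (Suc i) - p i)))"
      unfolding r reflect_along_side[OF x p(1)] ..
    also have "\<dots> = unf_lin x s (Suc i) (sgn (p (Suc i) - p i))" by simp
    also have "\<dots> = sgn (w i)" unfolding w unf_lin_sgn ..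
    finally show ?thesis .
  qed
  hence "sgn (w i) = sgn (w 0)" for i by (induction i) auto
  moreover have "sgn (w 0) \<noteq> 0"
    using p(3)[of 0] norm_unf_lin[of x s "Suc 0" "p (Suc 0) - p 0"] unfolding w sgn_zero_iff
    by (metis norm_eq_zero right_minus_eq)
  ultimately show ?thesis using that unfolding w_def by blast
qed

text \<open>
  The path may need several periods of the word, or only a part of one, to close up.  After as many
  words as the path has bounces in its own period, both have closed, and the unfolded path has
  advanced by a multiple of the translation \<open>d\<close>; hence it runs in direction \<open>d\<close>, at one constant
  height \<open>c\<close>.
\<close>

lemma periodic_path_heights:
  assumes x: "x \<in> obtuse_params" and s: "\<And>i. s i \<noteq> s (Suc i)"
    and L: "L > 0" and sL: "\<And>i. s (i + L) = s i"
    and hol: "\<And>z. unf x s L z = z + d"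
    and path: "periodic_billiard_path x s p"
  obtains c where "\<And>i. c < wedge d (end_left x s i)" "\<And>i. wedge d (end_right x s i) < c"
proof -
  have p: "\<And>i. s i \<in> {1, 2, 3}" "\<And>i. p i \<in> side_interior x (s i)"
    and "\<exists>N>0. \<forall>i. p (i + N) = p i"
    using path unfolding periodic_billiard_path_def by blast+
  then obtain N where N: "N > 0" "\<And>i. p (i + N) = p i" by blast
  obtain D where D: "D \<noteq> 0" "\<And>i. sgn (unf x s (Suc i) (p (Suc i)) - unf x s i (p i)) = D"
    using billiard_path_direction[OF x s path] by blast
  define q where "q i = unf x s i (p i)" for i
  define l where "l i = cmod (q (Suc i) - q i)" for i
  have step: "q (Suc i) - q i = l i *\<^sub>R D" for i
    using D(2)[of i] by (metis l_def q_def sgn_div_norm scaleR_scaleR scaleR_one divideR_right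
        norm_eq_zero scaleR_zero_left sgn_zero)
  have lpos: "l i > 0" for i
    using step[of i] D unfolding l_def q_def by (metis norm_ge_zero norm_zero order_le_less sgn_zero norm_eq_zero)
  have unfL: "unf x s (i + L) z = unf x s i z + d" for i z
  proof (induction i arbitrary: z)
    case 0 show ?case by (simp add: hol)
  next
    case (Suc i) show ?case by (simp add: Suc sL)
  qed
  have unfNL: "unf x s (i + m * L) z = unf x s i z + m *\<^sub>R d" for i z m
  proof (induction m)
    case (Suc m)
    show ?case using unfL[of "i + m * L" z] Suc by (simp add: algebra_simps)
  qed simp
  have pNL: "p (m * N) = p 0" for m
  proof (induction m)
    case (Suc m) thus ?case using N(2)[of "m * N"] by (simp add: add.commute)
  qed simp
  have "q (N * L) = q 0 + N *\<^sub>R d"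
    using unfNL[of 0 N "p 0"] pNL[of L] by (simp add: q_def mult.commute)
  moreover have sumq: "q i = q 0 + (\<Sum>j<i. l j) *\<^sub>R D" for i
  proof (induction i)
    case (Suc i) thus ?case using step[of i] by (simp add: algebra_simps)
  qed simp
  ultimately have "N *\<^sub>R d = (\<Sum>j<N * L. l j) *\<^sub>R D" by (metis add_left_cancel)
  moreover have "(\<Sum>j<N * L. l j) > 0" using lpos N L by (intro sum_pos) (auto simp: lessThan_empty_iff)
  moreover have "d = (1 / real N) *\<^sub>R (N *\<^sub>R d)" using N by simp
  ultimately have dD: "d = ((\<Sum>j<N * L. l j) / real N) *\<^sub>R D" and "(\<Sum>j<N * L. l j) / real N > 0"
    using N(1) by simp_all
  then obtain r where r: "r > 0" "d = r *\<^sub>R D" by blast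
  define c where "c = wedge d (q 0)"
  have c: "wedge d (q i) = c" for i
    by (subst sumq) (simp add: c_def r wedge_add_right wedge_scaleR_right wedge_scaleR_left)
  note sides = unf_segment_sides(1,2)[where s=s and i=i and p="p i" and q="p (Suc i)" for i, OF x p(1) s p(2) p(2), folded q_def, unfolded step wedge_scaleR_left]
  have "c < wedge d (end_left x s i)" for i
  proof -
    have "wedge D (end_left x s i - q i) > 0" using sides(1)[of i] lpos[of i] by (simp add: zero_less_mult_iff)
    hence "wedge d (end_left x s i - q i) > 0" using r by (simp add: wedge_scaleR_left)
    thus ?thesis by (simp add: wedge_diff_right c)
  qed
  moreover have "wedge d (end_right x s i) < c" for i
  proof -
    have "wedge D (end_right x s i - q i) < 0" using sides(2)[of i] lpos[of i] by (simp add: mult_less_0_iff)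
    hence "wedge d (end_right x s i - q i) < 0" using r by (simp add: wedge_scaleR_left mult_less_0_iff)
    thus ?thesis by (simp add: wedge_diff_right c)
  qed
  ultimately show ?thesis using that by blast
qed

text \<open>
  The line of height \<open>c\<close> meets the image of every side in an interior point.  Folded back, these
  points are the bounces: the reflection law holds because the unfolded path is straight, and the
  path closes up because \<open>d\<close> is parallel to the line.
\<close>

lemma heights_periodic_path:
  assumes x: "x \<in> obtuse_params" and s: "\<And>i. s i \<in> {1, 2, 3}" "\<And>i. s i \<noteq> s (Suc i)"
    and L: "L > 0" "even L" and sL: "\<And>i. s (i + L) = s i"
    and hol: "\<And>z. unf x s L z = z + d"
    and c: "\<And>i. c < wedge d (end_left x s i)" "\<And>i. wedge d (end_right x s i) < c"
  shows "\<exists>p. periodic_billiard_path x s p"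
proof -
  have unfL: "unf x s (i + L) z = unf x s i z + d" for i z
  proof (induction i arbitrary: z)
    case 0 show ?case by (simp add: hol)
  next
    case (Suc i) show ?case by (simp add: Suc sL)
  qed
  define hs where "hs i = wedge d (unf x s i (side_start x (s i)))" for i
  define he where "he i = wedge d (unf x s i (side_end x (s i)))" for i
  define t where "t i = (c - hs i) / (he i - hs i)" for i
  define p where "p i = side_start x (s i) + t i *\<^sub>R (side_end x (s i) - side_start x (s i))" for i
  define q where "q i = unf x s i (p i)" for i
  have hse: "hs i < c \<and> c < he i \<or> he i < c \<and> c < hs i" for i
    using c(1)[of i] c(2)[of i]
    by (cases "even i") (auto simp: hs_def he_def end_left_def end_right_def side_left_def)
  have t: "0 < t i" "t i < 1" for i
    using hse[of i] by (auto simp: t_def field_simps)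
  have pin: "p i \<in> side_interior x (s i)" for i
    using t[of i] by (auto simp: side_interior_iff[OF x s(1)] p_def)
  have qc: "wedge d (q i) = c" for i
  proof -
    have "wedge d (q i) = hs i + t i * (he i - hs i)"
      unfolding q_def p_def unf_affine by (simp add: wedge_add_right wedge_diff_right wedge_scaleR_right hs_def he_def)
    also have "\<dots> = c" using hse[of i] by (auto simp: t_def)
    finally show ?thesis .
  qed
  have d0: "d \<noteq> 0" using c(1)[of 0] c(2)[of 0] by auto
  define w where "w i = q (Suc i) - q i" for i
  note sides = unf_segment_sides[where s=s and i=i and p="p i" and q="p (Suc i)" for i, OF x s pin pin, folded q_def, folded w_def]
  have wdir: "sgn (w i) = sgn d" for i
  proof -
    have "wedge d (w i) = 0" by (simp add: w_def wedge_diff_right qc)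
    hence z: "Re d * Im (w i) = Im d * Re (w i)" by (simp add: wedge_alt)
    define m where "m = Re d * Re d + Im d * Im d"
    define r where "r = (Re d * Re (w i) + Im d * Im (w i)) / m"
    have m: "m \<noteq> 0" using d0 by (simp add: m_def complex_eq_iff sum_squares_eq_zero_iff)
    have "Re (w i) * m = (Re d * Re (w i) + Im d * Im (w i)) * Re d"
      and "Im (w i) * m = (Re d * Re (w i) + Im d * Im (w i)) * Im d"
      unfolding m_def using z by algebra+
    hence "w i = r *\<^sub>R d" using m by (simp add: complex_eq_iff r_def field_simps)
    moreover have "r > 0"
    proof -
      have "r * wedge d (end_left x s i - q i) > 0"
        using sides(1)[of i] unfolding \<open>w i = r *\<^sub>R d\<close> wedge_scaleR_left .
      moreover have "wedge d (end_left x s i - q i) > 0"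
        using c(1)[of i] by (simp add: wedge_diff_right qc)
      ultimately show ?thesis by (simp add: zero_less_mult_iff)
    qed
    ultimately show ?thesis by (simp add: sgn_scaleR)
  qed
  have wnz: "p (Suc i) \<noteq> p i" for i
    using wdir[of i] d0 sides(3)[of i] by (metis norm_unf_lin norm_zero right_minus_eq sgn_zero_iff norm_eq_zero)
  have refl: "sgn (p (Suc (Suc i)) - p (Suc i)) =
          reflect_along (side_end x (s (Suc i)) - side_start x (s (Suc i))) (sgn (p (Suc i) - p i))" for i
  proof -
    have "unf_lin x s (Suc i) (refl_lin x (s (Suc i)) (sgn (p (Suc (Suc i)) - p (Suc i)))) = sgn (w (Suc i))"
      unfolding sides(3) unf_lin_sgn[symmetric] by simp
    also have "\<dots> = sgn (w i)" by (simp add: wdir)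
    also have "\<dots> = unf_lin x s (Suc i) (sgn (p (Suc i) - p i))"
      unfolding sides(3) unf_lin_sgn ..
    finally have "refl_lin x (s (Suc i)) (sgn (p (Suc (Suc i)) - p (Suc i))) = sgn (p (Suc i) - p i)"
      by (rule unf_lin_inj)
    thus ?thesis unfolding reflect_along_side[OF x s(1)] by (metis refl_lin_invol)
  qed
  have "hs (i + L) = hs i" "he (i + L) = he i" for i
    by (simp_all add: hs_def he_def unfL sL wedge_add_right)
  hence "p (i + L) = p i" for i by (simp add: p_def t_def sL)
  hence "\<exists>N>0. \<forall>i. p (i + N) = p i" using L by blast
  thus ?thesis unfolding periodic_billiard_path_def using s(1) pin wnz refl by blast
qed

section \<open>Words as products of reflections\<close>

primrec word_map :: "real \<times> real \<Rightarrow> nat list \<Rightarrow> complex \<Rightarrow> complex" where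
  "word_map x [] = id"
| "word_map x (s # w) = side_refl x s \<circ> word_map x w"

text \<open>
  The endpoints, left or right according to \<open>b\<close>, of the sides crossed while a word is unfolded.  The
  flag alternates because each reflection reverses the orientation.
\<close>

primrec word_ends :: "real \<times> real \<Rightarrow> bool \<Rightarrow> nat list \<Rightarrow> complex set" where
  "word_ends x b [] = {}"
| "word_ends x b (s # w) = insert (side_left x b s) (side_refl x s ` word_ends x (\<not> b) w)"

lemma word_map_append: "word_map x (u @ w) = word_map x u \<circ> word_map x w"
  by (induction u) (simp_all add: o_assoc)

lemma word_ends_append:
  "word_ends x b (u @ w) = word_ends x b u \<union> word_map x u ` word_ends x (b = even (length u)) w"
proof (induction u arbitrary: b)
  case (Cons s u)
  have e: "((\<not> b) = even (length u)) = (b = odd (length u))" by auto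
  show ?case by (simp add: Cons image_Un image_image e)
qed simp

lemma length_word_pow [simp]: "length (word_pow w m) = m * length w"
  by (induction m) (simp_all add: word_pow_def)

lemma word_pow_Suc: "word_pow w (Suc m) = w @ word_pow w m"
  by (simp add: word_pow_def)

lemma word_pow_0 [simp]: "word_pow w 0 = []"
  by (simp add: word_pow_def)

lemma word_ends_conv_nth:
  "word_ends x b w = (\<lambda>i. word_map x (take i w) (side_left x (b = even i) (w ! i))) ` {..<length w}"
proof (induction w arbitrary: b)
  case (Cons s w)
  have e: "((\<not> b) = even i) = (b = odd i)" for i :: nat by auto
  show ?case
    by (simp add: lessThan_Suc_eq_insert_0 image_image Cons e)
qed simp

lemma unf_periodic_word:
  "i \<le> length W \<Longrightarrow> unf x (periodic_word W) i = word_map x (take i W)"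
proof (induction i)
  case (Suc i)
  hence "take (Suc i) W = take i W @ [W ! i]" by (simp add: take_Suc_conv_app_nth)
  thus ?case using Suc by (simp add: word_map_append periodic_word_def)
qed simp

text \<open>
  The height is invariant under the translation by \<open>d\<close>, so that the infinitely many conditions on the
  unfolded sides reduce to those of one period.
\<close>

lemma orbit_tile_iff:
  assumes x: "x \<in> obtuse_params" and W: "W \<noteq> []" "set W \<subseteq> {1, 2, 3}" "even (length W)"
    and adj: "distinct_adj W" "last W \<noteq> hd W"
    and hol: "\<And>z. word_map x W z = z + d"
  shows "x \<in> orbit_tile W \<longleftrightarrow>
    (\<exists>c. (\<forall>z\<in>word_ends x False W. c < wedge d z) \<and> (\<forall>z\<in>word_ends x True W. wedge d z < c))"
proof -
  define s where "s = periodic_word W"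
  define L where "L = length W"
  have L: "L > 0" "even L" using W by (simp_all add: L_def)
  have s1: "s i \<in> {1, 2, 3}" for i
  proof -
    have "s i \<in> set W" using L by (simp add: s_def periodic_word_def L_def)
    thus ?thesis using W(2) by blast
  qed
  have s2: "s i \<noteq> s (Suc i)" for i
  proof (cases "Suc (i mod L) = L")
    case True
    hence "W ! (i mod L) = last W" using W(1) by (metis L_def last_conv_nth diff_Suc_1)
    moreover have "Suc i mod L = 0" using True by (simp add: mod_Suc)
    ultimately show ?thesis using adj(2) W(1) by (simp add: s_def periodic_word_def L_def hd_conv_nth)
  next
    case False
    have "i mod L < L" using L by simp
    hence l: "Suc (i mod L) < L" using False by linarith
    have "Suc i mod L = Suc (i mod L)" using False by (simp add: mod_Suc)
    thus ?thesis using distinct_adj_nth[OF adj(1)] l by (simp add: s_def periodic_word_def L_def)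
  qed
  have s3: "s (i + L) = s i" for i by (simp add: s_def periodic_word_def L_def)
  have unfL: "unf x s L z = z + d" for z
    using unf_periodic_word[of L W x] hol by (simp add: s_def L_def)
  have shift: "unf x s (i + L) z = unf x s i z + d" for i z
  proof (induction i arbitrary: z)
    case 0 show ?case by (simp add: unfL)
  next
    case (Suc i) show ?case by (simp add: Suc s3)
  qed
  have eL: "end_left x s (i + L) = end_left x s i + d" "end_right x s (i + L) = end_right x s i + d" for i
    using L(2) by (simp_all add: end_left_def end_right_def s3 shift)
  have sW: "s i = W ! i" if "i < L" for i using that by (simp add: s_def periodic_word_def L_def)
  have L1: "word_ends x False W = end_left x s ` {..<L}" "word_ends x True W = end_right x s ` {..<L}"
    unfolding word_ends_conv_nth
    by (auto simp: end_left_def end_right_def sW L_def unf_periodic_word[of _ W x, folded s_def] intro!: image_cong)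
  have wl: "wedge d (end_left x s i) = wedge d (end_left x s (i mod L))
      \<and> wedge d (end_right x s i) = wedge d (end_right x s (i mod L))" for i
  proof (induction i rule: less_induct)
    case (less i)
    show ?case
    proof (cases "i < L")
      case False
      hence i: "i = (i - L) + L" by simp
      have m: "i mod L = (i - L) mod L" using False L by (simp add: le_mod_geq)
      have "wedge d (end_left x s i) = wedge d (end_left x s (i - L))
        \<and> wedge d (end_right x s i) = wedge d (end_right x s (i - L))"
        by (subst (1 3) i, unfold eL) (simp add: wedge_add_right)
      thus ?thesis using less[of "i - L"] L False m by simp
    qed simp
  qed
  have red: "(\<exists>c. (\<forall>z\<in>word_ends x False W. c < wedge d z) \<and> (\<forall>z\<in>word_ends x True W. wedge d z < c))
    \<longleftrightarrow> (\<exists>c. (\<forall>i. c < wedge d (end_left x s i)) \<and> (\<forall>i. wedge d (end_right x s i) < c))"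
    unfolding L1 using wl mod_less_divisor[OF L(1)] by (metis (no_types, lifting) imageE imageI lessThan_iff)
  show ?thesis
  proof
    assume "x \<in> orbit_tile W"
    then obtain p where p: "periodic_billiard_path x s p" by (auto simp: orbit_tile_def s_def)
    show "\<exists>c. (\<forall>z\<in>word_ends x False W. c < wedge d z) \<and> (\<forall>z\<in>word_ends x True W. wedge d z < c)"
      unfolding red using periodic_path_heights[of x s L d p, OF x s2 L(1) s3 unfL p] by metis
  next
    assume "\<exists>c. (\<forall>z\<in>word_ends x False W. c < wedge d z) \<and> (\<forall>z\<in>word_ends x True W. wedge d z < c)"
    then obtain c where "\<And>i. c < wedge d (end_left x s i)" "\<And>i. wedge d (end_right x s i) < c"
      unfolding red by blast
    hence "\<exists>p. periodic_billiard_path x s p"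
      by (rule heights_periodic_path[OF x s1 s2 L s3 unfL])
    thus "x \<in> orbit_tile W" using x by (simp add: orbit_tile_def s_def)
  qed
qed

section \<open>The unfolding of the words\<close>

text \<open>
  The tops satisfy \<open>T\<close> and the bottoms satisfy \<open>B\<close>, when the word \<open>w\<close> is unfolded from the position
  \<open>g\<close> of the triangle; \<open>b\<close> tells whether \<open>g\<close> preserves the orientation.
\<close>

definition strip :: "(complex \<Rightarrow> bool) \<Rightarrow> (complex \<Rightarrow> bool) \<Rightarrow> real \<times> real \<Rightarrow>
    (complex \<Rightarrow> complex) \<Rightarrow> bool \<Rightarrow> nat list \<Rightarrow> bool" where
  "strip T B x g b w \<longleftrightarrow>
     (\<forall>z\<in>word_ends x (\<not> b) w. T (g z)) \<and> (\<forall>z\<in>word_ends x b w. B (g z))"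

lemma strip_append:
  "strip T B x g b (u @ w) \<longleftrightarrow>
     strip T B x g b u \<and> strip T B x (g \<circ> word_map x u) (b = even (length u)) w"
proof -
  have e: "((\<not> b) = even (length u)) = (b = odd (length u))" by auto
  show ?thesis by (auto simp: strip_def word_ends_append e ball_Un)
qed

lemma strip_Nil [simp]: "strip T B x g b []"
  by (simp add: strip_def)

lemma strip_letter: "strip T B x g b [s] \<longleftrightarrow> T (g (side_left x (\<not> b) s)) \<and> B (g (side_left x b s))"
  by (auto simp: strip_def)

text \<open>
  The vertices of a fan with pivot \<open>P\<close>, entered over a longest side from \<open>P - cis t\<close> to \<open>P\<close>: images
  of the other end of the longest side and of the apex, the latter at distance \<open>l\<close> from the pivot.
  The entering vertex is not listed.  In a complete fan \<open>m\<close> and \<open>m'\<close> agree; a block that is not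
  followed by the letter 3 stops at an apex, with \<open>m' = m + 1\<close>.
\<close>

definition fan :: "complex \<Rightarrow> real \<Rightarrow> real \<Rightarrow> real \<Rightarrow> nat \<Rightarrow> nat \<Rightarrow> complex set" where
  "fan P l t x m m' = (\<lambda>i. P - cis (t + 2 * (real i + 1) * x)) ` {..<m} \<union>
     (\<lambda>i. P - complex_of_real l * cis (t + (2 * real i + 1) * x)) ` {..<m'}"

lemma ball_fan:
  "(\<forall>z\<in>fan P l t x m m'. Q z) \<longleftrightarrow>
    (\<forall>i<m. Q (P - cis (t + 2 * (real i + 1) * x))) \<and>
    (\<forall>i<m'. Q (P - complex_of_real l * cis (t + (2 * real i + 1) * x)))"
  by (auto simp: fan_def)

text \<open>
  Two reflections in lines through vertex 1, at angle \<open>fst x\<close>, compose to a rotation by twice this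
  angle; the sides 1 and 3 meet at vertex 2 in the angle \<open>snd x\<close>, with the opposite orientation.
\<close>

lemma word_map_23: "word_map x (word_pow [2, 3] m) z = cis (2 * real m * fst x) * z"
proof (induction m arbitrary: z)
  case (Suc m)
  have "cis (2 * real (Suc m) * fst x) = cis (2 * fst x) * cis (2 * real m * fst x)"
    by (simp add: cis_mult algebra_simps)
  then show ?case
    by (simp add: word_pow_Suc word_map_append Suc side_refl_def refl_lin_def refl_coef_def)
qed simp

lemma word_map_13: "word_map x (word_pow [Suc 0, 3] m) z = 1 + cis (- 2 * real m * snd x) * (z - 1)"
proof (induction m arbitrary: z)
  case (Suc m)
  have "cis (- 2 * real (Suc m) * snd x) = cis (- 2 * snd x) * cis (- 2 * real m * snd x)"
    by (simp add: cis_mult algebra_simps)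
  then show ?case
    by (simp add: word_pow_Suc word_map_append Suc side_refl_def refl_lin_def refl_coef_def)
qed simp

lemma word_pow_Suc_right: "word_pow w (Suc m) = word_pow w m @ w"
  by (induction m) (simp_all add: word_pow_Suc)

context
  fixes x :: "real \<times> real"
  assumes x: "x \<in> obtuse_params"
begin

lemma side_left_values:
  "side_left x True 2 = complex_of_real (leg2 x) * cis (fst x)" "side_left x False 2 = 0"
  "side_left x True 1 = 1" "side_left x False 1 = 1 - complex_of_real (leg1 x) * cis (- snd x)"
  "side_left x True (Suc 0) = 1"
  "side_left x False (Suc 0) = 1 - complex_of_real (leg1 x) * cis (- snd x)"
  "side_left x True 3 = 0" "side_left x False 3 = 1"
  using apex_from_1[of x] apex_from_2[OF x]
  by (simp_all add: side_left_def side_start_def side_end_def)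
     (simp_all add: tri_vertex_def)

lemma strip_pair_23:
  "strip T B x g True [2, 3] \<longleftrightarrow> T (g 0) \<and> B (g (complex_of_real (leg2 x) * cis (fst x)))
     \<and> B (g (cis (2 * fst x)))"
  "strip T B x g False [2, 3] \<longleftrightarrow> B (g 0) \<and> T (g (complex_of_real (leg2 x) * cis (fst x)))
     \<and> T (g (cis (2 * fst x)))"
  by (auto simp: strip_def side_left_values side_refl_def refl_lin_def refl_coef_def)

lemma strip_pair_13:
  "strip T B x g True [Suc 0, 3] \<longleftrightarrow> B (g 1) \<and> T (g (1 - complex_of_real (leg1 x) * cis (- snd x)))
     \<and> T (g (1 - cis (- 2 * snd x)))"
  "strip T B x g False [Suc 0, 3] \<longleftrightarrow> T (g 1) \<and> B (g (1 - complex_of_real (leg1 x) * cis (- snd x)))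
     \<and> B (g (1 - cis (- 2 * snd x)))"
  by (auto simp: strip_def side_left_values side_refl_def refl_lin_def refl_coef_def)

lemma strip_rot_23:
  "strip T B x g True (word_pow [2, 3] m) \<longleftrightarrow> (0 < m \<longrightarrow> T (g 0)) \<and>
     (\<forall>i<m. B (g (complex_of_real (leg2 x) * cis ((2 * real i + 1) * fst x)))
       \<and> B (g (cis (2 * (real i + 1) * fst x))))"
  "strip T B x g False (word_pow [2, 3] m) \<longleftrightarrow> (0 < m \<longrightarrow> B (g 0)) \<and>
     (\<forall>i<m. T (g (complex_of_real (leg2 x) * cis ((2 * real i + 1) * fst x)))
       \<and> T (g (cis (2 * (real i + 1) * fst x))))"
proof (induction m)
  case (Suc m)
  have e: "cis (2 * real m * fst x) * (complex_of_real (leg2 x) * cis (fst x))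
      = complex_of_real (leg2 x) * cis ((2 * real m + 1) * fst x)"
    "cis (2 * real m * fst x) * cis (2 * fst x) = cis (2 * (real m + 1) * fst x)"
    by (simp_all add: cis_mult algebra_simps)
  have s: "strip T B x g b (word_pow [2, 3] (Suc m)) \<longleftrightarrow> strip T B x g b (word_pow [2, 3] m)
      \<and> strip T B x (g \<circ> word_map x (word_pow [2, 3] m)) b [2, 3]" for b
    by (simp add: word_pow_Suc_right strip_append)
  case 1 show ?case
    unfolding s Suc strip_pair_23 o_apply word_map_23 e mult_zero_right All_less_Suc by blast
  case 2 show ?case
    unfolding s Suc strip_pair_23 o_apply word_map_23 e mult_zero_right All_less_Suc by blast
qed simp_all

lemma strip_rot_13:
  "strip T B x g True (word_pow [Suc 0, 3] m) \<longleftrightarrow> (0 < m \<longrightarrow> B (g 1)) \<and>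
     (\<forall>i<m. T (g (1 - complex_of_real (leg1 x) * cis (- ((2 * real i + 1) * snd x))))
       \<and> T (g (1 - cis (- (2 * (real i + 1) * snd x)))))"
  "strip T B x g False (word_pow [Suc 0, 3] m) \<longleftrightarrow> (0 < m \<longrightarrow> T (g 1)) \<and>
     (\<forall>i<m. B (g (1 - complex_of_real (leg1 x) * cis (- ((2 * real i + 1) * snd x))))
       \<and> B (g (1 - cis (- (2 * (real i + 1) * snd x)))))"
proof (induction m)
  case (Suc m)
  have e: "1 + cis (- 2 * real m * snd x) * (1 - complex_of_real (leg1 x) * cis (- snd x) - 1)
      = 1 - complex_of_real (leg1 x) * cis (- ((2 * real m + 1) * snd x))"
    "1 + cis (- 2 * real m * snd x) * (1 - cis (- 2 * snd x) - 1) = 1 - cis (- (2 * (real m + 1) * snd x))"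
    "1 + cis (- 2 * real m * snd x) * (1 - 1) = 1"
    by (simp_all add: cis_mult algebra_simps)
  have s: "strip T B x g b (word_pow [Suc 0, 3] (Suc m)) \<longleftrightarrow> strip T B x g b (word_pow [Suc 0, 3] m)
      \<and> strip T B x (g \<circ> word_map x (word_pow [Suc 0, 3] m)) b [Suc 0, 3]" for b
    by (simp add: word_pow_Suc_right strip_append)
  case 1 show ?case
    unfolding s Suc strip_pair_13 o_apply word_map_13 e All_less_Suc by blast
  case 2 show ?case
    unfolding s Suc strip_pair_13 o_apply word_map_13 e All_less_Suc by blast
qed simp_all

text \<open>
  In the names below, \<open>23\<close> and \<open>13\<close> tell the letters, hence the vertex of the triangle that serves
  as pivot; the frame is \<open>up\<close> if the pivot is a top and \<open>down\<close> if it is a bottom.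
\<close>

lemma strip_fan_23_up:
  "strip T B x (\<lambda>z. P - cis t * z) True (word_pow [2, 3] m) \<longleftrightarrow>
     (m > 0 \<longrightarrow> T P) \<and> (\<forall>z\<in>fan P (leg2 x) t (fst x) m m. B z)"
  by (auto simp: ball_fan strip_rot_23 cis_mult mult.left_commute[of "cis t"])

lemma strip_fan_23_down:
  "strip T B x (\<lambda>z. P - cis t * cnj z) False (word_pow [2, 3] m) \<longleftrightarrow>
     (m > 0 \<longrightarrow> B P) \<and> (\<forall>z\<in>fan P (leg2 x) t (- fst x) m m. T z)"
  by (auto simp: ball_fan strip_rot_23 cis_mult cis_cnj mult.left_commute[of "cis t"])

lemma strip_fan_13_down:
  "strip T B x (\<lambda>z. Q + cis t * (z - 1)) True (word_pow [Suc 0, 3] m) \<longleftrightarrow>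
     (m > 0 \<longrightarrow> B Q) \<and> (\<forall>z\<in>fan Q (leg1 x) t (- snd x) m m. T z)"
  by (auto simp: ball_fan strip_rot_13 cis_mult mult.left_commute[of "cis t"])

lemma strip_fan_13_up:
  "strip T B x (\<lambda>z. Q + cis t * (cnj z - 1)) False (word_pow [Suc 0, 3] m) \<longleftrightarrow>
     (m > 0 \<longrightarrow> T Q) \<and> (\<forall>z\<in>fan Q (leg1 x) t (snd x) m m. B z)"
  by (auto simp: ball_fan strip_rot_13 cis_mult cis_cnj mult.left_commute[of "cis t"])

lemma strip_trunc_23_up:
  "strip T B x (\<lambda>z. P - cis t * z) True (word_pow [2, 3] m @ [2]) \<longleftrightarrow>
     T P \<and> (\<forall>z\<in>fan P (leg2 x) t (fst x) m (Suc m). B z)"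
proof -
  have e: "cis t * (cis (2 * real m * fst x) * (complex_of_real (leg2 x) * cis (fst x)))
     = complex_of_real (leg2 x) * cis (t + (2 * real m + 1) * fst x)"
    by (simp add: cis_mult algebra_simps)
  show ?thesis
    unfolding strip_append strip_fan_23_up strip_letter ball_fan All_less_Suc
    by (simp add: side_left_values word_map_23 e) blast
qed

lemma strip_trunc_23_down:
  "strip T B x (\<lambda>z. P - cis t * cnj z) False (word_pow [2, 3] m @ [2]) \<longleftrightarrow>
     B P \<and> (\<forall>z\<in>fan P (leg2 x) t (- fst x) m (Suc m). T z)"
proof -
  have e: "cis t * (cis (- (2 * real m * fst x)) * (complex_of_real (leg2 x) * cis (- fst x)))
     = complex_of_real (leg2 x) * cis (t - (2 * real m + 1) * fst x)"
    by (simp add: cis_mult algebra_simps)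
  show ?thesis
    unfolding strip_append strip_fan_23_down strip_letter ball_fan All_less_Suc
    by (simp add: side_left_values word_map_23 cis_cnj e) blast
qed

lemma strip_trunc_13_down:
  "strip T B x (\<lambda>z. Q + cis t * (z - 1)) True (word_pow [Suc 0, 3] m @ [Suc 0]) \<longleftrightarrow>
     B Q \<and> (\<forall>z\<in>fan Q (leg1 x) t (- snd x) m (Suc m). T z)"
proof -
  have e: "cis t * (cis (- (2 * real m * snd x)) * (complex_of_real (leg1 x) * cis (- snd x)))
     = complex_of_real (leg1 x) * cis (t - (2 * real m + 1) * snd x)"
    by (simp add: cis_mult algebra_simps)
  show ?thesis
    unfolding strip_append strip_fan_13_down strip_letter ball_fan All_less_Suc
    by (simp add: side_left_values word_map_13 e) blast
qed

lemma strip_trunc_13_up: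
  "strip T B x (\<lambda>z. Q + cis t * (cnj z - 1)) False (word_pow [Suc 0, 3] m @ [Suc 0]) \<longleftrightarrow>
     T Q \<and> (\<forall>z\<in>fan Q (leg1 x) t (snd x) m (Suc m). B z)"
proof -
  have e: "cis t * (cis (2 * real m * snd x) * (complex_of_real (leg1 x) * cis (snd x)))
     = complex_of_real (leg1 x) * cis (t + (2 * real m + 1) * snd x)"
    by (simp add: cis_mult algebra_simps)
  show ?thesis
    unfolding strip_append strip_fan_13_up strip_letter ball_fan All_less_Suc
    by (simp add: side_left_values word_map_13 cis_cnj e) blast
qed

text \<open>
  The frame in which a fan of angle \<open>pi - r\<close> leaves the triangle: the next edge of the zigzag makes
  the angle \<open>r\<close> with the entering one, and its far end is the next pivot.
\<close>

lemma frame_23_up: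
  assumes "2 * real m * fst x = pi - r"
  shows "(\<lambda>z. P - cis t * z) \<circ> word_map x (word_pow [2, 3] m)
    = (\<lambda>z. (P + cis (t - r)) + cis (t - r) * (z - 1))"
proof -
  have "cis t * cis (pi - r) = - cis (t - r)"
    by (simp add: cis_mult complex_eq_iff sin_diff cos_diff sin_add cos_add)
  hence e: "cis t * (cis (pi - r) * z) = - (cis (t - r) * z)" for z
    by (simp add: mult.assoc[symmetric])
  show ?thesis
    by (rule ext) (simp add: word_map_23 assms e, simp add: algebra_simps)
qed

lemma frame_23_down:
  assumes "2 * real m * fst x = pi - r"
  shows "(\<lambda>z. P - cis t * cnj z) \<circ> word_map x (word_pow [2, 3] m)
    = (\<lambda>z. (P + cis (t + r)) + cis (t + r) * (cnj z - 1))"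
proof -
  have "cis t * cis (r - pi) = - cis (t + r)"
    by (simp add: cis_mult complex_eq_iff sin_diff cos_diff sin_add cos_add)
  hence e: "cis t * (cis (r - pi) * z) = - (cis (t + r) * z)" for z
    by (simp add: mult.assoc[symmetric])
  show ?thesis
    by (rule ext) (simp add: word_map_23 assms cis_cnj e, simp add: algebra_simps)
qed

lemma frame_13_down:
  assumes "2 * real m * snd x = pi - r"
  shows "(\<lambda>z. Q + cis t * (z - 1)) \<circ> word_map x (word_pow [Suc 0, 3] m)
    = (\<lambda>z. (Q + cis (t + r)) - cis (t + r) * z)"
proof -
  have "cis t * cis (r - pi) = - cis (t + r)"
    by (simp add: cis_mult complex_eq_iff sin_diff cos_diff sin_add cos_add)
  hence e: "cis t * (cis (r - pi) * z) = - (cis (t + r) * z)" for z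
    by (simp add: mult.assoc[symmetric])
  show ?thesis
    by (rule ext) (simp add: word_map_13 assms e, simp add: algebra_simps)
qed

lemma frame_13_up:
  assumes "2 * real m * snd x = pi - r"
  shows "(\<lambda>z. Q + cis t * (cnj z - 1)) \<circ> word_map x (word_pow [Suc 0, 3] m)
    = (\<lambda>z. (Q + cis (t - r)) - cis (t - r) * cnj z)"
proof -
  have "cis t * cis (pi - r) = - cis (t - r)"
    by (simp add: cis_mult complex_eq_iff sin_diff cos_diff sin_add cos_add)
  hence e: "cis t * (cis (pi - r) * z) = - (cis (t - r) * z)" for z
    by (simp add: mult.assoc[symmetric])
  show ?thesis
    by (rule ext) (simp add: word_map_13 assms cis_cnj e, simp add: algebra_simps)
qed

text \<open>
  At the end of a part the letter 3 is skipped.  So the fan is completed, and then the triangle is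
  reflected in its longest side, whose line is the real axis.  The word goes on in the opposite
  orientation, and this edge of the zigzag is not crossed.
\<close>

lemma word_map_trunc:
  "word_map x (word_pow [a, 3] m @ [a]) = word_map x (word_pow [a, 3] (Suc m)) \<circ> cnj"
  by (rule ext) (simp add: word_pow_Suc_right word_map_append side_refl_def refl_lin_def refl_coef_def)

end

text \<open>
  Pivots of the same kind (tops in \<open>zig\<close>, bottoms in \<open>zag\<close>) along a part of the zigzag.  Each pair of
  fans contributes two unit edges, at an angle of about \<open>r\<close>, and rotates what follows by \<open>d\<close> in a
  \<open>zig\<close> and by \<open>- d\<close> in a \<open>zag\<close>.
\<close>

definition zig :: "complex \<Rightarrow> real \<Rightarrow> real \<Rightarrow> real \<Rightarrow> nat \<Rightarrow> complex" where
  "zig P t r d j = P + (\<Sum>i<j. cis (t + real i * d - r) + cis (t + (real i + 1) * d))"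

definition zag :: "complex \<Rightarrow> real \<Rightarrow> real \<Rightarrow> real \<Rightarrow> nat \<Rightarrow> complex" where
  "zag P t r d j = P + (\<Sum>i<j. cis (t - real i * d) + cis (t - real i * d - r))"

lemma zig_0 [simp]: "zig P t r d 0 = P" and zag_0 [simp]: "zag P t r d 0 = P"
  and zig_Suc: "zig P t r d (Suc j) = zig P t r d j + cis (t + real j * d - r) + cis (t + (real j + 1) * d)"
  and zag_Suc: "zag P t r d (Suc j) = zag P t r d j + cis (t - real j * d) + cis (t - real j * d - r)"
  by (simp_all add: zig_def zag_def add.assoc)

locale hs_word =
  fixes x :: "real \<times> real" and n k :: nat
begin

text \<open>
  A complete fan about vertex \<open>i\<close> of the triangle has angle \<open>pi - turn\<^sub>i\<close>, a wide fan has angle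
  \<open>pi - gap\<^sub>i\<close>.  Passing through a pair of fans turns the zigzag by \<open>drift\<close>, alternately to the left
  and to the right in successive parts.
  
  The zigzag starts at the top 1, the translate of \<open>T2\<close> in the preceding period.  In part \<open>i\<close> the
  pivots are \<open>p\<^sub>i j\<close> and \<open>q\<^sub>i j\<close>; the tops are \<open>p1\<close>, \<open>q2\<close>, \<open>p3\<close>, \<open>q4\<close> and the bottoms \<open>q1\<close>, \<open>p2\<close>, \<open>q3\<close>,
  \<open>p4\<close>.  The pivots of the wide fans are \<open>B1\<close>, \<open>B2\<close>, \<open>T1\<close>, \<open>T2\<close>; these fans are entered in the
  directions \<open>E1\<close> to \<open>E4\<close>, and left in the directions \<open>th1\<close>, \<open>th2\<close>, \<open>th3\<close> and \<open>pi\<close>.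
\<close>

definition "turn1 = pi - 2 * (real n - 1) * fst x"
definition "turn2 = pi - 2 * (real n - 1) * snd x"
definition "gap1 = pi - 2 * real n * fst x"
definition "gap2 = pi - 2 * real n * snd x"
definition "drift = turn2 - turn1"

definition "E1 = pi + (real k + 2) * drift"
definition "th1 = E1 + gap1"
definition "E2 = th1 - (real k + 1) * drift"
definition "th2 = E2 + gap2"
definition "E3 = th2 + real k * drift"
definition "th3 = E3 - gap1"
definition "E4 = th3 - (real k + 1) * drift"

definition "p1 j = zig 0 pi turn1 drift j"
definition "q1 j = p1 j + cis (pi + real j * drift - turn1)"
definition "B1 = q1 (Suc k) + cis E1"
definition "p2 j = zag B1 th1 turn2 drift j"
definition "q2 j = p2 j + cis (th1 - real j * drift)"
definition "B2 = p2 (Suc k) + cis E2"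
definition "p3 j = zig (B2 + cis th2) th2 turn1 drift j"
definition "q3 j = p3 j + cis (th2 + real j * drift - turn1)"
definition "T1 = p3 k"
definition "p4 j = zag T1 th3 turn2 drift j"
definition "q4 j = p4 j + cis (th3 - real j * drift)"
definition "T2 = p4 (Suc k) + cis E4"

text \<open>
  The conditions on the vertices of the four parts.  In the last fan
  of a part there is one long edge less than there are apexes, because the letter 3 is missing; a
  wide fan has one more of each than the others.
\<close>

definition "part1 T B \<longleftrightarrow>
   (\<forall>j\<le>k + 1. T (p1 j) \<and> B (q1 j) \<and>
     (\<forall>z\<in>fan (p1 j) (leg2 x) (pi + real j * drift) (fst x) (n - 1) (n - 1). B z)) \<and>
   (\<forall>j\<le>k. \<forall>z\<in>fan (q1 j) (leg1 x) (pi + real j * drift - turn1) (- snd x) (n - 1) (n - 1). T z) \<and>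
   (\<forall>z\<in>fan (q1 (Suc k)) (leg1 x) (pi + (real k + 1) * drift - turn1) (- snd x) (n - 2) (n - 1). T z)"

definition "part2 T B \<longleftrightarrow>
   B B1 \<and> (\<forall>z\<in>fan B1 (leg2 x) E1 (- fst x) n n. T z) \<and>
   (\<forall>j\<le>k. T (q2 j) \<and> B (p2 (Suc j)) \<and>
     (\<forall>z\<in>fan (q2 j) (leg1 x) (th1 - real j * drift) (snd x) (n - 1) (n - 1). B z)) \<and>
   (\<forall>j<k. \<forall>z\<in>fan (p2 (Suc j)) (leg2 x) (th1 - real j * drift - turn2) (- fst x) (n - 1) (n - 1). T z) \<and>
   (\<forall>z\<in>fan (p2 (Suc k)) (leg2 x) (th1 - real k * drift - turn2) (- fst x) (n - 2) (n - 1). T z)"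

definition "part3 T B \<longleftrightarrow>
   B B2 \<and> (\<forall>z\<in>fan B2 (leg1 x) E2 (- snd x) n n. T z) \<and>
   (\<forall>j<k. T (p3 j) \<and> B (q3 j) \<and>
     (\<forall>z\<in>fan (p3 j) (leg2 x) (th2 + real j * drift) (fst x) (n - 1) (n - 1). B z) \<and>
     (\<forall>z\<in>fan (q3 j) (leg1 x) (th2 + real j * drift - turn1) (- snd x) (n - 1) (n - 1). T z)) \<and>
   T T1 \<and> (\<forall>z\<in>fan T1 (leg2 x) E3 (fst x) (n - 1) n. B z)"

definition "part4 T B \<longleftrightarrow>
   (\<forall>j\<le>k. T (q4 j) \<and> B (p4 (Suc j)) \<and>
     (\<forall>z\<in>fan (q4 j) (leg1 x) (th3 - real j * drift) (snd x) (n - 1) (n - 1). B z) \<and>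
     (\<forall>z\<in>fan (p4 (Suc j)) (leg2 x) (th3 - real j * drift - turn2) (- fst x) (n - 1) (n - 1). T z)) \<and>
   T T2 \<and> (\<forall>z\<in>fan T2 (leg1 x) E4 (snd x) (n - 1) n. B z)"

end

abbreviation rot1 :: "nat \<Rightarrow> nat list" where "rot1 m \<equiv> word_pow [2, 3] m"
abbreviation rot2 :: "nat \<Rightarrow> nat list" where "rot2 m \<equiv> word_pow [Suc 0, 3] m"

lemma word_pow_shift: "u @ word_pow (v @ u) m = word_pow (u @ v) m @ u"
  by (induction m) (simp_all add: word_pow_Suc)

text \<open>
  Regrouping the letters so that every block ends with the letter 3, where possible: then each
  block is a rotation.
\<close>

lemma word_W_blocks:
  assumes "n \<ge> 3"
  shows "word_W n k =
    (word_pow (rot1 (n - 1) @ rot2 (n - 1)) (Suc k) @ rot1 (n - 1) @ (rot2 (n - 2) @ [Suc 0])) @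
    (rot1 n @ word_pow (rot2 (n - 1) @ rot1 (n - 1)) k @ rot2 (n - 1) @ (rot1 (n - 2) @ [2])) @
    (rot2 n @ word_pow (rot1 (n - 1) @ rot2 (n - 1)) k @ (rot1 (n - 1) @ [2])) @
    (word_pow (rot2 (n - 1) @ rot1 (n - 1)) (Suc k) @ (rot2 (n - 1) @ [Suc 0]))"
proof -
  obtain m where m: "n = Suc (Suc m)" by (rule that[of "n - 2"]) (use assms in simp)
  have s: "a # word_pow [3, a] i = word_pow [a, 3] i @ [a]" for a i
    using word_pow_shift[of "[a]" "[3]" i] by simp
  have h: "word_h n @ [3] = rot1 (n - 1)" and v: "word_v n @ [3] = rot2 (n - 1)"
    and H: "word_H n @ [3] = rot1 n" and u: "word_u n @ [3] = rot2 n"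
    by (simp_all add: m word_h_def word_v_def word_H_def word_u_def s word_pow_Suc_right)
  have h': "word_h n = rot1 (n - 2) @ [2]" and v': "word_v n = rot2 (n - 2) @ [Suc 0]"
    and H': "word_H n = rot1 (n - 1) @ [2]" and u': "word_u n = rot2 (n - 1) @ [Suc 0]"
    by (simp_all add: m word_h_def word_v_def word_H_def word_u_def s)
  have 1: "word_pow (word_h n @ [3] @ word_v n @ [3]) j = word_pow (rot1 (n - 1) @ rot2 (n - 1)) j" for j
    unfolding h[symmetric] v[symmetric] by simp
  have 2: "word_pow (word_v n @ [3] @ word_h n @ [3]) j = word_pow (rot2 (n - 1) @ rot1 (n - 1)) j" for j
    unfolding h[symmetric] v[symmetric] by simp
  have 3: "word_v n @ word_pow ([3] @ word_h n @ [3] @ word_v n) k @ [3]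
      = word_pow (rot2 (n - 1) @ rot1 (n - 1)) k @ rot2 (n - 1)"
    using word_pow_shift[of "word_v n" "[3] @ word_h n @ [3]" k]
    unfolding 2[symmetric] unfolding v[symmetric] by simp
  have "word_W n k = (word_pow (word_h n @ [3] @ word_v n @ [3]) (k + 1) @ (word_h n @ [3]) @ word_v n) @
       ((word_H n @ [3]) @ (word_v n @ word_pow ([3] @ word_h n @ [3] @ word_v n) k @ [3]) @ word_h n) @
       ((word_u n @ [3]) @ word_pow (word_h n @ [3] @ word_v n @ [3]) k @ word_H n) @
       (word_pow (word_v n @ [3] @ word_h n @ [3]) (k + 1) @ word_u n)"
    by (simp add: word_W_def Let_def)
  thus ?thesis unfolding 1 2 3 unfolding h v H u unfolding h' v' H' u' by simp
qed

context hs_word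
begin

context
  assumes x: "x \<in> obtuse_params" and n: "n \<ge> 3"
begin

lemma turns:
  "2 * real (n - 1) * fst x = pi - turn1" "2 * real (n - 1) * snd x = pi - turn2"
  "2 * real n * fst x = pi - gap1" "2 * real n * snd x = pi - gap2"
  "2 * real (Suc (n - 2)) * fst x = pi - turn1" "2 * real (Suc (n - 2)) * snd x = pi - turn2"
  "2 * real (Suc (n - 1)) * fst x = pi - gap1" "2 * real (Suc (n - 1)) * snd x = pi - gap2"
  using n by (auto simp: turn1_def turn2_def gap1_def gap2_def of_nat_diff)

lemma evens: "even (length (rot1 i))" "even (length (rot2 i))"
  "even (length (word_pow (rot1 i @ rot2 j) m))" "even (length (word_pow (rot2 i @ rot1 j) m))"
  by simp_all

lemma up_frame: "(\<lambda>z. P + cis t * cnj z) = (\<lambda>z. (P + cis t) + cis t * (cnj z - 1))"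
  by (rule ext) (simp add: algebra_simps)

lemma fan_13_up': "strip T B x (\<lambda>z. P + cis t * cnj z) False (rot2 m) \<longleftrightarrow>
     (0 < m \<longrightarrow> T (P + cis t)) \<and> (\<forall>z\<in>fan (P + cis t) (leg1 x) t (snd x) m m. B z)"
  unfolding up_frame by (rule strip_fan_13_up[OF x])

lemma trunc_13_up': "strip T B x (\<lambda>z. P + cis t * cnj z) False (rot2 m @ [Suc 0]) \<longleftrightarrow>
     T (P + cis t) \<and> (\<forall>z\<in>fan (P + cis t) (leg1 x) t (snd x) m (Suc m). B z)"
  unfolding up_frame by (rule strip_trunc_13_up[OF x])

lemma frame_13_up': "2 * real m * snd x = pi - r \<Longrightarrow> (\<lambda>z. P + cis t * cnj z) \<circ> word_map x (rot2 m)
    = (\<lambda>z. (P + cis t + cis (t - r)) - cis (t - r) * cnj z)"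
  unfolding up_frame by (rule frame_13_up[OF x])

lemma frame_23_down': "2 * real m * fst x = pi - r \<Longrightarrow> (\<lambda>z. P - cis t * cnj z) \<circ> word_map x (rot1 m)
    = (\<lambda>z. P + cis (t + r) * cnj z)"
  unfolding up_frame by (rule frame_23_down[OF x])

lemma pair_up_map:
  "(\<lambda>z. P - cis t * z) \<circ> word_map x (word_pow (rot1 (n - 1) @ rot2 (n - 1)) m)
    = (\<lambda>z. zig P t turn1 drift m - cis (t + real m * drift) * z)"
proof (induction m)
  case (Suc m)
  have e: "t + real m * drift - turn1 + turn2 = t + real (Suc m) * drift"
    "t + (real m + 1) * drift = t + real (Suc m) * drift"
    by (simp_all add: drift_def algebra_simps)
  show ?case
    unfolding word_pow_Suc_right word_map_append o_assoc Suc frame_23_up[OF x turns(1)]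
      frame_13_down[OF x turns(2)] e zig_Suc ..
qed simp

lemma pair_up_strip:
  "strip T B x (\<lambda>z. P - cis t * z) True (word_pow (rot1 (n - 1) @ rot2 (n - 1)) m) \<longleftrightarrow>
   (\<forall>j<m. T (zig P t turn1 drift j) \<and>
      (\<forall>z\<in>fan (zig P t turn1 drift j) (leg2 x) (t + real j * drift) (fst x) (n - 1) (n - 1). B z) \<and>
      B (zig P t turn1 drift j + cis (t + real j * drift - turn1)) \<and>
      (\<forall>z\<in>fan (zig P t turn1 drift j + cis (t + real j * drift - turn1)) (leg1 x)
          (t + real j * drift - turn1) (- snd x) (n - 1) (n - 1). T z))"
proof (induction m)
  case (Suc m)
  have n0: "0 < n - 1" using n by simp
  show ?case
    unfolding word_pow_Suc_right strip_append[of _ _ _ _ _ "word_pow _ m"] Suc pair_up_map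
      strip_append[of _ _ _ _ _ "rot1 (n - 1)"] All_less_Suc
    by (simp only: evens n0 simp_thms strip_fan_23_up[OF x] frame_23_up[OF x turns(1)] strip_fan_13_down[OF x]) blast
qed simp

lemma pair_down_map:
  "(\<lambda>z. P + cis t * cnj z) \<circ> word_map x (word_pow (rot2 (n - 1) @ rot1 (n - 1)) m)
    = (\<lambda>z. zag P t turn2 drift m + cis (t - real m * drift) * cnj z)"
proof (induction m)
  case (Suc m)
  have e: "t - real m * drift - turn2 + turn1 = t - real (Suc m) * drift"
    by (simp add: drift_def algebra_simps)
  show ?case
    unfolding word_pow_Suc_right word_map_append o_assoc Suc frame_13_up'[OF turns(2)]
      frame_23_down'[OF turns(1)] e zag_Suc ..
qed simp

lemma pair_down_strip:
  "strip T B x (\<lambda>z. P + cis t * cnj z) False (word_pow (rot2 (n - 1) @ rot1 (n - 1)) m) \<longleftrightarrow>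
   (\<forall>j<m. T (zag P t turn2 drift j + cis (t - real j * drift)) \<and>
      (\<forall>z\<in>fan (zag P t turn2 drift j + cis (t - real j * drift)) (leg1 x)
          (t - real j * drift) (snd x) (n - 1) (n - 1). B z) \<and>
      B (zag P t turn2 drift (Suc j)) \<and>
      (\<forall>z\<in>fan (zag P t turn2 drift (Suc j)) (leg2 x)
          (t - real j * drift - turn2) (- fst x) (n - 1) (n - 1). T z))"
proof (induction m)
  case (Suc m)
  have n0: "0 < n - 1" using n by simp
  show ?case
    unfolding word_pow_Suc_right strip_append[of _ _ _ _ _ "word_pow _ m"] Suc pair_down_map
      strip_append[of _ _ _ _ _ "rot2 (n - 1)"] All_less_Suc
    by (simp only: evens n0 simp_thms fan_13_up' frame_13_up'[OF turns(2)] strip_fan_23_down[OF x]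
        zag_Suc) blast
qed simp

lemma strip_part1:
  fixes T B
  defines "w \<equiv> word_pow (rot1 (n - 1) @ rot2 (n - 1)) (Suc k) @ rot1 (n - 1) @ (rot2 (n - 2) @ [Suc 0])"
  shows "strip T B x (\<lambda>z. 0 - cis pi * z) True w \<longleftrightarrow> part1 T B"
    and "(\<lambda>z. 0 - cis pi * z) \<circ> word_map x w = (\<lambda>z. B1 - cis E1 * cnj z)"
proof -
  have n0: "0 < n - 1" using n by simp
  have e: "Suc (n - 2) = n - 1" using n by simp
  have a: "pi + real (Suc k) * drift - turn1 + turn2 = E1"
    by (simp add: E1_def drift_def algebra_simps)
  have r: "real k + 1 = real (Suc k)" by simp
  have all: "(\<forall>j\<le>k + 1. P j) \<longleftrightarrow> P (Suc k) \<and> (\<forall>j<Suc k. P j)" for P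
    by (auto simp: le_Suc_eq less_Suc_eq_le)
  have all': "(\<forall>j\<le>k. P j) \<longleftrightarrow> (\<forall>j<Suc k. P j)" for P by (simp add: less_Suc_eq_le)
  show "strip T B x (\<lambda>z. 0 - cis pi * z) True w \<longleftrightarrow> part1 T B"
    unfolding w_def part1_def strip_append[of _ _ _ _ _ "word_pow _ (Suc k)"]
      strip_append[of _ _ _ _ _ "rot1 (n - 1)"] all all' r
    by (simp only: evens n0 simp_thms pair_up_strip pair_up_map strip_fan_23_up[OF x]
        frame_23_up[OF x turns(1)] strip_trunc_13_down[OF x] e p1_def q1_def) blast
  show "(\<lambda>z. 0 - cis pi * z) \<circ> word_map x w = (\<lambda>z. B1 - cis E1 * cnj z)"
    unfolding w_def word_map_append[of _ "word_pow _ (Suc k)"] word_map_append[of _ "rot1 (n - 1)"]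
      word_map_trunc[OF x] o_assoc pair_up_map frame_23_up[OF x turns(1)] frame_13_down[OF x turns(6)] a
    unfolding B1_def q1_def p1_def by (simp add: comp_def)
qed

lemma strip_part2:
  fixes T B
  defines "w \<equiv> rot1 n @ word_pow (rot2 (n - 1) @ rot1 (n - 1)) k @ rot2 (n - 1) @ (rot1 (n - 2) @ [2])"
  shows "strip T B x (\<lambda>z. B1 - cis E1 * cnj z) False w \<longleftrightarrow> part2 T B"
    and "(\<lambda>z. B1 - cis E1 * cnj z) \<circ> word_map x w = (\<lambda>z. B2 + cis E2 * (z - 1))"
proof -
  have n0: "0 < n - 1" "0 < n" using n by simp_all
  have e: "Suc (n - 2) = n - 1" using n by simp
  have a: "th1 - real k * drift - turn2 + turn1 = E2"
    by (simp add: E2_def drift_def algebra_simps)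
  have all: "(\<forall>j\<le>k. P j) \<longleftrightarrow> P k \<and> (\<forall>j<k. P j)" for P
    by (metis less_Suc_eq_le All_less_Suc)
  show "strip T B x (\<lambda>z. B1 - cis E1 * cnj z) False w \<longleftrightarrow> part2 T B"
    unfolding w_def part2_def strip_append[of _ _ _ _ _ "word_pow _ k"] strip_append[of _ _ _ _ _ "rot1 n"]
      strip_append[of _ _ _ _ _ "rot2 (n - 1)"] all
    by (simp only: evens n0 simp_thms pair_down_strip pair_down_map strip_fan_23_down[OF x]
        frame_23_down'[OF turns(3)] fan_13_up' frame_13_up'[OF turns(2)] th1_def[symmetric]
        strip_trunc_23_down[OF x] e p2_def q2_def zag_Suc) blast
  show "(\<lambda>z. B1 - cis E1 * cnj z) \<circ> word_map x w = (\<lambda>z. B2 + cis E2 * (z - 1))"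
    unfolding w_def word_map_append[of _ "word_pow _ k"] word_map_append[of _ "rot1 n"]
      word_map_append[of _ "rot2 (n - 1)"]
      word_map_trunc[OF x] o_assoc frame_23_down'[OF turns(3)] th1_def[symmetric] pair_down_map
      frame_13_up'[OF turns(2)] frame_23_down'[OF turns(5)] a
    unfolding B2_def p2_def zag_Suc by (simp add: comp_def algebra_simps)
qed

lemma strip_part3:
  fixes T B
  defines "w \<equiv> rot2 n @ word_pow (rot1 (n - 1) @ rot2 (n - 1)) k @ (rot1 (n - 1) @ [2])"
  shows "strip T B x (\<lambda>z. B2 + cis E2 * (z - 1)) True w \<longleftrightarrow> part3 T B"
    and "(\<lambda>z. B2 + cis E2 * (z - 1)) \<circ> word_map x w = (\<lambda>z. T1 + cis th3 * cnj z)"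
proof -
  have n0: "0 < n - 1" "0 < n" using n by simp_all
  have e: "Suc (n - 1) = n" using n by simp
  show "strip T B x (\<lambda>z. B2 + cis E2 * (z - 1)) True w \<longleftrightarrow> part3 T B"
    unfolding w_def part3_def strip_append[of _ _ _ _ _ "word_pow _ k"] strip_append[of _ _ _ _ _ "rot2 n"]
    by (simp only: evens n0 simp_thms pair_up_strip pair_up_map strip_fan_13_down[OF x]
        frame_13_down[OF x turns(4)] th2_def[symmetric] E3_def[symmetric]
        strip_trunc_23_up[OF x] e p3_def q3_def T1_def) blast
  have a: "(P - cis s * z) = (P - cis s) - cis s * (z - 1)" for P s z
    by (simp add: algebra_simps)
  show "(\<lambda>z. B2 + cis E2 * (z - 1)) \<circ> word_map x w = (\<lambda>z. T1 + cis th3 * cnj z)"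
    unfolding w_def word_map_append[of _ "word_pow _ k"] word_map_append[of _ "rot2 n"]
      word_map_trunc[OF x] o_assoc frame_13_down[OF x turns(4)] th2_def[symmetric] pair_up_map
      E3_def[symmetric] frame_23_up[OF x turns(7)] th3_def[symmetric]
    unfolding T1_def p3_def by (simp add: comp_def algebra_simps)
qed

lemma strip_part4:
  fixes T B
  defines "w \<equiv> word_pow (rot2 (n - 1) @ rot1 (n - 1)) (Suc k) @ (rot2 (n - 1) @ [Suc 0])"
  shows "strip T B x (\<lambda>z. T1 + cis th3 * cnj z) False w \<longleftrightarrow> part4 T B"
    and "(\<lambda>z. T1 + cis th3 * cnj z) \<circ> word_map x w = (\<lambda>z. z + (T2 - 1))"
proof -
  have n0: "0 < n - 1" "0 < n" using n by simp_all
  have e: "Suc (n - 1) = n" using n by simp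
  have E4: "th3 - real (Suc k) * drift = E4" by (simp add: E4_def)
  have "E4 - gap2 = pi"
    by (simp add: E4_def th3_def E3_def th2_def E2_def th1_def E1_def algebra_simps)
  hence c: "cis (E4 - gap2) = - 1" by simp
  have all: "(\<forall>j\<le>k. P j) \<longleftrightarrow> (\<forall>j<Suc k. P j)" for P by (simp add: less_Suc_eq_le)
  show "strip T B x (\<lambda>z. T1 + cis th3 * cnj z) False w \<longleftrightarrow> part4 T B"
    unfolding w_def part4_def strip_append[of _ _ _ _ _ "word_pow _ (Suc k)"] all
    by (simp only: evens n0 simp_thms pair_down_strip pair_down_map E4 trunc_13_up' e p4_def q4_def T2_def) blast
  show "(\<lambda>z. T1 + cis th3 * cnj z) \<circ> word_map x w = (\<lambda>z. z + (T2 - 1))"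
    unfolding w_def word_map_append[of _ "word_pow _ (Suc k)"]
      word_map_trunc[OF x] o_assoc pair_down_map E4 frame_13_up'[OF turns(8)] c
    unfolding T2_def p4_def by (simp add: comp_def algebra_simps)
qed

text \<open>
  The four parts fit together, and the directions add up to a full period, so that the word acts as
  a translation.
\<close>

lemma strip_word_W:
  "strip T B x id True (word_W n k) \<longleftrightarrow> part1 T B \<and> part2 T B \<and> part3 T B \<and> part4 T B"
  "word_map x (word_W n k) z = z + (T2 - 1)"
proof -
  have id: "id = (\<lambda>z. 0 - cis pi * z)" by (simp add: fun_eq_iff)
  have l: "even (length (word_pow (rot1 (n - 1) @ rot2 (n - 1)) (Suc k) @ rot1 (n - 1) @ (rot2 (n - 2) @ [Suc 0]))) = False"
    "even (length (rot1 n @ word_pow (rot2 (n - 1) @ rot1 (n - 1)) k @ rot2 (n - 1) @ (rot1 (n - 2) @ [2]))) = False"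
    "even (length (rot2 n @ word_pow (rot1 (n - 1) @ rot2 (n - 1)) k @ (rot1 (n - 1) @ [2]))) = False"
    by simp_all
  show "strip T B x id True (word_W n k) \<longleftrightarrow> part1 T B \<and> part2 T B \<and> part3 T B \<and> part4 T B"
    unfolding word_W_blocks[OF n] id
    unfolding strip_append[of _ _ _ _ _ "word_pow (rot1 (n - 1) @ rot2 (n - 1)) (Suc k) @ rot1 (n - 1) @ (rot2 (n - 2) @ [Suc 0])"]
      strip_append[of _ _ _ _ _ "rot1 n @ word_pow (rot2 (n - 1) @ rot1 (n - 1)) k @ rot2 (n - 1) @ (rot1 (n - 2) @ [2])"]
      strip_append[of _ _ _ _ _ "rot2 n @ word_pow (rot1 (n - 1) @ rot2 (n - 1)) k @ (rot1 (n - 1) @ [2])"]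
      strip_part1 l
    by (simp only: simp_thms strip_part2 strip_part3 strip_part4)
  have "id \<circ> word_map x (word_W n k) = (\<lambda>z. z + (T2 - 1))"
    unfolding word_W_blocks[OF n] id
    unfolding word_map_append[of _ "word_pow (rot1 (n - 1) @ rot2 (n - 1)) (Suc k) @ rot1 (n - 1) @ (rot2 (n - 2) @ [Suc 0])"]
      word_map_append[of _ "rot1 n @ word_pow (rot2 (n - 1) @ rot1 (n - 1)) k @ rot2 (n - 1) @ (rot1 (n - 2) @ [2])"]
      word_map_append[of _ "rot2 n @ word_pow (rot1 (n - 1) @ rot2 (n - 1)) k @ (rot1 (n - 1) @ [2])"]
      o_assoc strip_part1 strip_part2 strip_part3 strip_part4 ..
  thus "word_map x (word_W n k) z = z + (T2 - 1)" by (simp add: fun_eq_iff)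
qed

end
end

section \<open>The tiles in terms of heights\<close>

lemma hd_word_pow: "w \<noteq> [] \<Longrightarrow> hd (word_pow w (Suc m)) = hd w"
  by (simp add: word_pow_Suc)

lemma last_word_pow: "w \<noteq> [] \<Longrightarrow> last (word_pow w (Suc m)) = last w"
  by (simp add: word_pow_Suc_right)

lemma distinct_adj_word_pow:
  assumes "distinct_adj w" "last w \<noteq> hd w"
  shows "distinct_adj (word_pow w m)"
proof (cases "w = []")
  case True thus ?thesis by (induction m) (simp_all add: word_pow_Suc)
next
  case w: False
  show ?thesis
  proof (induction m)
    case (Suc m)
    have "m \<noteq> 0 \<Longrightarrow> hd (word_pow w m) = hd w" by (cases m) (simp_all add: hd_word_pow w)
    thus ?case using assms Suc by (cases "m = 0") (auto simp: word_pow_Suc distinct_adj_append_iff)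
  qed simp
qed

lemma set_word_pow: "set (word_pow w m) \<subseteq> set w"
  by (induction m) (auto simp: word_pow_Suc)

lemma word_W_admissible:
  assumes "n \<ge> 3"
  shows "word_W n k \<noteq> []" "set (word_W n k) \<subseteq> {1, 2, 3}" "even (length (word_W n k))"
    "distinct_adj (word_W n k)" "last (word_W n k) \<noteq> hd (word_W n k)"
proof -
  obtain m where m: "n = Suc (Suc (Suc m))"
    by (rule that[of "n - 3"]) (use assms in simp)
  have d: "distinct_adj (word_pow [a, 3] i)" if "a \<noteq> 3" for a i
    by (rule distinct_adj_word_pow) (use that in simp_all)
  have h: "hd (word_pow [a, 3] (Suc i) @ w) = a" "last (word_pow [a, 3] (Suc i)) = 3"
    "word_pow [a, 3] (Suc i) \<noteq> []" for a i w
    by (simp add: word_pow_Suc, simp add: word_pow_Suc_right, simp add: word_pow_Suc)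
  have h': "hd (word_pow [a, 3] (Suc i)) = a" for a i by (simp add: word_pow_Suc)
  have dd: "distinct_adj (word_pow (rot1 (Suc i) @ rot2 (Suc i)) j)"
    "distinct_adj (word_pow (rot2 (Suc i) @ rot1 (Suc i)) j)" for i j
    by (rule distinct_adj_word_pow; simp add: distinct_adj_append_iff d h h')+
  have hh: "word_pow (rot1 (Suc i) @ rot2 (Suc i)) j = [] \<longleftrightarrow> j = 0"
    "word_pow (rot2 (Suc i) @ rot1 (Suc i)) j = [] \<longleftrightarrow> j = 0" for i j
    by (cases j; simp add: word_pow_Suc h)+
  have h1: "j \<noteq> 0 \<Longrightarrow> hd (word_pow (rot1 (Suc i) @ rot2 (Suc i)) j) = 2"
    "j \<noteq> 0 \<Longrightarrow> hd (word_pow (rot2 (Suc i) @ rot1 (Suc i)) j) = 1"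
    "j \<noteq> 0 \<Longrightarrow> last (word_pow (rot1 (Suc i) @ rot2 (Suc i)) j) = 3"
    "j \<noteq> 0 \<Longrightarrow> last (word_pow (rot2 (Suc i) @ rot1 (Suc i)) j) = 3" for i j
    by (cases j; simp add: hd_word_pow last_word_pow h h')+
  have n1: "n - 1 = Suc (Suc m)" "n - 2 = Suc m" by (simp_all add: m)
  note W = word_W_blocks[OF assms, of k, unfolded n1, unfolded m]
  show "word_W n k \<noteq> []" by (simp add: m W h)
  show "even (length (word_W n k))" by (simp add: m W)
  show "set (word_W n k) \<subseteq> {1, 2, 3}"
  proof -
    have s: "set (rot1 i) \<subseteq> {1, 2, 3}" "set (rot2 i) \<subseteq> {1, 2, 3}" for i
      using set_word_pow[of "[2, 3]" i] set_word_pow[of "[Suc 0, 3]" i] by auto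
    have s': "set (word_pow (rot1 i @ rot2 j) l) \<subseteq> {1, 2, 3}" "set (word_pow (rot2 i @ rot1 j) l) \<subseteq> {1, 2, 3}" for i j l
      by (rule order_trans[OF set_word_pow], use s in simp)+
    show ?thesis unfolding m W set_append Un_subset_iff using s s' by simp
  qed
  show "distinct_adj (word_W n k)"
    unfolding m W by (auto simp: distinct_adj_append_iff distinct_adj_Cons d dd h h' hh h1 last_append hd_append)
  show "last (word_W n k) \<noteq> hd (word_W n k)"
    unfolding m W by (simp add: h h' hh h1 hd_append last_append)
qed

text \<open>Height above the line through 0 in direction \<open>t\<close>, without the factor that \<open>wedge\<close> carries.\<close>

definition hgt :: "real \<Rightarrow> complex \<Rightarrow> real" where
  "hgt t z = Im (cis (- t) * z)"

lemma hgt_add: "hgt t (y + z) = hgt t y + hgt t z"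
  and hgt_diff: "hgt t (y - z) = hgt t y - hgt t z"
  and hgt_real: "hgt t (complex_of_real r * z) = r * hgt t z"
  by (simp_all add: hgt_def algebra_simps)

lemma hgt_cis: "hgt t (cis s) = sin (s - t)"
  by (simp add: hgt_def cis_mult)

lemma wedge_hgt: "wedge (complex_of_real r * cis t) z = r * hgt t z"
  by (simp add: wedge_def hgt_def cis_cnj mult.assoc)

context hs_word
begin

lemma tile_iff_parts:
  assumes x: "x \<in> obtuse_params" and n: "n \<ge> 3"
  shows "x \<in> orbit_tile (word_W n k) \<longleftrightarrow>
    (\<exists>c. let T = (\<lambda>z. c < wedge (T2 - 1) z); B = (\<lambda>z. wedge (T2 - 1) z < c)
         in part1 T B \<and> part2 T B \<and> part3 T B \<and> part4 T B)"
  unfolding Let_def strip_word_W(1)[OF x n, symmetric]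
    orbit_tile_iff[OF x word_W_admissible[OF n] strip_word_W(2)[OF x n]]
  by (simp add: strip_def)

text \<open>
  The direction of \<open>d\<close> is an angle \<open>t\<close> only up to multiples of \<open>2 * pi\<close>.  The representative is fixed
  by the first up edge, of direction \<open>pi + drift\<close>, which leads from a bottom to a top.
\<close>

lemma tile_direction:
  assumes x: "x \<in> obtuse_params" and n: "n \<ge> 3" and tile: "x \<in> orbit_tile (word_W n k)"
  obtains c t where "part1 (\<lambda>z. c < hgt t z) (\<lambda>z. hgt t z < c)" "part2 (\<lambda>z. c < hgt t z) (\<lambda>z. hgt t z < c)"
    "part3 (\<lambda>z. c < hgt t z) (\<lambda>z. hgt t z < c)" "part4 (\<lambda>z. c < hgt t z) (\<lambda>z. hgt t z < c)"
    "T2 - 1 = complex_of_real (cmod (T2 - 1)) * cis t" "T2 - 1 \<noteq> 0" "0 \<le> pi + drift - t" "pi + drift - t \<le> pi"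
proof -
  obtain c where c: "part1 (\<lambda>z. c < wedge (T2 - 1) z) (\<lambda>z. wedge (T2 - 1) z < c)" (is "part1 ?T ?B")
    "part2 (\<lambda>z. c < wedge (T2 - 1) z) (\<lambda>z. wedge (T2 - 1) z < c)"
    "part3 (\<lambda>z. c < wedge (T2 - 1) z) (\<lambda>z. wedge (T2 - 1) z < c)"
    "part4 (\<lambda>z. c < wedge (T2 - 1) z) (\<lambda>z. wedge (T2 - 1) z < c)"
    using tile unfolding tile_iff_parts[OF x n] Let_def by blast
  have "?T (p1 1)" "?B (q1 0)" using c(1) unfolding part1_def by auto
  hence nz: "T2 - 1 \<noteq> 0" by auto
  define r where "r = cmod (T2 - 1)"
  have r: "r > 0" using nz by (simp add: r_def)
  obtain s where s: "T2 - 1 = complex_of_real r * cis s"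
    using cis_Arg[OF nz] by (metis r_def nz sgn_eq mult.commute nonzero_eq_divide_eq of_real_eq_0_iff norm_eq_zero)
  have up: "p1 1 - q1 0 = cis (pi + drift)" by (simp add: p1_def q1_def zig_Suc)
  have "wedge (T2 - 1) (p1 1 - q1 0) > 0"
    using \<open>?T (p1 1)\<close> \<open>?B (q1 0)\<close> by (simp add: wedge_diff_right)
  hence "sin (pi + drift - s) > 0"
    unfolding up s wedge_hgt hgt_cis using r by (simp add: zero_less_mult_iff)
  then obtain u where u: "0 \<le> u" "u \<le> pi" "sin (pi + drift - s) = sin u" "cos (pi + drift - s) = cos u"
    using sincos_total_pi[of "sin (pi + drift - s)" "cos (pi + drift - s)"] by auto
  define t where "t = pi + drift - u"
  have cs: "cis (pi + drift - s) = cis u" using u by (simp add: complex_eq_iff)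
  have "cis s = cis t"
  proof -
    have "cis s = cis (pi + drift) / cis (pi + drift - s)" by (simp add: cis_divide)
    also have "\<dots> = cis t" unfolding cs t_def by (simp add: cis_divide)
    finally show ?thesis .
  qed
  hence s': "T2 - 1 = complex_of_real r * cis t" using s by simp
  have e: "(\<lambda>z. c < wedge (T2 - 1) z) = (\<lambda>z. c / r < hgt t z)" "(\<lambda>z. wedge (T2 - 1) z < c) = (\<lambda>z. hgt t z < c / r)"
    unfolding s' wedge_hgt using r by (auto simp: field_simps)
  show ?thesis
    by (rule that[OF c[unfolded e]]) (use s' r nz u in \<open>auto simp: r_def t_def\<close>)
qed

end

section \<open>Coarse confinement\<close>

lemma sin_pos_range: "sin u > 0 \<Longrightarrow> - pi < u \<Longrightarrow> u < 2 * pi \<Longrightarrow> 0 < u \<and> u < (pi::real)"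
proof (rule ccontr)
  assume s: "sin u > 0" and u: "- pi < u" "u < 2 * pi" and "\<not> (0 < u \<and> u < pi)"
  then consider "u \<le> 0" | "u \<ge> pi" by linarith
  thus False
  proof cases
    case 1
    hence "sin (- u) \<ge> 0" using u by (intro sin_ge_zero) auto
    thus False using s by simp
  next
    case 2
    hence "sin (u - pi) \<ge> 0" using u by (intro sin_ge_zero) auto
    thus False using s by (simp add: sin_diff)
  qed
qed

lemma sin_neg_range: "sin u < 0 \<Longrightarrow> - pi < u \<Longrightarrow> u < pi \<Longrightarrow> u < (0::real)"
  using sin_ge_zero[of u] by force

text \<open>Steps of size less than \<open>pi\<close> cannot jump over the interval where the sine is negative.\<close>

lemma fan_angles:
  assumes "\<And>i. i \<le> m \<Longrightarrow> sin (u + real i * a) > 0" and "0 < u" "u < pi" "0 < a" "a < pi"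
  shows "u + real m * a < pi"
  using assms(1)
proof (induction m)
  case (Suc m)
  have "u + real m * a < pi" by (rule Suc.IH) (use Suc.prems in simp)
  hence "u + real (Suc m) * a < 2 * pi" using assms(5) by (simp add: algebra_simps)
  moreover have "u + real (Suc m) * a > - pi"
    using assms(2,4) by (smt (verit) mult_nonneg_nonneg of_nat_0_le_iff pi_gt_zero)
  moreover have "sin (u + real (Suc m) * a) > 0" by (rule Suc.prems) simp
  ultimately show ?case using sin_pos_range by blast
qed (use assms in simp)

text \<open>
  The directions \<open>u + i * d\<close> of the up edges, relative to the path, start in \<open>(0, r)\<close> because the
  edge goes up and an adjacent one, turned by \<open>r\<close>, goes down; the steps are too small to leave this
  interval and come back elsewhere.
\<close>

lemma zigzag_directions:
  fixes u d r :: real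
  assumes up: "\<And>i. i \<le> m \<Longrightarrow> sin (u + real i * d) > 0"
    and down: "\<And>i. i \<le> m \<Longrightarrow> sin (u + real i * d - r) < 0"
    and u: "- pi < u" "u < 2 * pi" and d: "\<bar>d\<bar> < pi" and r: "0 < r" "r < pi"
  shows "i \<le> m \<Longrightarrow> 0 < u + real i * d \<and> u + real i * d < r"
proof (induction i)
  case 0
  have s: "sin u > 0" "sin (u - r) < 0" using up[of 0] down[of 0] by simp_all
  note w' = sin_pos_range[OF s(1) u]
  hence "- pi < u - r" "u - r < pi" using r by linarith+
  from sin_neg_range[OF s(2) this] show ?case using w' by simp
next
  case (Suc i)
  hence IH: "0 < u + real i * d" "u + real i * d < r" by auto
  let ?w = "u + real (Suc i) * d"
  have w: "?w = u + real i * d + d" by (simp add: algebra_simps)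
  have s: "sin ?w > 0" "sin (?w - r) < 0" using up[OF Suc.prems] down[OF Suc.prems] by simp_all
  have "- pi < ?w" "?w < 2 * pi" unfolding w using IH d r by linarith+
  note w' = sin_pos_range[OF s(1) this]
  hence "- pi < ?w - r" "?w - r < pi" using r by linarith+
  from sin_neg_range[OF s(2) this] show ?case using w' by simp
qed

lemma sin_lipschitz: "\<bar>sin a - sin b\<bar> \<le> \<bar>a - b\<bar>" for a b :: real
proof -
  have "sin a - sin b = 2 * sin ((a - b) / 2) * cos ((a + b) / 2)" by (rule sin_diff_sin)
  hence "\<bar>sin a - sin b\<bar> = 2 * \<bar>sin ((a - b) / 2)\<bar> * \<bar>cos ((a + b) / 2)\<bar>"
    by (simp add: abs_mult)
  also have "\<dots> \<le> 2 * \<bar>(a - b) / 2\<bar> * 1"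
    by (intro mult_mono abs_sin_x_le_abs_x abs_cos_le_one) (auto simp: abs_sin_x_le_abs_x)
  finally show ?thesis by simp
qed

lemma half_le_sin:
  assumes "0 \<le> t" "t \<le> pi / 3" shows "t / 2 \<le> sin t"
proof -
  have "sin 0 - 0 / 2 \<le> sin t - t / 2"
  proof (rule DERIV_nonneg_imp_nondecreasing[OF assms(1), where f = "\<lambda>t. sin t - t / 2"])
    fix s assume s: "0 \<le> s" "s \<le> t"
    have "cos (pi / 3) \<le> cos s" by (rule cos_monotone_0_pi_le) (use s assms in auto)
    hence "0 \<le> cos s - 1 / 2" by (simp add: cos_60)
    moreover have "((\<lambda>t. sin t - t / 2) has_real_derivative cos s - 1 / 2) (at s)"
      by (auto intro!: derivative_eq_intros)
    ultimately show "\<exists>y. ((\<lambda>t. sin t - t / 2) has_real_derivative y) (at s) \<and> 0 \<le> y" by blast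
  qed
  thus ?thesis by simp
qed

lemma abs_le_2_sin: "\<bar>t\<bar> \<le> pi / 3 \<Longrightarrow> \<bar>t\<bar> \<le> 2 * \<bar>sin t\<bar>" for t :: real
  using half_le_sin[of t] half_le_sin[of "- t"] by (cases "t \<ge> 0") (auto simp: abs_if)

lemma half_le_cos: "\<bar>t\<bar> \<le> pi / 3 \<Longrightarrow> 1 / 2 \<le> cos t" for t :: real
proof -
  assume t: "\<bar>t\<bar> \<le> pi / 3"
  have "cos (pi / 3) \<le> cos \<bar>t\<bar>" by (rule cos_monotone_0_pi_le) (use t in auto)
  thus ?thesis by (simp add: cos_60)
qed

text \<open>
  The second half of the progression minus the first half is \<open>2 * sin (m * e / 2)\<close> times a sum of \<open>m\<close>
  cosines that are at least \<open>1 / 2\<close>; as both halves are bounded, \<open>m * e\<close> is of order \<open>1 / m\<close>.  Then all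
  terms of the first half are close to \<open>sin z\<close>, so that \<open>m * sin z\<close> is bounded as well.
\<close>

lemma arith_prog_small:
  fixes z e :: real
  assumes m: "m \<ge> 1"
    and range: "\<And>l. l < 2 * m \<Longrightarrow> \<bar>z + real l * e\<bar> \<le> pi / 3"
    and s1: "\<bar>\<Sum>l<m. sin (z + real l * e)\<bar> \<le> 1"
    and s2: "\<bar>\<Sum>l<2 * m. sin (z + real l * e)\<bar> \<le> 1"
  shows "\<bar>e\<bar> \<le> 12 / (real m)\<^sup>2" "\<bar>z\<bar> \<le> 26 / real m"
proof -
  define s where "s l = sin (z + real l * e)" for l
  define S where "S = (\<Sum>l<m. cos (z + (real l + real m / 2) * e))"
  have "(\<Sum>l<2 * m. s l) = (\<Sum>l<m. s l) + (\<Sum>l<m. s (l + m))"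
  proof -
    have "{..<2 * m} = {..<m} \<union> {m..<m + m}" by auto
    hence "(\<Sum>l<2 * m. s l) = (\<Sum>l<m. s l) + (\<Sum>l=m..<m + m. s l)"
      by (simp add: sum.union_disjoint ivl_disj_int)
    also have "(\<Sum>l=m..<m + m. s l) = (\<Sum>l<m. s (l + m))"
      using sum.shift_bounds_nat_ivl[of s 0 m m] by (simp add: atLeast0LessThan)
    finally show ?thesis .
  qed
  moreover have "(\<Sum>l<m. s (l + m)) - (\<Sum>l<m. s l) = 2 * sin (real m * e / 2) * S"
    unfolding sum_subtractf[symmetric] S_def sum_distrib_left
  proof (rule sum.cong[OF refl])
    fix l
    have e: "(z + real (l + m) * e - (z + real l * e)) / 2 = real m * e / 2"
      "(z + real (l + m) * e + (z + real l * e)) / 2 = z + (real l + real m / 2) * e"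
      by (simp_all add: field_simps)
    show "s (l + m) - s l = 2 * sin (real m * e / 2) * cos (z + (real l + real m / 2) * e)"
      by (simp only: s_def sin_diff_sin e)
  qed
  ultimately have "\<bar>2 * sin (real m * e / 2) * S\<bar> \<le> 3"
    using s1 s2 unfolding s_def[symmetric] by linarith
  moreover have S: "S \<ge> real m * (1 / 2)"
  proof -
    have "(\<Sum>l<m. 1 / 2 :: real) \<le> S" unfolding S_def
    proof (rule sum_mono)
      fix l assume "l \<in> {..<m}"
      hence "\<bar>z + real l * e\<bar> \<le> pi / 3" "\<bar>z + real (l + m) * e\<bar> \<le> pi / 3"
        using range[of l] range[of "l + m"] by auto
      moreover have "z + (real l + real m / 2) * e = ((z + real l * e) + (z + real (l + m) * e)) / 2"
        by (simp add: field_simps)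
      moreover have "\<bar>(p + q) / 2\<bar> \<le> r" if "\<bar>p\<bar> \<le> r" "\<bar>q\<bar> \<le> r" for p q r :: real
        using that by (auto simp: abs_le_iff field_simps)
      ultimately have "\<bar>z + (real l + real m / 2) * e\<bar> \<le> pi / 3" by metis
      thus "1 / 2 \<le> cos (z + (real l + real m / 2) * e)" by (rule half_le_cos)
    qed
    thus ?thesis by simp
  qed
  moreover have "\<bar>2 * sin (real m * e / 2) * S\<bar> = 2 * \<bar>sin (real m * e / 2)\<bar> * S"
    using S m by (simp add: abs_mult)
  moreover have "2 * \<bar>sin (real m * e / 2)\<bar> * (real m * (1 / 2)) \<le> 2 * \<bar>sin (real m * e / 2)\<bar> * S"
    using S by (intro mult_left_mono) auto
  ultimately have b: "\<bar>sin (real m * e / 2)\<bar> * real m \<le> 3" by (simp add: field_simps)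
  have "\<bar>real m * e / 2\<bar> \<le> pi / 3"
  proof -
    have "real m * e = (z + real m * e) - z" by simp
    moreover have "\<bar>z + real m * e\<bar> \<le> pi / 3" "\<bar>z\<bar> \<le> pi / 3"
      using range[of m] range[of 0] m by auto
    ultimately show ?thesis by linarith
  qed
  hence "\<bar>real m * e / 2\<bar> \<le> 2 * \<bar>sin (real m * e / 2)\<bar>" by (rule abs_le_2_sin)
  hence "\<bar>real m * e / 2\<bar> * real m \<le> 2 * \<bar>sin (real m * e / 2)\<bar> * real m"
    by (rule mult_right_mono) simp
  hence "\<bar>e\<bar> * (real m)\<^sup>2 \<le> 12" using b by (simp add: power2_eq_square abs_mult field_simps)
  thus e: "\<bar>e\<bar> \<le> 12 / (real m)\<^sup>2" using m by (simp add: field_simps)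
  have "\<bar>s l - sin z\<bar> \<le> 12 / real m" if "l < m" for l
  proof -
    have "\<bar>s l - sin z\<bar> \<le> real l * \<bar>e\<bar>"
      using sin_lipschitz[of "z + real l * e" z] by (simp add: s_def abs_mult)
    also have "\<dots> \<le> real m * (12 / (real m)\<^sup>2)" using that e by (intro mult_mono) auto
    finally show ?thesis using m by (simp add: power2_eq_square)
  qed
  hence "\<bar>\<Sum>l<m. s l - sin z\<bar> \<le> (\<Sum>l<m. 12 / real m)"
    by (intro order_trans[OF sum_abs] sum_mono) auto
  hence "\<bar>(\<Sum>l<m. s l) - real m * sin z\<bar> \<le> 12" using m by (simp add: sum_subtractf)
  hence "\<bar>real m * sin z\<bar> \<le> 13" using s1 unfolding s_def[symmetric] by linarith
  hence "\<bar>sin z\<bar> \<le> 13 / real m" using m by (simp add: abs_mult field_simps)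
  moreover have "\<bar>z\<bar> \<le> 2 * \<bar>sin z\<bar>" using range[of 0] m by (intro abs_le_2_sin) auto
  ultimately show "\<bar>z\<bar> \<le> 26 / real m" by simp
qed

lemma fan_angle_bound:
  assumes s: "\<And>i. i \<le> m \<Longrightarrow> sin (u + real i * a) > 0" and a: "0 < a" "a < pi"
  shows "real m * a < pi"
proof -
  obtain w where w: "0 \<le> w" "w \<le> pi" "sin u = sin w" "cos u = cos w"
    using s[of 0] sincos_total_pi[of "sin u" "cos u"] by auto
  have "sin w > 0" using s[of 0] w by simp
  hence w0: "0 < w" "w < pi" using w by (auto simp: order_le_less)
  have "sin (w + real i * a) > 0" if "i \<le> m" for i
    using s[OF that] by (simp add: sin_add w)
  from fan_angles[of m w a, OF this w0 a] w0 show ?thesis by simp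
qed

context hs_word
begin

text \<open>
  All tops lie above the line and all bottoms below.  First, each fan is less than a half turn, so
  that \<open>turn1\<close> and \<open>turn2\<close> lie between 0 and \<open>pi\<close>; then the edges of the first two parts and of the
  start of the third alternately go up and down.  Comparing the directions at the start of parts 1
  and 3, which differ by \<open>gap1 + gap2\<close>, shows that the turns are not close to \<open>pi\<close>.  Finally, bottoms
  that are joined to a top by a unit edge lie within distance 1 of the line.  So partial sums of the
  sines of the mean directions of the pairs of edges are bounded, and \<open>arith_prog_small\<close> applies to
  the first two parts: it bounds the drift and the inclinations of the parts, whose difference
  is essentially \<open>gap1\<close>.
\<close>

lemma coarse_confinement:
  assumes x: "x \<in> obtuse_params" and n: "n \<ge> 3" and tile: "x \<in> orbit_tile (word_W n k)" and k: "k \<ge> 20"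
  shows "\<bar>drift\<bar> \<le> 108 / (real k)\<^sup>2" "\<bar>gap1\<bar> \<le> 310 / real k" "\<bar>gap2\<bar> \<le> 310 / real k"
proof -
  obtain c t where P: "part1 (\<lambda>z. c < hgt t z) (\<lambda>z. hgt t z < c)" "part2 (\<lambda>z. c < hgt t z) (\<lambda>z. hgt t z < c)"
    "part3 (\<lambda>z. c < hgt t z) (\<lambda>z. hgt t z < c)" "part4 (\<lambda>z. c < hgt t z) (\<lambda>z. hgt t z < c)"
    and t: "0 \<le> pi + drift - t" "pi + drift - t \<le> pi"
    using tile_direction[OF x n tile] by metis
  define al be where "al = fst x" and "be = snd x"
  define X Y where "X = real n * al" and "Y = real n * be"
  have ab: "0 < al" "0 < be" "al < pi / 2" "be < pi / 2" "al < pi" "be < pi"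
    using obtuse_paramsD[OF x] unfolding al_def be_def by auto
  have l2: "leg2 x > 0" "leg1 x > 0"
    using obtuse_paramsD[OF x] by (simp_all add: leg2_def leg1_def)
  have XY: "X \<ge> 3 * al" "Y \<ge> 3 * be" using n ab by (auto simp: X_def Y_def)
  have tr: "turn1 = pi - 2 * X + 2 * al" "turn2 = pi - 2 * Y + 2 * be"
    "gap1 = pi - 2 * X" "gap2 = pi - 2 * Y"
    by (simp_all add: turn1_def turn2_def gap1_def gap2_def X_def Y_def al_def be_def algebra_simps)
  have dr: "drift = 2 * X - 2 * al - 2 * Y + 2 * be" by (simp add: drift_def tr)
  have rs: "real (Suc i) = real i + 1" for i by simp

  \<comment> \<open>the fans of \<open>T1\<close> and \<open>T2\<close> hang below tops, so they span less than a half turn\<close>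
  have k1: "k = Suc (k - 1)" using k by simp
  have 1: "2 * X - al < pi"
  proof -
    have T: "c < hgt t T1" and q: "hgt t (q3 (k - 1)) < c"
      and f: "\<And>i. i < n - 1 \<Longrightarrow> hgt t (T1 - cis (E3 + 2 * (real i + 1) * al)) < c"
      and g: "\<And>i. i < n \<Longrightarrow> hgt t (T1 - complex_of_real (leg2 x) * cis (E3 + (2 * real i + 1) * al)) < c"
      using P(3) k unfolding part3_def ball_fan al_def by auto
    have r: "real (k - 1) + 1 = real k" using k by simp
    have "p3 (Suc (k - 1)) = q3 (k - 1) + cis (th2 + (real (k - 1) + 1) * drift)"
      by (simp add: p3_def q3_def zig_Suc)
    hence "T1 = q3 (k - 1) + cis E3" unfolding T1_def E3_def r k1[symmetric] .
    hence "sin (E3 - t) > 0" using T q by (simp add: hgt_add hgt_cis)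
    moreover have "sin (E3 - t + real (2 * (i + 1)) * al) > 0" if "i < n - 1" for i
      using f[OF that] T by (simp add: hgt_diff hgt_cis algebra_simps)
    moreover have "sin (E3 - t + real (2 * i + 1) * al) > 0" if "i < n" for i
    proof -
      have "leg2 x * sin (E3 - t + real (2 * i + 1) * al) > 0"
        using g[OF that] T by (simp add: hgt_diff hgt_cis hgt_real algebra_simps)
      thus ?thesis using l2 by (simp add: zero_less_mult_iff)
    qed
    ultimately have "sin (E3 - t + real i * al) > 0" if "i \<le> 2 * n - 1" for i
    proof -
      consider "i = 0" | j where "i = 2 * (j + 1)" | j where "i = 2 * j + 1"
        by (metis One_nat_def add.commute evenE mult_eq_0_iff not0_implies_Suc oddE plus_1_eq_Suc)
      thus ?thesis
      proof cases
        case 1 thus ?thesis using \<open>sin (E3 - t) > 0\<close> by simp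
      next
        case (2 j)
        hence "j < n - 1" using that by simp
        thus ?thesis using 2 \<open>\<And>i. i < n - 1 \<Longrightarrow> 0 < sin (E3 - t + real (2 * (i + 1)) * al)\<close> by blast
      next
        case (3 j)
        hence "j < n" using that by simp
        thus ?thesis using 3 \<open>\<And>i. i < n \<Longrightarrow> 0 < sin (E3 - t + real (2 * i + 1) * al)\<close> by blast
      qed
    qed
    from fan_angle_bound[OF this ab(1,5)] have "real (2 * n - 1) * al < pi" by blast
    thus ?thesis using n by (simp add: X_def of_nat_diff algebra_simps)
  qed
  have 2: "2 * Y - be < pi"
  proof -
    have T: "c < hgt t T2" and q: "hgt t (p4 (Suc k)) < c"
      and f: "\<And>i. i < n - 1 \<Longrightarrow> hgt t (T2 - cis (E4 + 2 * (real i + 1) * be)) < c"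
      and g: "\<And>i. i < n \<Longrightarrow> hgt t (T2 - complex_of_real (leg1 x) * cis (E4 + (2 * real i + 1) * be)) < c"
      using P(4) k unfolding part4_def ball_fan be_def by auto
    have "sin (E4 - t) > 0" using T q by (simp add: T2_def hgt_add hgt_cis)
    moreover have "sin (E4 - t + real (2 * (i + 1)) * be) > 0" if "i < n - 1" for i
      using f[OF that] T by (simp add: hgt_diff hgt_cis algebra_simps)
    moreover have "sin (E4 - t + real (2 * i + 1) * be) > 0" if "i < n" for i
    proof -
      have "leg1 x * sin (E4 - t + real (2 * i + 1) * be) > 0"
        using g[OF that] T by (simp add: hgt_diff hgt_cis hgt_real algebra_simps)
      thus ?thesis using l2 by (simp add: zero_less_mult_iff)
    qed
    ultimately have "sin (E4 - t + real i * be) > 0" if "i \<le> 2 * n - 1" for i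
    proof -
      consider "i = 0" | j where "i = 2 * (j + 1)" | j where "i = 2 * j + 1"
        by (metis One_nat_def add.commute evenE mult_eq_0_iff not0_implies_Suc oddE plus_1_eq_Suc)
      thus ?thesis
      proof cases
        case 1 thus ?thesis using \<open>sin (E4 - t) > 0\<close> by simp
      next
        case (2 j)
        hence "j < n - 1" using that by simp
        thus ?thesis using 2 \<open>\<And>i. i < n - 1 \<Longrightarrow> 0 < sin (E4 - t + real (2 * (i + 1)) * be)\<close> by blast
      next
        case (3 j)
        hence "j < n" using that by simp
        thus ?thesis using 3 \<open>\<And>i. i < n \<Longrightarrow> 0 < sin (E4 - t + real (2 * i + 1) * be)\<close> by blast
      qed
    qed
    from fan_angle_bound[OF this ab(2,6)] have "real (2 * n - 1) * be < pi" by blast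
    thus ?thesis using n by (simp add: Y_def of_nat_diff algebra_simps)
  qed
  have tp: "0 < turn1" "turn1 < pi" "0 < turn2" "turn2 < pi" unfolding tr using 1 2 ab XY by linarith+
  have dpi: "\<bar>drift\<bar> < pi" unfolding dr using 1 2 ab XY by linarith

  \<comment> \<open>directions of the edges in the first part\<close>
  define u where "u = pi + drift - t"
  have T1: "c < hgt t (p1 j)" and B1': "hgt t (q1 j) < c" if "j \<le> k + 1" for j
    using P(1) that unfolding part1_def by auto
  have pq: "p1 (Suc j) = q1 j + cis (pi + real (Suc j) * drift)"
    "q1 j = p1 j + cis (pi + real j * drift - turn1)" for j
    by (simp_all add: p1_def q1_def zig_Suc add.commute)
  have up1: "sin (u + real i * drift) > 0" if "i \<le> k" for i
    using T1[of "Suc i"] B1'[of i] that by (simp add: pq(1) hgt_add hgt_cis u_def algebra_simps)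
  have down1: "sin (u + real i * drift - turn1) < 0" if "i \<le> k" for i
    using T1[of "Suc i"] B1'[of "Suc i"] that by (simp add: pq(2)[of "Suc i"] hgt_add hgt_cis u_def algebra_simps)
  have a: "0 < u + real i * drift \<and> u + real i * drift < turn1" if "i \<le> k" for i
    using zigzag_directions[of k u drift turn1 i, OF up1 down1] t dpi tp that unfolding u_def[symmetric] by linarith

  \<comment> \<open>and in the second part\<close>
  define v where "v = th1 - t"
  have v: "v = u + real k * drift + drift + gap1"
    by (simp add: v_def u_def th1_def E1_def algebra_simps)
  have T2': "c < hgt t (q2 j)" and B2': "hgt t (p2 j) < c" if "j \<le> k" for j
    using P(2) that unfolding part2_def by (auto simp: p2_def less_Suc_eq_le gr0_conv_Suc) (cases j; auto simp: p2_def)+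
  have B2'': "hgt t (p2 (Suc k)) < c" and B2: "hgt t B2 < c"
    using P(2,3) unfolding part2_def part3_def by auto
  have pq2: "q2 j = p2 j + cis (th1 - real j * drift)"
    "p2 (Suc j) = q2 j + cis (th1 - real j * drift - turn2)" for j
    by (simp_all add: p2_def q2_def zag_Suc)
  have up2: "sin (v + real i * (- drift)) > 0" if "i \<le> k" for i
    using T2'[of i] B2'[of i] that by (simp add: pq2(1) hgt_add hgt_cis v_def algebra_simps)
  have B2s: "hgt t (p2 (Suc i)) < c" if "i \<le> k" for i
    using B2'[of "Suc i"] B2'' that by (cases "i = k") auto
  have down2: "sin (v + real i * (- drift) - turn2) < 0" if "i \<le> k" for i
    using T2'[of i] B2s[of i] that by (simp add: pq2(2) hgt_add hgt_cis v_def algebra_simps)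
  have vr: "- pi < v" "v < 2 * pi"
    using a[of k] unfolding v tr dr using 1 2 ab XY by (simp_all add: algebra_simps)
  have b: "0 < v + real i * (- drift) \<and> v + real i * (- drift) < turn2" if "i \<le> k" for i
    using zigzag_directions[of k v "- drift" turn2 i, OF up2 down2] vr dpi tp that by simp

  \<comment> \<open>and at the start of the third part\<close>
  define w where "w = th2 - t"
  have w: "w = (v + real k * (- drift)) - drift + gap2"
    by (simp add: w_def v_def th2_def E2_def algebra_simps)
  have wu: "w = u + gap1 + gap2" unfolding w v by (simp add: algebra_simps)
  have "c < hgt t (p3 0)" "hgt t (q3 0) < c" using P(3) k unfolding part3_def by auto
  hence w3: "sin w > 0" "sin (w - turn1) < 0" using B2
    by (simp_all add: p3_def q3_def hgt_add hgt_cis w_def algebra_simps)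
  have wr: "- pi < w" "w < 2 * pi"
    using b[of k] unfolding w tr dr using 1 2 ab XY by (simp_all add: algebra_simps)
  have w4: "0 < w \<and> w < turn1"
    using zigzag_directions[of 0 w 0 turn1 0] w3 wr tp by simp

  \<comment> \<open>the direction at the start of part 3 is that of part 1 turned by \<open>gap1 + gap2\<close>,
    and both lie in \<open>(0, turn1)\<close>: this keeps the turns away from \<open>pi\<close>\<close>
  have kd: "real k * \<bar>drift\<bar> < pi"
  proof -
    have "\<bar>real k * drift\<bar> < pi" using a[of 0] a[of k] tp by auto
    thus ?thesis by (simp add: abs_mult)
  qed
  hence dk: "20 * \<bar>drift\<bar> < pi"
    using k mult_right_mono[of 20 "real k" "\<bar>drift\<bar>"] by simp
  have gd: "\<bar>gap2 - gap1\<bar> \<le> 3 / 2 * \<bar>drift\<bar>"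
  proof -
    have g: "gap2 - gap1 = 2 * real n * (al - be)" and d: "drift = 2 * (real n - 1) * (al - be)"
      unfolding tr dr by (simp_all add: X_def Y_def algebra_simps)
    have "2 * real n * \<bar>al - be\<bar> \<le> 3 / 2 * (2 * (real n - 1)) * \<bar>al - be\<bar>"
      using n by (intro mult_right_mono) auto
    moreover have "\<bar>gap2 - gap1\<bar> = 2 * real n * \<bar>al - be\<bar>" unfolding g by (simp add: abs_mult)
    moreover have "\<bar>drift\<bar> = 2 * (real n - 1) * \<bar>al - be\<bar>" unfolding d using n by (simp add: abs_mult)
    ultimately show ?thesis by (simp add: algebra_simps)
  qed
  have t1: "turn1 < 11 / 20 * pi"
  proof -
    have "0 < u" "u + gap1 + gap2 < turn1" using a[of 0] w4 unfolding wu by auto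
    moreover have "gap1 - gap2 \<le> 3 / 2 * \<bar>drift\<bar>"
      using gd abs_ge_minus_self[of "gap2 - gap1"] by argo
    ultimately have "2 * gap1 < turn1 + 3 / 2 * \<bar>drift\<bar>" by argo
    hence "2 * X + 2 * al > 37 / 40 * pi" using dk unfolding tr by argo
    thus ?thesis unfolding tr using XY pi_gt_zero by argo
  qed
  have t2: "turn2 < 3 / 5 * pi" using t1 dk abs_ge_self[of drift] unfolding drift_def by argo
  have mid: "\<bar>p - r / 2 + q\<bar> \<le> pi / 3" if "0 < p + q" "p + q < r" "r < 3 / 5 * pi" for p q r :: real
    using that pi_gt_zero unfolding abs_le_iff by argo
  have c12: "1 / 2 \<le> cos (turn1 / 2)" "1 / 2 \<le> cos (turn2 / 2)"
    by (rule half_le_cos, use t1 t2 tp in simp)+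

  \<comment> \<open>all bottom pivots of a part have heights between \<open>c - 1\<close> and \<open>c\<close>\<close>
  have sum1: "\<bar>\<Sum>i<m. sin ((u - turn1 / 2) + real i * drift)\<bar> \<le> 1" if m: "m \<le> k" for m
  proof -
    have h: "hgt t (q1 m) = hgt t (q1 0) + 2 * cos (turn1 / 2) * (\<Sum>i<m. sin ((u - turn1 / 2) + real i * drift))" for m
    proof (induction m)
      case (Suc m)
      have "hgt t (q1 (Suc m)) - hgt t (q1 m) = sin (u + real m * drift) + sin (u + real m * drift - turn1)"
        unfolding pq(2)[of "Suc m"] pq(1) hgt_add hgt_cis by (simp add: u_def algebra_simps)
      also have "\<dots> = 2 * sin (u + real m * drift - turn1 / 2) * cos (turn1 / 2)"
        by (subst sin_plus_sin) (simp add: field_simps)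
      finally show ?case using Suc by (simp add: algebra_simps)
    qed simp
    have r: "c - 1 < hgt t (q1 j) \<and> hgt t (q1 j) < c" if "j \<le> k + 1" for j
      using T1[OF that] B1'[OF that] sin_ge_minus_one[of "pi + real j * drift - turn1 - t"]
      unfolding pq(2)[of j] hgt_add hgt_cis by linarith
    have "\<bar>2 * cos (turn1 / 2) * (\<Sum>i<m. sin ((u - turn1 / 2) + real i * drift))\<bar> \<le> 1"
      using h[of m] r[of m] r[of 0] m by auto
    moreover have "1 * \<bar>\<Sum>i<m. sin ((u - turn1 / 2) + real i * drift)\<bar>
      \<le> (2 * cos (turn1 / 2)) * \<bar>\<Sum>i<m. sin ((u - turn1 / 2) + real i * drift)\<bar>"
      using c12 by (intro mult_right_mono) auto
    ultimately show ?thesis using c12 by (simp add: abs_mult)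
  qed
  have sum2: "\<bar>\<Sum>i<m. sin ((v - turn2 / 2) + real i * (- drift))\<bar> \<le> 1" if m: "m \<le> k" for m
  proof -
    have h: "hgt t (p2 m) = hgt t (p2 0) + 2 * cos (turn2 / 2) * (\<Sum>i<m. sin ((v - turn2 / 2) + real i * (- drift)))" for m
    proof (induction m)
      case (Suc m)
      have "hgt t (p2 (Suc m)) - hgt t (p2 m) = sin (v - real m * drift) + sin (v - real m * drift - turn2)"
        unfolding pq2(2) pq2(1) hgt_add hgt_cis by (simp add: v_def algebra_simps)
      also have "\<dots> = 2 * sin (v - real m * drift - turn2 / 2) * cos (turn2 / 2)"
        by (subst sin_plus_sin) (simp add: field_simps)
      finally show ?case using Suc by (simp add: algebra_simps)
    qed simp
    have r: "c - 1 < hgt t (p2 j) \<and> hgt t (p2 j) < c" if "j \<le> k" for j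
      using T2'[OF that] B2'[OF that] sin_le_one[of "th1 - real j * drift - t"]
      unfolding pq2(1)[of j] hgt_add hgt_cis by linarith
    have "\<bar>2 * cos (turn2 / 2) * (\<Sum>i<m. sin ((v - turn2 / 2) + real i * (- drift)))\<bar> \<le> 1"
      using h[of m] r[of m] r[of 0] m by auto
    moreover have "1 * \<bar>\<Sum>i<m. sin ((v - turn2 / 2) + real i * (- drift))\<bar>
      \<le> (2 * cos (turn2 / 2)) * \<bar>\<Sum>i<m. sin ((v - turn2 / 2) + real i * (- drift))\<bar>"
      using c12 by (intro mult_right_mono) auto
    ultimately show ?thesis using c12 by (simp add: abs_mult)
  qed
  \<comment> \<open>\<open>k \<le> 3 * m\<close> turns the bounds 12 and 26 for \<open>m\<close> into 108 and 78 for \<open>k\<close>\<close>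
  define m where "m = k div 2"
  have m: "m \<ge> 1" "2 * m \<le> k" "real k \<le> 3 * real m" using k by (auto simp: m_def)
  have A: "\<bar>drift\<bar> \<le> 12 / (real m)\<^sup>2" "\<bar>u - turn1 / 2\<bar> \<le> 26 / real m"
  proof -
    have "\<bar>(u - turn1 / 2) + real l * drift\<bar> \<le> pi / 3" if "l < 2 * m" for l
      by (rule mid) (use a[of l] that m t1 pi_gt_zero in auto)
    from arith_prog_small[OF m(1) this sum1 sum1] m
    show "\<bar>drift\<bar> \<le> 12 / (real m)\<^sup>2" "\<bar>u - turn1 / 2\<bar> \<le> 26 / real m" by auto
  qed
  have B: "\<bar>v - turn2 / 2\<bar> \<le> 26 / real m"
  proof -
    have "\<bar>(v - turn2 / 2) + real l * (- drift)\<bar> \<le> pi / 3" if "l < 2 * m" for l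
      by (rule mid) (use b[of l] that m t2 in auto)
    from arith_prog_small(2)[OF m(1) this sum2 sum2] m show ?thesis by auto
  qed
  have km: "1 / real m \<le> 3 / real k" using m k by (simp add: field_simps)
  have "12 / (real m)\<^sup>2 = 12 * (1 / real m)\<^sup>2" by (simp add: power2_eq_square)
  also have "\<dots> \<le> 12 * (3 / real k)\<^sup>2" using km by (intro mult_left_mono power_mono) auto
  finally show d: "\<bar>drift\<bar> \<le> 108 / (real k)\<^sup>2" using A(1) by (simp add: power2_eq_square)
  have kd2: "real k * \<bar>drift\<bar> \<le> 108 / real k"
    using mult_left_mono[OF d, of "real k"] k by (simp add: power2_eq_square)
  have d1: "\<bar>drift\<bar> \<le> 6 / real k"
  proof -
    have "20 * \<bar>drift\<bar> \<le> real k * \<bar>drift\<bar>" using k by (intro mult_right_mono) auto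
    thus ?thesis using kd2 by simp
  qed
  have "gap1 = (v - turn2 / 2) - (u - turn1 / 2) + drift / 2 - drift - real k * drift"
    unfolding v drift_def by (simp add: field_simps)
  moreover have "\<bar>real k * drift\<bar> \<le> 108 * (1 / real k)" using kd2 by (simp add: abs_mult)
  moreover have "26 / real m \<le> 78 * (1 / real k)" using km by simp
  moreover have "\<bar>drift\<bar> \<le> 6 * (1 / real k)" using d1 by simp
  ultimately have "gap1 \<le> 267 * (1 / real k)" "- gap1 \<le> 267 * (1 / real k)"
    using A(2) B unfolding abs_le_iff by argo+
  hence g1: "\<bar>gap1\<bar> \<le> 267 / real k" by (simp add: abs_le_iff)
  thus "\<bar>gap1\<bar> \<le> 310 / real k" using k by (simp add: field_simps)
  have "3 / 2 * \<bar>drift\<bar> \<le> 3 / 2 * (6 / real k)" by (rule mult_left_mono[OF d1]) simp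
  hence "\<bar>gap2 - gap1\<bar> \<le> 9 / real k" using gd by simp
  hence "\<bar>gap2\<bar> \<le> \<bar>gap1\<bar> + 9 / real k" using abs_triangle_ineq[of gap1 "gap2 - gap1"] by simp
  thus "\<bar>gap2\<bar> \<le> 310 / real k" using g1 k by (simp add: field_simps)
qed

end

section \<open>The critical vertices in polar form\<close>

text \<open>
  The length of a sum of \<open>m\<close> unit vectors whose directions form an arithmetic progression with
  difference \<open>d\<close>, that is, \<open>sin (m * d / 2) / sin (d / 2)\<close>, in a form that makes sense for \<open>d = 0\<close>.
\<close>

definition csum :: "nat \<Rightarrow> real \<Rightarrow> real" where
  "csum m d = (\<Sum>i<m. cos ((real i - (real m - 1) / 2) * d))"

lemma sum_cis_arith:
  "(\<Sum>i<m. cis (t + real i * d)) = complex_of_real (csum m d) * cis (t + (real m - 1) / 2 * d)"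
proof -
  let ?f = "\<lambda>i. (real i - (real m - 1) / 2) * d"
  have "(\<Sum>i<m. sin (?f i)) = (\<Sum>i<m. sin (?f (m - Suc i)))"
    by (rule sum.nat_diff_reindex[symmetric])
  also have "\<dots> = (\<Sum>i<m. - sin (?f i))"
  proof (rule sum.cong[OF refl])
    fix i assume "i \<in> {..<m}"
    hence "?f (m - Suc i) = - ?f i" by (simp add: of_nat_diff field_simps)
    thus "sin (?f (m - Suc i)) = - sin (?f i)" by simp
  qed
  finally have z: "(\<Sum>i<m. sin (?f i)) = 0" by (simp add: sum_negf)
  have "(\<Sum>i<m. cis (t + real i * d)) = (\<Sum>i<m. cis (t + (real m - 1) / 2 * d) * cis (?f i))"
    by (intro sum.cong refl) (simp add: cis_mult left_diff_distrib)
  also have "\<dots> = cis (t + (real m - 1) / 2 * d) * (\<Sum>i<m. cis (?f i))"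
    by (simp add: sum_distrib_left)
  also have "(\<Sum>i<m. cis (?f i)) = complex_of_real (csum m d)"
    using z by (simp add: complex_eq_iff csum_def)
  finally show ?thesis by (simp add: mult.commute)
qed

lemma cis_pair: "cis t + cis (t - r) = complex_of_real (2 * cos (r / 2)) * cis (t - r / 2)"
proof -
  have "cis t = cis (t - r / 2) * cis (r / 2)" "cis (t - r) = cis (t - r / 2) * cis (- (r / 2))"
    by (simp_all add: cis_mult)
  moreover have "cis (r / 2) + cis (- (r / 2)) = complex_of_real (2 * cos (r / 2))"
    by (simp add: complex_eq_iff)
  ultimately show ?thesis by (metis distrib_left mult.commute)
qed

lemma sum_cis_pairs:
  "(\<Sum>i<m. cis (t + real i * d) + cis (t + real i * d - r))
    = complex_of_real (2 * cos (r / 2) * csum m d) * cis (t - r / 2 + (real m - 1) / 2 * d)"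
proof -
  have "(\<Sum>i<m. cis (t + real i * d) + cis (t + real i * d - r))
    = (\<Sum>i<m. complex_of_real (2 * cos (r / 2)) * cis (t - r / 2 + real i * d))"
    by (intro sum.cong refl, subst cis_pair) (simp add: algebra_simps)
  thus ?thesis by (simp only: sum_distrib_left[symmetric] sum_cis_arith of_real_mult mult.assoc)
qed

lemma zag_polar:
  "zag P t r d j - P = complex_of_real (2 * cos (r / 2) * csum j d) * cis (t - r / 2 - (real j - 1) / 2 * d)"
proof -
  have c: "csum j (- d) = csum j d" by (simp add: csum_def)
  show ?thesis using sum_cis_pairs[of t "- d" r j] by (simp add: zag_def c)
qed

text \<open>
  Starting one edge earlier, at \<open>P - cis t\<close>, turns a \<open>zig\<close> into a sum of pairs as in a \<open>zag\<close>.
\<close>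

lemma zig_regroup:
  "zig P t r d j + cis (t + real j * d - r) = (P - cis t) + (\<Sum>i<Suc j. cis (t + real i * d) + cis (t + real i * d - r))"
  "zig P t r d j = (P - cis t) + (\<Sum>i<j. cis (t + real i * d) + cis (t + real i * d - r)) + cis (t + real j * d)"
  by (induction j) (simp_all add: zig_Suc algebra_simps)

context hs_word
begin

text \<open>
  Each part is a vector of length about \<open>2 * k * cos (pi / (2 * n))\<close>, followed by one more edge.  All
  directions are measured from the direction \<open>psi\<close> of part 2: then parts 1, 2, 3, 4 have the small
  directions \<open>- (gap1 + drift)\<close>, \<open>0\<close>, \<open>gap2 - drift\<close> and \<open>twist\<close>, and the lengths \<open>M1\<close>, \<open>M2\<close>, \<open>M3\<close>, \<open>M2\<close>; the
  extra edges have the directions \<open>A1\<close> to \<open>A4\<close>, close to \<open>pi / (2 * n)\<close>.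
\<close>

definition "psi = th1 - turn2 / 2 - real k * drift / 2"
definition "M1 = 2 * cos (turn1 / 2) * csum (k + 2) drift"
definition "M2 = 2 * cos (turn2 / 2) * csum (k + 1) drift"
definition "M3 = 2 * cos (turn1 / 2) * csum k drift"
definition "twist = gap2 - gap1 - drift"
definition "A1 = turn2 / 2 + real k / 2 * drift - gap1"
definition "A2 = turn2 / 2 - (real k / 2 + 1) * drift"
definition "A3 = turn2 / 2 + (real k / 2 - 1) * drift + gap2"
definition "A4 = A2 + twist"

definition "rot z = cis (- psi) * z"

lemma rot_add: "rot (y + z) = rot y + rot z" and rot_diff: "rot (y - z) = rot y - rot z"
  and rot_real: "rot (complex_of_real r * z) = complex_of_real r * rot z"
  and rot_cis: "rot (cis t) = cis (t - psi)"
  by (simp_all add: rot_def algebra_simps cis_mult)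

lemma wedge_rot: "wedge (rot y) (rot z) = wedge y z"
  unfolding rot_def by (rule wedge_mult_unit) simp

lemma edge_angles: "E1 - psi = A1" "E2 - psi = A2" "E3 - psi = A3" "E4 - psi = A4"
  by (simp_all add: E1_def th1_def E2_def th2_def E3_def th3_def E4_def psi_def A1_def A2_def A3_def
      A4_def twist_def field_simps)

lemma polar_B1: "rot (B1 - 1) = complex_of_real M1 * cis (- (gap1 + drift)) + cis A1"
proof -
  have "B1 - 1 = (\<Sum>i<Suc (Suc k). cis (pi + real i * drift) + cis (pi + real i * drift - turn1)) + cis E1"
    unfolding B1_def q1_def p1_def zig_regroup by simp
  moreover have "pi - turn1 / 2 + (real (Suc (Suc k)) - 1) / 2 * drift - psi = - (gap1 + drift)"
    by (simp add: psi_def th1_def E1_def drift_def field_simps)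
  ultimately show ?thesis
    by (simp only: sum_cis_pairs rot_add rot_real rot_cis edge_angles M1_def add_2_eq_Suc')
qed

lemma polar_B2: "rot (B2 - B1) = complex_of_real M2 + cis A2"
proof -
  have "B2 - B1 = (zag B1 th1 turn2 drift (Suc k) - B1) + cis E2" by (simp add: B2_def p2_def)
  moreover have "th1 - turn2 / 2 - (real (Suc k) - 1) / 2 * drift - psi = 0"
    by (simp add: psi_def)
  ultimately show ?thesis
    by (simp only: zag_polar rot_add rot_real rot_cis edge_angles M2_def Suc_eq_plus1[symmetric]) simp
qed

lemma polar_T1: "rot (T1 - B2) = complex_of_real M3 * cis (gap2 - drift) + cis A3"
proof -
  have "T1 - B2 = (\<Sum>i<k. cis (th2 + real i * drift) + cis (th2 + real i * drift - turn1)) + cis E3"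
    unfolding T1_def p3_def zig_regroup(2) E3_def by simp
  moreover have "th2 - turn1 / 2 + (real k - 1) / 2 * drift - psi = gap2 - drift"
    by (simp add: psi_def th2_def E2_def drift_def field_simps)
  ultimately show ?thesis
    by (simp only: sum_cis_pairs rot_add rot_real rot_cis edge_angles M3_def)
qed

lemma polar_T2: "rot (T2 - T1) = complex_of_real M2 * cis twist + cis A4"
proof -
  have "T2 - T1 = (zag T1 th3 turn2 drift (Suc k) - T1) + cis E4" by (simp add: T2_def p4_def)
  moreover have "th3 - turn2 / 2 - (real (Suc k) - 1) / 2 * drift - psi = twist"
    by (simp add: psi_def th3_def E3_def th2_def E2_def twist_def field_simps)
  ultimately show ?thesis
    by (simp only: zag_polar rot_add rot_real rot_cis edge_angles M2_def Suc_eq_plus1[symmetric])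
qed

text \<open>
  Apexes of triangles at the ends of the parts: \<open>C1\<close> and \<open>C2\<close> are the last tops of parts 1 and 2, \<open>C3\<close>
  and \<open>C4\<close> the first bottoms of part 4 and of part 1 of the next period.
\<close>

definition "C1 = B1 - complex_of_real (leg2 x) * cis (E1 - fst x)"
definition "C2 = B2 - complex_of_real (leg1 x) * cis (E2 - snd x)"
definition "C3 = T1 + complex_of_real (leg2 x) * cis (E3 - gap1 - fst x)"
definition "C4 = T2 + complex_of_real (leg1 x) * cis (E4 - gap2 - snd x)"

lemma polar_C:
  "rot (C1 - B1) = - (complex_of_real (leg2 x) * cis (A1 - fst x))"
  "rot (C2 - B2) = - (complex_of_real (leg1 x) * cis (A2 - snd x))"
  "rot (C3 - T1) = complex_of_real (leg2 x) * cis (A3 - gap1 - fst x)"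
  "rot (C4 - T2) = complex_of_real (leg1 x) * cis (A4 - gap2 - snd x)"
proof -
  have e: "E1 - fst x - psi = A1 - fst x" "E2 - snd x - psi = A2 - snd x"
    "E3 - gap1 - fst x - psi = A3 - gap1 - fst x" "E4 - gap2 - snd x - psi = A4 - gap2 - snd x"
    using edge_angles by simp_all
  show "rot (C1 - B1) = - (complex_of_real (leg2 x) * cis (A1 - fst x))"
    "rot (C2 - B2) = - (complex_of_real (leg1 x) * cis (A2 - snd x))"
    "rot (C3 - T1) = complex_of_real (leg2 x) * cis (A3 - gap1 - fst x)"
    "rot (C4 - T2) = complex_of_real (leg1 x) * cis (A4 - gap2 - snd x)"
    using rot_diff[of 0] by (simp_all add: C1_def C2_def C3_def C4_def rot_real rot_cis e rot_def[of 0])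
qed

lemma critical_vertices:
  assumes n: "n \<ge> 3"
  shows "part2 T B \<Longrightarrow> B B1 \<and> T C1" "part3 T B \<Longrightarrow> B B2 \<and> T C2 \<and> T T1 \<and> B C3"
    "part4 T B \<Longrightarrow> T T2 \<and> B C4"
proof -
  have c: "cis (E3 + (2 * real (n - 1) + 1) * fst x) = - cis (E3 - gap1 - fst x)"
    "cis (E4 + (2 * real (n - 1) + 1) * snd x) = - cis (E4 - gap2 - snd x)"
  proof -
    have e: "E3 + (2 * real (n - 1) + 1) * fst x = pi + (E3 - gap1 - fst x)"
      "E4 + (2 * real (n - 1) + 1) * snd x = pi + (E4 - gap2 - snd x)"
      using n by (simp_all add: gap1_def gap2_def of_nat_diff algebra_simps)
    show "cis (E3 + (2 * real (n - 1) + 1) * fst x) = - cis (E3 - gap1 - fst x)"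
      "cis (E4 + (2 * real (n - 1) + 1) * snd x) = - cis (E4 - gap2 - snd x)"
      unfolding e by (simp_all add: complex_eq_iff)
  qed
  have n0: "0 < n" "n - 1 < n" using n by simp_all
  { assume p: "part2 T B"
    hence "\<forall>i<n. T (B1 - complex_of_real (leg2 x) * cis (E1 + (2 * real i + 1) * - fst x))"
      unfolding part2_def ball_fan by blast
    from this[rule_format, of 0] show "B B1 \<and> T C1" using p n0 by (simp add: part2_def C1_def) }
  { assume p: "part3 T B"
    hence "\<forall>i<n. T (B2 - complex_of_real (leg1 x) * cis (E2 + (2 * real i + 1) * - snd x))"
      "\<forall>i<n. B (T1 - complex_of_real (leg2 x) * cis (E3 + (2 * real i + 1) * fst x))"
      unfolding part3_def ball_fan by blast+
    from this(1)[rule_format, of 0] this(2)[rule_format, of "n - 1"]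
    show "B B2 \<and> T C2 \<and> T T1 \<and> B C3" using p n0 c by (simp add: part3_def C2_def C3_def) }
  { assume p: "part4 T B"
    hence "\<forall>i<n. B (T2 - complex_of_real (leg1 x) * cis (E4 + (2 * real i + 1) * snd x))"
      unfolding part4_def ball_fan by blast+
    from this[rule_format, of "n - 1"]
    show "T T2 \<and> B C4" using p n0 c by (simp add: part4_def C4_def) }
qed

end

section \<open>Asymptotics\<close>

lemma scaled_deriv:
  assumes "DERIV f a :> l" "(\<lambda>j. k j * (e j - a)) \<longlonglongrightarrow> y" "e \<longlonglongrightarrow> a"
  shows "(\<lambda>j. k j * (f (e j) - f a)) \<longlonglongrightarrow> l * y"
proof -
  obtain g where g: "\<And>z. f z - f a = g z * (z - a)" "isCont g a" "g a = l"
    using assms(1) by (auto simp: CARAT_DERIV)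
  have "(\<lambda>j. g (e j)) \<longlonglongrightarrow> l" using isCont_tendsto_compose[OF g(2) assms(3)] g(3) by simp
  from tendsto_mult[OF this assms(2)] show ?thesis by (simp add: g(1) mult_ac)
qed

lemma csum_bound: "\<bar>csum m d - real m\<bar> \<le> real m * (real m * \<bar>d\<bar>)\<^sup>2"
proof -
  have "csum m d - real m = (\<Sum>i<m. cos ((real i - (real m - 1) / 2) * d) - 1)"
    by (simp add: csum_def sum_subtractf)
  also have "\<bar>\<dots>\<bar> \<le> (\<Sum>i<m. (real m * \<bar>d\<bar>)\<^sup>2)"
  proof (intro order_trans[OF sum_abs] sum_mono)
    fix i assume i: "i \<in> {..<m}"
    define t where "t = (real i - (real m - 1) / 2) * d"
    have "cos t - 1 = - (2 * (sin (t / 2))\<^sup>2)"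
      using cos_double_sin[of "t / 2"] by simp
    hence "\<bar>cos t - 1\<bar> = 2 * \<bar>sin (t / 2)\<bar>\<^sup>2" by simp
    also have "\<dots> \<le> 2 * \<bar>t / 2\<bar>\<^sup>2"
      by (intro mult_left_mono power_mono abs_sin_x_le_abs_x) auto
    also have "\<dots> \<le> \<bar>t\<bar>\<^sup>2" by (simp add: power2_eq_square field_simps)
    also have "\<bar>t\<bar> \<le> real m * \<bar>d\<bar>"
    proof -
      have "\<bar>real i - (real m - 1) / 2\<bar> \<le> real m" using i by (auto simp: abs_le_iff field_simps)
      thus ?thesis unfolding t_def abs_mult by (rule mult_right_mono) simp
    qed
    hence "\<bar>t\<bar>\<^sup>2 \<le> (real m * \<bar>d\<bar>)\<^sup>2" by (intro power_mono) auto
    finally show "\<bar>cos ((real i - (real m - 1) / 2) * d) - 1\<bar> \<le> (real m * \<bar>d\<bar>)\<^sup>2"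
      by (simp add: t_def)
  qed
  finally show ?thesis by simp
qed

text \<open>
  A sequence of parameters, at the scale where the estimates of \<open>coarse_confinement\<close> hold: after
  passing to a subsequence, \<open>k * gap1\<close> and \<open>k\<^sup>2 * drift\<close> converge.
\<close>

locale hs_seq =
  fixes n :: nat and X :: "nat \<Rightarrow> real \<times> real" and K :: "nat \<Rightarrow> nat" and ga De :: real
  assumes n: "n \<ge> 3" and K: "filterlim K at_top sequentially"
    and lim_gap1: "(\<lambda>j. real (K j) * hs_word.gap1 (X j) n) \<longlonglongrightarrow> ga"
    and lim_drift: "(\<lambda>j. (real (K j))\<^sup>2 * hs_word.drift (X j) n) \<longlonglongrightarrow> De"
begin

definition "k j = real (K j)"
definition "g1 j = hs_word.gap1 (X j) n"
definition "g2 j = hs_word.gap2 (X j) n"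
definition "D j = hs_word.drift (X j) n"
definition "tw j = hs_word.twist (X j) n"
definition "lam = pi / (2 * real n)"
definition "c = cos lam"
definition "s = sin lam"
definition "M1 j = hs_word.M1 (X j) n (K j)"
definition "M2 j = hs_word.M2 (X j) n (K j)"
definition "M3 j = hs_word.M3 (X j) n (K j)"
definition "A1 j = hs_word.A1 (X j) n (K j)"
definition "A2 j = hs_word.A2 (X j) n (K j)"
definition "A3 j = hs_word.A3 (X j) n (K j)"
definition "A4 j = hs_word.A4 (X j) n (K j)"

lemma lam_bounds: "0 < lam" "lam \<le> pi / 6" "0 < c" "0 < s" "c\<^sup>2 + s\<^sup>2 = 1"
proof -
  show l: "0 < lam" using n by (simp add: lam_def)
  show l': "lam \<le> pi / 6" unfolding lam_def using n by (intro divide_left_mono) auto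
  show "0 < c" unfolding c_def by (rule cos_gt_zero_pi) (use l l' pi_gt_zero in auto)
  show "0 < s" unfolding s_def by (rule sin_gt_zero) (use l l' pi_gt_zero in auto)
  show "c\<^sup>2 + s\<^sup>2 = 1" by (simp add: c_def s_def)
qed

lemma k_at_top: "filterlim k at_top sequentially"
  unfolding k_def by (rule filterlim_compose[OF filterlim_real_sequentially K])

lemma k_pos: "eventually (\<lambda>j. k j > 0) sequentially"
  using k_at_top by (simp add: filterlim_at_top_dense)

lemma inv_k: "(\<lambda>j. 1 / k j) \<longlonglongrightarrow> 0"
  by (rule tendsto_divide_0[OF tendsto_const filterlim_at_top_imp_at_infinity[OF k_at_top]])

lemma unscale: "(\<lambda>j. k j * f j) \<longlonglongrightarrow> y \<Longrightarrow> f \<longlonglongrightarrow> 0"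
proof -
  assume "(\<lambda>j. k j * f j) \<longlonglongrightarrow> y"
  from tendsto_mult[OF this inv_k] have "(\<lambda>j. k j * f j * (1 / k j)) \<longlonglongrightarrow> 0" by simp
  thus ?thesis by (rule Lim_transform_eventually) (use k_pos in eventually_elim, simp)
qed

text \<open>All the angles are linear functions of \<open>gap1\<close> and \<open>drift\<close>.\<close>

lemma relations:
  "fst (X j) = lam - g1 j / (2 * real n)" "snd (X j) = lam - g2 j / (2 * real n)"
  "hs_word.turn1 (X j) n = 2 * lam + (real n - 1) / real n * g1 j"
  "hs_word.turn2 (X j) n = 2 * lam + (real n - 1) / real n * g2 j"
  "g2 j = g1 j + real n / (real n - 1) * D j" "tw j = D j / (real n - 1)"
proof -
  have n': "real n > 0" "real n - 1 > 0" using n by simp_all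
  show a: "fst (X j) = lam - g1 j / (2 * real n)" "snd (X j) = lam - g2 j / (2 * real n)"
    using n' by (simp_all add: lam_def g1_def g2_def hs_word.gap1_def hs_word.gap2_def field_simps)
  show t: "hs_word.turn1 (X j) n = 2 * lam + (real n - 1) / real n * g1 j"
    "hs_word.turn2 (X j) n = 2 * lam + (real n - 1) / real n * g2 j"
    unfolding hs_word.turn1_def hs_word.turn2_def a using n' by (simp_all add: lam_def field_simps)
  have d: "D j = (real n - 1) / real n * (g2 j - g1 j)"
    unfolding D_def hs_word.drift_def t by (simp add: algebra_simps)
  thus g: "g2 j = g1 j + real n / (real n - 1) * D j" using n' by simp
  have "tw j = g2 j - g1 j - D j" by (simp add: tw_def hs_word.twist_def g1_def g2_def D_def)
  thus "tw j = D j / (real n - 1)" unfolding g using n' by (simp add: field_simps)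
qed

lemma angles:
  "A1 j = hs_word.turn2 (X j) n / 2 + k j / 2 * D j - g1 j"
  "A2 j = hs_word.turn2 (X j) n / 2 - (k j / 2 + 1) * D j"
  "A3 j = hs_word.turn2 (X j) n / 2 + (k j / 2 - 1) * D j + g2 j"
  "A4 j = A2 j + tw j"
  by (simp_all add: A1_def A2_def A3_def A4_def hs_word.A1_def hs_word.A2_def hs_word.A3_def
      hs_word.A4_def D_def g1_def g2_def tw_def k_def)

lemma lim_kk_D: "(\<lambda>j. k j * (k j * D j)) \<longlonglongrightarrow> De"
  using lim_drift by (simp add: k_def D_def power2_eq_square mult.assoc)

lemma lim_k_D: "(\<lambda>j. k j * D j) \<longlonglongrightarrow> 0"
  by (rule unscale[OF lim_kk_D])

lemma lim_k_g1: "(\<lambda>j. k j * g1 j) \<longlonglongrightarrow> ga"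
  using lim_gap1 by (simp add: k_def g1_def)

lemma lim_k_g2: "(\<lambda>j. k j * g2 j) \<longlonglongrightarrow> ga"
proof -
  have "(\<lambda>j. k j * g1 j + real n / (real n - 1) * (k j * D j)) \<longlonglongrightarrow> ga + real n / (real n - 1) * 0"
    by (intro tendsto_intros lim_k_g1 lim_k_D)
  thus ?thesis by (simp add: relations(5) algebra_simps)
qed

lemma lim_g: "g1 \<longlonglongrightarrow> 0" "g2 \<longlonglongrightarrow> 0" "D \<longlonglongrightarrow> 0" "tw \<longlonglongrightarrow> 0"
proof -
  show "g1 \<longlonglongrightarrow> 0" "g2 \<longlonglongrightarrow> 0" and d: "D \<longlonglongrightarrow> 0"
    by (rule unscale[OF lim_k_g1], rule unscale[OF lim_k_g2], rule unscale[OF lim_k_D])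
  have "tw = (\<lambda>j. D j / (real n - 1))" by (rule ext) (rule relations(6))
  thus "tw \<longlonglongrightarrow> 0" using tendsto_divide[OF d tendsto_const, of "real n - 1"] n by simp
qed

lemma lim_kk_tw: "(\<lambda>j. k j * (k j * tw j)) \<longlonglongrightarrow> De / (real n - 1)"
  using tendsto_divide[OF lim_kk_D tendsto_const, of "real n - 1"] n by (simp add: relations(6))

lemma lim_k_tw: "(\<lambda>j. k j * tw j) \<longlonglongrightarrow> 0"
  by (rule unscale[OF lim_kk_tw])

lemma lim_csum: "(\<lambda>j. csum (K j + h) (D j) - k j) \<longlonglongrightarrow> real h"
proof -
  have "(\<lambda>j. csum (K j + h) (D j) - real (K j + h)) \<longlonglongrightarrow> 0"
  proof (rule Lim_null_comparison)
    show "\<forall>\<^sub>F j in sequentially. norm (csum (K j + h) (D j) - real (K j + h))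
        \<le> (1 + real h * (1 / k j))^3 * (k j * (k j * D j))\<^sup>2 * (1 / k j)"
      using k_pos
    proof eventually_elim
      case (elim j)
      have "norm (csum (K j + h) (D j) - real (K j + h)) \<le> (k j + real h) * ((k j + real h) * \<bar>D j\<bar>)\<^sup>2"
        using csum_bound[of "K j + h" "D j"] by (simp add: k_def)
      also have "\<dots> = (1 + real h * (1 / k j))^3 * (k j * (k j * D j))\<^sup>2 * (1 / k j)"
        using elim by (simp add: field_simps power2_eq_square power3_eq_cube)
      finally show ?case .
    qed
    have "(\<lambda>j. (1 + real h * (1 / k j))^3 * (k j * (k j * D j))\<^sup>2 * (1 / k j)) \<longlonglongrightarrow> (1 + real h * 0)^3 * De\<^sup>2 * 0"
      by (intro tendsto_intros inv_k lim_kk_D)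
    thus "(\<lambda>j. (1 + real h * (1 / k j))^3 * (k j * (k j * D j))\<^sup>2 * (1 / k j)) \<longlonglongrightarrow> 0" by simp
  qed
  from tendsto_add[OF this tendsto_const, of "real h"] show ?thesis by (simp add: k_def)
qed

definition "kap = - (s * ((real n - 1) / real n * ga))"

lemma lim_len:
  assumes g: "(\<lambda>j. k j * g j) \<longlonglongrightarrow> ga"
  shows "(\<lambda>j. 2 * cos ((2 * lam + (real n - 1) / real n * g j) / 2) * csum (K j + h) (D j) - 2 * c * k j)
    \<longlonglongrightarrow> 2 * c * real h + kap"
proof -
  let ?e = "\<lambda>j. (2 * lam + (real n - 1) / real n * g j) / 2"
  have g0: "g \<longlonglongrightarrow> 0" by (rule unscale[OF g])
  have "?e \<longlonglongrightarrow> (2 * lam + (real n - 1) / real n * 0) / 2" by (intro tendsto_intros g0) simp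
  hence e: "?e \<longlonglongrightarrow> lam" by simp
  have "(\<lambda>j. (real n - 1) / real n * (k j * g j) / 2) \<longlonglongrightarrow> (real n - 1) / real n * ga / 2"
    by (intro tendsto_intros g) simp
  hence ke: "(\<lambda>j. k j * (?e j - lam)) \<longlonglongrightarrow> (real n - 1) / real n * ga / 2"
    by (simp add: field_simps)
  have "(\<lambda>j. k j * (cos (?e j) - c)) \<longlonglongrightarrow> - s * ((real n - 1) / real n * ga / 2)"
    unfolding c_def s_def by (rule scaled_deriv[OF _ ke e]) (auto intro!: derivative_eq_intros)
  moreover have "(\<lambda>j. cos (?e j)) \<longlonglongrightarrow> c" unfolding c_def by (intro tendsto_intros e)
  ultimately have "(\<lambda>j. 2 * (k j * (cos (?e j) - c)) + 2 * cos (?e j) * (csum (K j + h) (D j) - k j))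
    \<longlonglongrightarrow> 2 * (- s * ((real n - 1) / real n * ga / 2)) + 2 * c * real h"
    by (rule tendsto_add[OF tendsto_mult[OF tendsto_const] tendsto_mult[OF tendsto_mult[OF tendsto_const] lim_csum]])
  moreover have "2 * (- s * ((real n - 1) / real n * ga / 2)) + 2 * c * real h = 2 * c * real h + kap"
    by (simp add: kap_def)
  moreover have "(\<lambda>j. 2 * (k j * (cos (?e j) - c)) + 2 * cos (?e j) * (csum (K j + h) (D j) - k j))
     = (\<lambda>j. 2 * cos (?e j) * csum (K j + h) (D j) - 2 * c * k j)"
    by (rule ext) (simp add: algebra_simps)
  ultimately show ?thesis by (simp only:)
qed

lemma lim_M:
  "(\<lambda>j. M1 j - 2 * c * k j) \<longlonglongrightarrow> 4 * c + kap"
  "(\<lambda>j. M2 j - 2 * c * k j) \<longlonglongrightarrow> 2 * c + kap"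
  "(\<lambda>j. M3 j - 2 * c * k j) \<longlonglongrightarrow> kap"
  using lim_len[OF lim_k_g1, of 2] lim_len[OF lim_k_g2, of 1] lim_len[OF lim_k_g1, of 0]
  by (simp_all add: M1_def M2_def M3_def hs_word.M1_def hs_word.M2_def hs_word.M3_def relations(3,4)
      D_def[symmetric])

lemma ratio: "(\<lambda>j. f j - a * k j) \<longlonglongrightarrow> y \<Longrightarrow> (\<lambda>j. f j / k j) \<longlonglongrightarrow> a"
proof -
  assume "(\<lambda>j. f j - a * k j) \<longlonglongrightarrow> y"
  from tendsto_add[OF tendsto_mult[OF this inv_k] tendsto_const, of a]
  have "(\<lambda>j. (f j - a * k j) * (1 / k j) + a) \<longlonglongrightarrow> a" by simp
  thus ?thesis
    by (rule Lim_transform_eventually) (use k_pos in eventually_elim, simp add: field_simps)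
qed

lemma lim_Mk: "(\<lambda>j. M1 j / k j) \<longlonglongrightarrow> 2 * c" "(\<lambda>j. M2 j / k j) \<longlonglongrightarrow> 2 * c" "(\<lambda>j. M3 j / k j) \<longlonglongrightarrow> 2 * c"
  by (rule ratio[OF lim_M(1)], rule ratio[OF lim_M(2)], rule ratio[OF lim_M(3)])

definition "nu = (real n - 1) / (2 * real n) * ga"

lemma lim_k_A:
  "(\<lambda>j. k j * (A1 j - lam)) \<longlonglongrightarrow> nu + De / 2 - ga"
  "(\<lambda>j. k j * (A2 j - lam)) \<longlonglongrightarrow> nu - De / 2"
  "(\<lambda>j. k j * (A3 j - lam)) \<longlonglongrightarrow> nu + De / 2 + ga"
  "(\<lambda>j. k j * (A4 j - lam)) \<longlonglongrightarrow> nu - De / 2"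
proof -
  let ?m = "(real n - 1) / (2 * real n)"
  have n': "real n > 0" using n by simp
  have t: "hs_word.turn2 (X j) n / 2 = lam + ?m * g2 j" for j
    using n' by (simp add: relations(4) field_simps)
  have "(\<lambda>j. ?m * (k j * g2 j) + (k j * (k j * D j)) / 2 - k j * g1 j) \<longlonglongrightarrow> ?m * ga + De / 2 - ga"
    by (intro tendsto_intros lim_k_g1 lim_k_g2 lim_kk_D) simp
  moreover have "k j * (A1 j - lam) = ?m * (k j * g2 j) + (k j * (k j * D j)) / 2 - k j * g1 j" for j
    unfolding angles t by (simp add: algebra_simps)
  ultimately show "(\<lambda>j. k j * (A1 j - lam)) \<longlonglongrightarrow> nu + De / 2 - ga" by (simp add: nu_def)
  have "(\<lambda>j. ?m * (k j * g2 j) - (k j * (k j * D j)) / 2 - k j * D j) \<longlonglongrightarrow> ?m * ga - De / 2 - 0"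
    by (intro tendsto_intros lim_k_D lim_k_g2 lim_kk_D) simp
  moreover have "k j * (A2 j - lam) = ?m * (k j * g2 j) - (k j * (k j * D j)) / 2 - k j * D j" for j
    unfolding angles t by (simp add: algebra_simps)
  ultimately show A2: "(\<lambda>j. k j * (A2 j - lam)) \<longlonglongrightarrow> nu - De / 2" by (simp add: nu_def)
  have "(\<lambda>j. ?m * (k j * g2 j) + (k j * (k j * D j)) / 2 - k j * D j + k j * g2 j) \<longlonglongrightarrow> ?m * ga + De / 2 - 0 + ga"
    by (intro tendsto_intros lim_k_D lim_k_g2 lim_kk_D) simp
  moreover have "k j * (A3 j - lam) = ?m * (k j * g2 j) + (k j * (k j * D j)) / 2 - k j * D j + k j * g2 j" for j
    unfolding angles t by (simp add: algebra_simps)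
  ultimately show "(\<lambda>j. k j * (A3 j - lam)) \<longlonglongrightarrow> nu + De / 2 + ga" by (simp add: nu_def)
  from tendsto_add[OF A2 lim_k_tw] show "(\<lambda>j. k j * (A4 j - lam)) \<longlonglongrightarrow> nu - De / 2"
    by (simp add: angles(4) algebra_simps)
qed

lemma lim_from_k: "(\<lambda>j. k j * (f j - a)) \<longlonglongrightarrow> y \<Longrightarrow> f \<longlonglongrightarrow> a"
  using unscale[of "\<lambda>j. f j - a"] by (simp add: LIM_zero_iff)

lemma lim_angle: "(\<lambda>j. fst (X j)) \<longlonglongrightarrow> lam" "(\<lambda>j. snd (X j)) \<longlonglongrightarrow> lam"
proof -
  have "(\<lambda>j. lam - g1 j / (2 * real n)) \<longlonglongrightarrow> lam - 0 / (2 * real n)"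
    "(\<lambda>j. lam - g2 j / (2 * real n)) \<longlonglongrightarrow> lam - 0 / (2 * real n)"
    using n by (intro tendsto_intros lim_g; simp)+
  thus "(\<lambda>j. fst (X j)) \<longlonglongrightarrow> lam" "(\<lambda>j. snd (X j)) \<longlonglongrightarrow> lam" by (simp_all add: relations)
qed

lemma lim_leg: "(\<lambda>j. leg1 (X j)) \<longlonglongrightarrow> 1 / (2 * c)" "(\<lambda>j. leg2 (X j)) \<longlonglongrightarrow> 1 / (2 * c)"
proof -
  have d: "sin (lam + lam) = 2 * s * c" by (simp add: s_def c_def sin_double[symmetric])
  hence "sin (lam + lam) \<noteq> 0" using lam_bounds by simp
  hence "(\<lambda>j. leg1 (X j)) \<longlonglongrightarrow> sin lam / sin (lam + lam)" "(\<lambda>j. leg2 (X j)) \<longlonglongrightarrow> sin lam / sin (lam + lam)"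
    unfolding leg1_def leg2_def by (intro tendsto_intros lim_angle; simp)+
  moreover have "sin lam / sin (lam + lam) = 1 / (2 * c)"
    unfolding d using lam_bounds by (simp add: s_def)
  ultimately show "(\<lambda>j. leg1 (X j)) \<longlonglongrightarrow> 1 / (2 * c)" "(\<lambda>j. leg2 (X j)) \<longlonglongrightarrow> 1 / (2 * c)" by simp_all
qed

text \<open>
  An expansion \<open>Re v = 2 * c * m * k + r + o(1)\<close> and \<open>Im v = m' * s + y / k + o(1 / k)\<close>: the vector
  consists of \<open>m\<close> parts, each of length about \<open>2 * c * k\<close>, and of \<open>m'\<close> extra edges, each of which rises
  by \<open>s\<close>.  This precision determines \<open>wedge d v\<close> up to \<open>o(1)\<close>, as \<open>d\<close> has length of order \<open>k\<close>.
\<close>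

definition expn :: "(nat \<Rightarrow> complex) \<Rightarrow> real \<Rightarrow> real \<Rightarrow> real \<Rightarrow> real \<Rightarrow> bool" where
  "expn v m m' r y \<longleftrightarrow> (\<lambda>j. Re (v j) - 2 * c * m * k j) \<longlonglongrightarrow> r \<and> (\<lambda>j. k j * (Im (v j) - m' * s)) \<longlonglongrightarrow> y"

lemma expn_add: "expn v m m' r y \<Longrightarrow> expn w l l' q z \<Longrightarrow> expn (\<lambda>j. v j + w j) (m + l) (m' + l') (r + q) (y + z)"
proof -
  assume v: "expn v m m' r y" and w: "expn w l l' q z"
  have "(\<lambda>j. (Re (v j) - 2 * c * m * k j) + (Re (w j) - 2 * c * l * k j)) \<longlonglongrightarrow> r + q"
    "(\<lambda>j. k j * (Im (v j) - m' * s) + k j * (Im (w j) - l' * s)) \<longlonglongrightarrow> y + z"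
    using v w unfolding expn_def by (auto intro!: tendsto_add)
  thus ?thesis unfolding expn_def by (simp add: algebra_simps)
qed

lemma expn_minus: "expn v m m' r y \<Longrightarrow> expn (\<lambda>j. - v j) (- m) (- m') (- r) (- y)"
proof -
  assume v: "expn v m m' r y"
  have a: "(\<lambda>j. Re (v j) - 2 * c * m * k j) \<longlonglongrightarrow> r"
    and b: "(\<lambda>j. k j * (Im (v j) - m' * s)) \<longlonglongrightarrow> y"
    using v unfolding expn_def by blast+
  from tendsto_minus[OF a] tendsto_minus[OF b]
  show ?thesis unfolding expn_def by (simp add: algebra_simps)
qed

lemma expn_edge:
  assumes "(\<lambda>j. k j * (A j - lam)) \<longlonglongrightarrow> y"
  shows "expn (\<lambda>j. cis (A j)) 0 1 c (c * y)"
proof -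
  have A: "A \<longlonglongrightarrow> lam" by (rule lim_from_k[OF assms])
  have "(\<lambda>j. k j * (sin (A j) - sin lam)) \<longlonglongrightarrow> cos lam * y"
    by (rule scaled_deriv[OF _ assms A]) (auto intro!: derivative_eq_intros)
  moreover have "(\<lambda>j. cos (A j)) \<longlonglongrightarrow> cos lam" by (intro tendsto_intros A)
  ultimately show ?thesis by (simp add: expn_def c_def s_def)
qed

lemma expn_off:
  assumes A: "(\<lambda>j. k j * A j) \<longlonglongrightarrow> y" and l: "l \<longlonglongrightarrow> 1 / (2 * c)"
  shows "expn (\<lambda>j. complex_of_real (l j) * cis (A j)) 0 0 (1 / (2 * c)) (1 / (2 * c) * y)"
proof -
  have A0: "A \<longlonglongrightarrow> 0" by (rule unscale[OF A])
  have "(\<lambda>j. k j * (sin (A j) - sin 0)) \<longlonglongrightarrow> cos 0 * y"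
    by (rule scaled_deriv[OF _ _ A0]) (use A in \<open>auto intro!: derivative_eq_intros\<close>)
  hence "(\<lambda>j. l j * (k j * sin (A j))) \<longlonglongrightarrow> 1 / (2 * c) * y" using l by (intro tendsto_mult) simp_all
  moreover have "(\<lambda>j. l j * cos (A j)) \<longlonglongrightarrow> 1 / (2 * c) * cos 0" by (intro tendsto_intros A0 l)
  ultimately show ?thesis by (simp add: expn_def mult_ac)
qed

lemma expn_part:
  assumes M: "(\<lambda>j. M j - 2 * c * k j) \<longlonglongrightarrow> r" and A: "(\<lambda>j. k j * (k j * A j)) \<longlonglongrightarrow> y"
  shows "expn (\<lambda>j. complex_of_real (M j) * cis (A j)) 1 0 r (2 * c * y)"
proof -
  have kA: "(\<lambda>j. k j * A j) \<longlonglongrightarrow> 0" by (rule unscale[OF A])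
  have A0: "A \<longlonglongrightarrow> 0" by (rule unscale[OF kA])
  have Mk: "(\<lambda>j. M j / k j) \<longlonglongrightarrow> 2 * c" by (rule ratio[OF M])
  have "(\<lambda>j. (k j * k j) * (sin (A j) - sin 0)) \<longlonglongrightarrow> cos 0 * y"
    by (rule scaled_deriv[OF _ _ A0]) (use A in \<open>auto intro!: derivative_eq_intros simp: mult.assoc\<close>)
  hence "(\<lambda>j. (M j / k j) * (k j * k j * sin (A j))) \<longlonglongrightarrow> 2 * c * y" using Mk by (intro tendsto_mult) simp_all
  hence Im: "(\<lambda>j. k j * (M j * sin (A j))) \<longlonglongrightarrow> 2 * c * y"
    by (rule Lim_transform_eventually) (use k_pos in eventually_elim, simp)
  have "(\<lambda>j. k j * (cos (A j) - cos 0)) \<longlonglongrightarrow> - sin 0 * 0"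
    by (rule scaled_deriv[OF _ _ A0]) (use kA in \<open>auto intro!: derivative_eq_intros\<close>)
  hence "(\<lambda>j. (M j - 2 * c * k j) + (M j / k j) * (k j * (cos (A j) - 1))) \<longlonglongrightarrow> r + 2 * c * 0"
    using Mk M by (intro tendsto_intros) simp_all
  hence "(\<lambda>j. M j * cos (A j) - 2 * c * k j) \<longlonglongrightarrow> r"
    by (subst (asm) mult_zero_right, subst (asm) add_0_right, elim Lim_transform_eventually)
       (use k_pos in eventually_elim, simp add: algebra_simps)
  thus ?thesis using Im by (simp add: expn_def)
qed

text \<open>The terms of order \<open>k\<close> cancel, because \<open>v\<close> and \<open>d\<close> have the same ratio of parts and extra edges.\<close>

lemma expn_wedge:
  assumes d: "expn d 4 4 (12 * c) g" and v: "expn v m m r y"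
  shows "(\<lambda>j. wedge (d j) (v j)) \<longlonglongrightarrow> 8 * c * y + 12 * c * m * s - 4 * s * r - 2 * c * m * g"
proof -
  define a where "a j = Re (d j) - 2 * c * 4 * k j" for j
  define b where "b j = k j * (Im (d j) - 4 * s)" for j
  define p where "p j = Re (v j) - 2 * c * m * k j" for j
  define q where "q j = k j * (Im (v j) - m * s)" for j
  have l: "a \<longlonglongrightarrow> 12 * c" "b \<longlonglongrightarrow> g" "p \<longlonglongrightarrow> r" "q \<longlonglongrightarrow> y"
    using d v unfolding expn_def a_def[abs_def] b_def[abs_def] p_def[abs_def] q_def[abs_def] by blast+
  have "(\<lambda>j. 8 * c * q j + a j * m * s + a j * q j * (1 / k j) - 4 * s * p j - 2 * c * m * b j - b j * p j * (1 / k j))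
    \<longlonglongrightarrow> 8 * c * y + 12 * c * m * s + 12 * c * y * 0 - 4 * s * r - 2 * c * m * g - g * r * 0"
    by (intro tendsto_intros l inv_k)
  hence "(\<lambda>j. wedge (d j) (v j)) \<longlonglongrightarrow> 8 * c * y + 12 * c * m * s + 12 * c * y * 0 - 4 * s * r - 2 * c * m * g - g * r * 0"
  proof (rule Lim_transform_eventually)
    show "\<forall>\<^sub>F j in sequentially. 8 * c * q j + a j * m * s + a j * q j * (1 / k j) - 4 * s * p j - 2 * c * m * b j - b j * p j * (1 / k j)
      = wedge (d j) (v j)"
      using k_pos
    proof eventually_elim
      case (elim j)
      have r: "Re (d j) = 8 * c * k j + a j" "Im (d j) = 4 * s + b j / k j"
        "Re (v j) = 2 * c * m * k j + p j" "Im (v j) = m * s + q j / k j"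
        using elim by (simp_all add: a_def b_def p_def q_def)
      show ?case unfolding wedge_alt r using elim by (simp add: field_simps)
    qed
  qed
  thus ?thesis by simp
qed

end

context hs_seq
begin

definition "vec_d j = hs_word.rot (X j) n (K j) (hs_word.T2 (X j) n (K j) - 1)"

lemma polar_all:
  "hs_word.rot (X j) n (K j) (hs_word.B1 (X j) n (K j) - 1) = complex_of_real (M1 j) * cis (- (g1 j + D j)) + cis (A1 j)"
  "hs_word.rot (X j) n (K j) (hs_word.B2 (X j) n (K j) - hs_word.B1 (X j) n (K j)) = complex_of_real (M2 j) * cis 0 + cis (A2 j)"
  "hs_word.rot (X j) n (K j) (hs_word.T1 (X j) n (K j) - hs_word.B2 (X j) n (K j)) = complex_of_real (M3 j) * cis (g2 j - D j) + cis (A3 j)"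
  "hs_word.rot (X j) n (K j) (hs_word.T2 (X j) n (K j) - hs_word.T1 (X j) n (K j)) = complex_of_real (M2 j) * cis (tw j) + cis (A4 j)"
  "hs_word.rot (X j) n (K j) (hs_word.C1 (X j) n (K j) - hs_word.B1 (X j) n (K j)) = - (complex_of_real (leg2 (X j)) * cis (A1 j - fst (X j)))"
  "hs_word.rot (X j) n (K j) (hs_word.C2 (X j) n (K j) - hs_word.B2 (X j) n (K j)) = - (complex_of_real (leg1 (X j)) * cis (A2 j - snd (X j)))"
  "hs_word.rot (X j) n (K j) (hs_word.C3 (X j) n (K j) - hs_word.T1 (X j) n (K j)) = complex_of_real (leg2 (X j)) * cis (A3 j - g1 j - fst (X j))"
  "hs_word.rot (X j) n (K j) (hs_word.C4 (X j) n (K j) - hs_word.T2 (X j) n (K j)) = complex_of_real (leg1 (X j)) * cis (A4 j - g2 j - snd (X j))"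
  unfolding hs_word.polar_B1 hs_word.polar_B2 hs_word.polar_T1 hs_word.polar_T2 hs_word.polar_C
    M1_def M2_def M3_def A1_def A2_def A3_def A4_def g1_def g2_def D_def tw_def
  by simp_all

lemma lim_k_angle: "(\<lambda>j. k j * (fst (X j) - lam)) \<longlonglongrightarrow> - (ga / (2 * real n))"
  "(\<lambda>j. k j * (snd (X j) - lam)) \<longlonglongrightarrow> - (ga / (2 * real n))"
proof -
  have "(\<lambda>j. - (k j * g1 j / (2 * real n))) \<longlonglongrightarrow> - (ga / (2 * real n))"
    "(\<lambda>j. - (k j * g2 j / (2 * real n))) \<longlonglongrightarrow> - (ga / (2 * real n))"
    using n by (intro tendsto_intros lim_k_g1 lim_k_g2; simp)+
  thus "(\<lambda>j. k j * (fst (X j) - lam)) \<longlonglongrightarrow> - (ga / (2 * real n))"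
    "(\<lambda>j. k j * (snd (X j) - lam)) \<longlonglongrightarrow> - (ga / (2 * real n))" by (simp_all add: relations)
qed

text \<open>The expansion of a part while only \<open>k * A\<close> is known to converge.\<close>

lemma part_weak:
  assumes M: "(\<lambda>j. M j - 2 * c * k j) \<longlonglongrightarrow> r" and A: "(\<lambda>j. k j * A j) \<longlonglongrightarrow> y"
  shows "(\<lambda>j. M j * cos (A j) - 2 * c * k j) \<longlonglongrightarrow> r" "(\<lambda>j. M j * sin (A j)) \<longlonglongrightarrow> 2 * c * y"
proof -
  have A0: "A \<longlonglongrightarrow> 0" by (rule unscale[OF A])
  have Mk: "(\<lambda>j. M j / k j) \<longlonglongrightarrow> 2 * c" by (rule ratio[OF M])
  have "(\<lambda>j. k j * (sin (A j) - sin 0)) \<longlonglongrightarrow> cos 0 * y"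
    by (rule scaled_deriv[OF _ _ A0]) (use A in \<open>auto intro!: derivative_eq_intros\<close>)
  hence "(\<lambda>j. k j * sin (A j)) \<longlonglongrightarrow> y" by simp
  from tendsto_mult[OF Mk this] show "(\<lambda>j. M j * sin (A j)) \<longlonglongrightarrow> 2 * c * y"
    by (rule Lim_transform_eventually) (use k_pos in eventually_elim, simp)
  have "(\<lambda>j. k j * (cos (A j) - cos 0)) \<longlonglongrightarrow> - sin 0 * y"
    by (rule scaled_deriv[OF _ _ A0]) (use A in \<open>auto intro!: derivative_eq_intros\<close>)
  hence "(\<lambda>j. k j * (cos (A j) - 1)) \<longlonglongrightarrow> 0" by simp
  from tendsto_add[OF M tendsto_mult[OF Mk this]]
  have "(\<lambda>j. (M j - 2 * c * k j) + (M j / k j) * (k j * (cos (A j) - 1))) \<longlonglongrightarrow> r" by simp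
  thus "(\<lambda>j. M j * cos (A j) - 2 * c * k j) \<longlonglongrightarrow> r"
    by (rule Lim_transform_eventually) (use k_pos in eventually_elim, simp add: algebra_simps)
qed

lemma lim_k_sin:
  assumes "(\<lambda>j. k j * (A j - lam)) \<longlonglongrightarrow> y"
  shows "(\<lambda>j. k j * (sin (A j) - s)) \<longlonglongrightarrow> c * y" "(\<lambda>j. sin (A j)) \<longlonglongrightarrow> s" "(\<lambda>j. cos (A j)) \<longlonglongrightarrow> c"
proof -
  have A: "A \<longlonglongrightarrow> lam" by (rule lim_from_k[OF assms])
  show "(\<lambda>j. k j * (sin (A j) - s)) \<longlonglongrightarrow> c * y" unfolding s_def c_def
    by (rule scaled_deriv[OF _ assms A]) (auto intro!: derivative_eq_intros)
  show "(\<lambda>j. sin (A j)) \<longlonglongrightarrow> s" "(\<lambda>j. cos (A j)) \<longlonglongrightarrow> c"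
    unfolding s_def c_def by (intro tendsto_intros A)+
qed

text \<open>
  By \<open>polar_all\<close>, the vector from \<open>B1\<close> to \<open>T1\<close> (parts 2 and 3) is turned against the remaining half of
  the period (parts 4 and 1) by an angle of about \<open>gap1\<close>.  If \<open>k\<^sup>2 * gap1\<close> were unbounded, this would
  dominate the height of \<open>T1\<close> over \<open>B1\<close>: the value of \<open>wedge d\<close> would be \<open>16 * c\<^sup>2 * k\<^sup>2 * gap1\<close> to leading
  order.  But this height is positive, and it is bounded because \<open>C1\<close>, near \<open>B1\<close>, lies above \<open>C3\<close>, near \<open>T1\<close>.
\<close>

lemma gap_not_large:
  assumes low: "\<And>j. 0 < wedge (hs_word.T2 (X j) n (K j) - 1) (hs_word.T1 (X j) n (K j) - hs_word.B1 (X j) n (K j))"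
    and up: "\<And>j. 0 < wedge (hs_word.T2 (X j) n (K j) - 1) (hs_word.C1 (X j) n (K j) - hs_word.C3 (X j) n (K j))"
    and large: "filterlim (\<lambda>j. \<bar>k j * (k j * g1 j)\<bar>) at_top sequentially"
  shows False
proof -
  define w where "w j = k j * (k j * g1 j)" for j
  have iw: "(\<lambda>j. inverse (w j)) \<longlonglongrightarrow> 0"
  proof -
    have "(\<lambda>j. inverse \<bar>w j\<bar>) \<longlonglongrightarrow> 0"
      using large unfolding w_def[symmetric] by (rule tendsto_inverse_0_at_top)
    hence "(\<lambda>j. \<bar>inverse (w j)\<bar>) \<longlonglongrightarrow> 0" by (simp only: abs_inverse)
    thus ?thesis by (rule tendsto_rabs_zero_cancel)
  qed
  have wnz: "eventually (\<lambda>j. w j \<noteq> 0) sequentially"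
  proof -
    have "eventually (\<lambda>j. 0 < \<bar>w j\<bar>) sequentially"
      using large unfolding w_def[symmetric] filterlim_at_top_dense by blast
    thus ?thesis by eventually_elim simp
  qed
  have small: "(\<lambda>j. f j * inverse (w j)) \<longlonglongrightarrow> 0" if "f \<longlonglongrightarrow> y" for f y
    using tendsto_mult[OF that iw] by simp
  define x where "x j = complex_of_real (M2 j) * cis 0 + cis (A2 j) + (complex_of_real (M3 j) * cis (g2 j - D j) + cis (A3 j))" for j
  define y where "y j = complex_of_real (M1 j) * cis (- (g1 j + D j)) + cis (A1 j) + (complex_of_real (M2 j) * cis (tw j) + cis (A4 j))" for j
  define o1 where "o1 j = - (complex_of_real (leg2 (X j)) * cis (A1 j - fst (X j))) - complex_of_real (leg2 (X j)) * cis (A3 j - g1 j - fst (X j))" for j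
  have xv: "hs_word.rot (X j) n (K j) (hs_word.T1 (X j) n (K j) - hs_word.B1 (X j) n (K j)) = x j" for j
    using hs_word.rot_add[of "X j" n "K j" "hs_word.B2 (X j) n (K j) - hs_word.B1 (X j) n (K j)" "hs_word.T1 (X j) n (K j) - hs_word.B2 (X j) n (K j)"]
    unfolding polar_all by (simp add: x_def)
  have dv: "vec_d j = x j + y j" for j
  proof -
    have "vec_d j = hs_word.rot (X j) n (K j) ((hs_word.T1 (X j) n (K j) - hs_word.B1 (X j) n (K j))
       + ((hs_word.B1 (X j) n (K j) - 1) + (hs_word.T2 (X j) n (K j) - hs_word.T1 (X j) n (K j))))"
      by (simp add: vec_d_def)
    thus ?thesis unfolding hs_word.rot_add xv polar_all y_def by simp
  qed
  have ov: "hs_word.rot (X j) n (K j) (hs_word.C1 (X j) n (K j) - hs_word.C3 (X j) n (K j)) = o1 j - x j" for j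
  proof -
    have e: "hs_word.C1 (X j) n (K j) - hs_word.C3 (X j) n (K j) = (hs_word.C1 (X j) n (K j) - hs_word.B1 (X j) n (K j))
       - (hs_word.C3 (X j) n (K j) - hs_word.T1 (X j) n (K j)) - (hs_word.T1 (X j) n (K j) - hs_word.B1 (X j) n (K j))" by simp
    show ?thesis unfolding e hs_word.rot_diff[of _ _ _ "_ - _"] xv polar_all o1_def by simp
  qed
  define f where "f j = wedge (vec_d j) (x j)" for j
  define g where "g j = wedge (vec_d j) (o1 j)" for j
  have f0: "0 < f j" for j
    using low[of j] hs_word.wedge_rot[of "X j" n "K j"] by (metis f_def vec_d_def xv)
  have fg: "f j < g j" for j
  proof -
    have "0 < wedge (vec_d j) (o1 j - x j)"
      using up[of j] hs_word.wedge_rot[of "X j" n "K j"] by (metis vec_d_def ov)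
    thus ?thesis by (simp add: f_def g_def wedge_diff_right)
  qed
  have e1: "(\<lambda>j. k j * (g2 j - D j)) \<longlonglongrightarrow> ga" "(\<lambda>j. k j * (- (g1 j + D j))) \<longlonglongrightarrow> - ga"
    using tendsto_diff[OF lim_k_g2 lim_k_D] tendsto_minus[OF tendsto_add[OF lim_k_g1 lim_k_D]]
    by (simp_all add: algebra_simps)
  note p1 = part_weak[OF lim_M(1) e1(2)] and p3 = part_weak[OF lim_M(3) e1(1)]
    and p2 = part_weak[OF lim_M(2) lim_k_tw]
  note a1 = lim_k_sin[OF lim_k_A(1)] and a2 = lim_k_sin[OF lim_k_A(2)]
    and a3 = lim_k_sin[OF lim_k_A(3)] and a4 = lim_k_sin[OF lim_k_A(4)]
  have "(\<lambda>j. (M2 j - 2 * c * k j) + cos (A2 j) + ((M3 j * cos (g2 j - D j) - 2 * c * k j) + cos (A3 j)))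
     \<longlonglongrightarrow> (2 * c + kap) + c + (kap + c)"
    by (intro tendsto_add lim_M p3 a2 a3)
  hence xr: "(\<lambda>j. Re (x j) - 4 * c * k j) \<longlonglongrightarrow> (2 * c + kap) + c + (kap + c)" by (simp add: x_def algebra_simps)
  have "(\<lambda>j. (M1 j * cos (- (g1 j + D j)) - 2 * c * k j) + cos (A1 j) + ((M2 j * cos (tw j) - 2 * c * k j) + cos (A4 j)))
     \<longlonglongrightarrow> (4 * c + kap) + c + ((2 * c + kap) + c)"
    by (intro tendsto_add p1 p2 a1 a4)
  hence yr: "(\<lambda>j. Re (y j) - 4 * c * k j) \<longlonglongrightarrow> (4 * c + kap) + c + ((2 * c + kap) + c)"
    by (simp add: y_def algebra_simps)
  have xi: "(\<lambda>j. Im (x j)) \<longlonglongrightarrow> s + (2 * c * ga + s)"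
    using tendsto_add[OF a2(2) tendsto_add[OF p3(2) a3(2)]] by (simp add: x_def)
  have yi: "(\<lambda>j. Im (y j)) \<longlonglongrightarrow> 2 * c * - ga + s + (2 * c * 0 + s)"
    using tendsto_add[OF tendsto_add[OF p1(2) a1(2)] tendsto_add[OF p2(2) a4(2)]] by (simp add: y_def)
  obtain r1 where r1: "(\<lambda>j. (Re (x j) - Re (y j)) * Im (y j)) \<longlonglongrightarrow> r1"
  proof -
    from tendsto_mult[OF tendsto_diff[OF xr yr] yi]
    show ?thesis by (intro that) simp
  qed
  have yk: "(\<lambda>j. Re (y j) / k j) \<longlonglongrightarrow> 4 * c" by (rule ratio[OF yr])
  have xk: "(\<lambda>j. Re (x j) / k j) \<longlonglongrightarrow> 4 * c" by (rule ratio[OF xr])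

  \<comment> \<open>\<open>x\<close> and \<open>y\<close> are the two halves of \<open>d\<close>, of nearly equal length,
    so \<open>wedge d x\<close> is governed by \<open>Im x - Im y\<close>\<close>
  have rel: "(\<lambda>j. k j * k j * inverse (w j) * (g2 j - D j)) \<longlonglongrightarrow> 1"
    "(\<lambda>j. k j * k j * inverse (w j) * (g1 j + D j)) \<longlonglongrightarrow> 1"
    "(\<lambda>j. k j * k j * inverse (w j) * tw j) \<longlonglongrightarrow> 0"
  proof -
    have n1: "real n - 1 > 0" using n by simp
    have "g2 j - D j = g1 j + D j / (real n - 1)" for j using n1 by (simp add: relations(5) field_simps)
    hence 1: "k j * k j * inverse (w j) * (g2 j - D j) = w j * inverse (w j) + (k j * (k j * D j)) / (real n - 1) * inverse (w j)" for j
      by (simp add: w_def algebra_simps)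
    have one: "(\<lambda>j. w j * inverse (w j)) \<longlonglongrightarrow> 1"
      by (rule Lim_transform_eventually[OF tendsto_const]) (use wnz in eventually_elim, simp)
    have "(\<lambda>j. (k j * (k j * D j)) / (real n - 1) * inverse (w j)) \<longlonglongrightarrow> 0"
      by (rule small[OF tendsto_divide[OF lim_kk_D tendsto_const]]) (use n1 in simp)
    from tendsto_add[OF one this] show "(\<lambda>j. k j * k j * inverse (w j) * (g2 j - D j)) \<longlonglongrightarrow> 1"
      by (simp add: 1)
    have "k j * k j * inverse (w j) * (g1 j + D j) = w j * inverse (w j) + (k j * (k j * D j)) * inverse (w j)" for j
      by (simp add: w_def algebra_simps)
    with tendsto_add[OF one small[OF lim_kk_D]]
    show "(\<lambda>j. k j * k j * inverse (w j) * (g1 j + D j)) \<longlonglongrightarrow> 1" by simp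
    show "(\<lambda>j. k j * k j * inverse (w j) * tw j) \<longlonglongrightarrow> 0"
      using small[OF lim_kk_tw] by (simp add: mult_ac)
  qed
  have sl: "(\<lambda>j. M j / k j * (k j * k j * inverse (w j) * sin (A j))) \<longlonglongrightarrow> 2 * c * l"
    if "(\<lambda>j. M j / k j) \<longlonglongrightarrow> 2 * c" "(\<lambda>j. k j * k j * inverse (w j) * A j) \<longlonglongrightarrow> l" "A \<longlonglongrightarrow> 0" for M A l
  proof -
    have "(\<lambda>j. k j * k j * inverse (w j) * (sin (A j) - sin 0)) \<longlonglongrightarrow> cos 0 * l"
      by (rule scaled_deriv[OF _ _ that(3)]) (use that(2) in \<open>auto intro!: derivative_eq_intros\<close>)
    from tendsto_mult[OF that(1) this] show ?thesis by simp
  qed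
  have z: "(\<lambda>j. g2 j - D j) \<longlonglongrightarrow> 0" "(\<lambda>j. g1 j + D j) \<longlonglongrightarrow> 0"
    using tendsto_diff[OF lim_g(2,3)] tendsto_add[OF lim_g(1,3)] by simp_all
  have ym: "Im (y j) = - (M1 j * sin (g1 j + D j)) + sin (A1 j) + (M2 j * sin (tw j) + sin (A4 j))" for j
    using sin_minus[of "g1 j + D j"] by (simp add: y_def)
  have "(\<lambda>j. M3 j / k j * (k j * k j * inverse (w j) * sin (g2 j - D j))
      + M1 j / k j * (k j * k j * inverse (w j) * sin (g1 j + D j))
      - M2 j / k j * (k j * k j * inverse (w j) * sin (tw j))
      + ((k j * (sin (A2 j) - s) - k j * (sin (A4 j) - s)) * inverse (w j)
      + (k j * (sin (A3 j) - s) - k j * (sin (A1 j) - s)) * inverse (w j)))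
    \<longlonglongrightarrow> 2 * c * 1 + 2 * c * 1 - 2 * c * 0 + (0 + 0)"
    by (intro tendsto_add tendsto_diff sl[OF lim_Mk(3) rel(1) z(1)] sl[OF lim_Mk(1) rel(2) z(2)]
        sl[OF lim_Mk(2) rel(3) lim_g(4)] small[OF tendsto_diff[OF a2(1) a4(1)]] small[OF tendsto_diff[OF a3(1) a1(1)]])
  hence "(\<lambda>j. k j * inverse (w j) * (Im (x j) - Im (y j))) \<longlonglongrightarrow> 2 * c * 1 + 2 * c * 1 - 2 * c * 0 + (0 + 0)"
    by (rule Lim_transform_eventually)
       (use k_pos in eventually_elim, unfold ym, simp add: x_def algebra_simps)
  from tendsto_diff[OF tendsto_mult[OF yk this] small[OF r1]]
  have "(\<lambda>j. Re (y j) / k j * (k j * inverse (w j) * (Im (x j) - Im (y j)))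
      - (Re (x j) - Re (y j)) * Im (y j) * inverse (w j)) \<longlonglongrightarrow> 16 * c\<^sup>2"
    by (simp add: power2_eq_square)
  hence lf: "(\<lambda>j. f j * inverse (w j)) \<longlonglongrightarrow> 16 * c\<^sup>2"
    by (rule Lim_transform_eventually)
       (use k_pos in eventually_elim, simp add: f_def dv wedge_alt algebra_simps)

  \<comment> \<open>the upper bound \<open>g\<close> for \<open>f\<close> converges\<close>
  have oi: "(\<lambda>j. k j * (l j * sin (A j))) \<longlonglongrightarrow> 1 / (2 * c) * z" "(\<lambda>j. l j * cos (A j)) \<longlonglongrightarrow> 1 / (2 * c)"
    if "l \<longlonglongrightarrow> 1 / (2 * c)" "(\<lambda>j. k j * A j) \<longlonglongrightarrow> z" for l A z
  proof -
    have "expn (\<lambda>j. complex_of_real (l j) * cis (A j)) 0 0 (1 / (2 * c)) (1 / (2 * c) * z)"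
      by (rule expn_off[OF that(2,1)])
    thus "(\<lambda>j. k j * (l j * sin (A j))) \<longlonglongrightarrow> 1 / (2 * c) * z" "(\<lambda>j. l j * cos (A j)) \<longlonglongrightarrow> 1 / (2 * c)"
      by (simp_all add: expn_def)
  qed
  have B1: "(\<lambda>j. k j * (A1 j - fst (X j))) \<longlonglongrightarrow> nu + De / 2 - ga - (- (ga / (2 * real n)))"
    using tendsto_diff[OF lim_k_A(1) lim_k_angle(1)] by (simp add: algebra_simps)
  have B3: "(\<lambda>j. k j * (A3 j - g1 j - fst (X j))) \<longlonglongrightarrow> nu + De / 2 + ga - ga - (- (ga / (2 * real n)))"
    using tendsto_diff[OF tendsto_diff[OF lim_k_A(3) lim_k_g1] lim_k_angle(1)] by (simp add: algebra_simps)
  note o1' = oi[OF lim_leg(2) B1] and o3' = oi[OF lim_leg(2) B3]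
  obtain oy where oy: "(\<lambda>j. k j * Im (o1 j)) \<longlonglongrightarrow> oy"
    using tendsto_diff[OF tendsto_minus[OF o1'(1)] o3'(1)] that by (simp add: o1_def algebra_simps)
  obtain oz where oz: "(\<lambda>j. Re (o1 j)) \<longlonglongrightarrow> oz"
    using tendsto_diff[OF tendsto_minus[OF o1'(2)] o3'(2)] that by (simp add: o1_def algebra_simps)
  obtain r2 where r2: "(\<lambda>j. (Re (x j) / k j + Re (y j) / k j) * (k j * Im (o1 j)) - (Im (x j) + Im (y j)) * Re (o1 j)) \<longlonglongrightarrow> r2"
    using tendsto_diff[OF tendsto_mult[OF tendsto_add[OF xk yk] oy] tendsto_mult[OF tendsto_add[OF xi yi] oz]] that by blast
  hence "g \<longlonglongrightarrow> r2"
    by (rule Lim_transform_eventually)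
       (use k_pos in eventually_elim, simp add: g_def dv wedge_alt field_simps)
  hence lg: "(\<lambda>j. \<bar>g j * inverse (w j)\<bar>) \<longlonglongrightarrow> 0" using small by (simp add: tendsto_rabs_zero_iff)
  have "(\<lambda>j. f j * inverse (w j)) \<longlonglongrightarrow> 0"
  proof (rule Lim_null_comparison[OF _ lg])
    show "\<forall>\<^sub>F j in sequentially. norm (f j * inverse (w j)) \<le> \<bar>g j * inverse (w j)\<bar>"
    proof (intro always_eventually allI)
      fix j
      have "\<bar>f j\<bar> \<le> \<bar>g j\<bar>" using f0[of j] fg[of j] by simp
      thus "norm (f j * inverse (w j)) \<le> \<bar>g j * inverse (w j)\<bar>"
        by (simp add: abs_mult mult_right_mono)
    qed
  qed
  from LIMSEQ_unique[OF this lf] show False using lam_bounds by simp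
qed

end

definition hgt_rel :: "real \<times> real \<Rightarrow> nat \<Rightarrow> nat \<Rightarrow> complex \<Rightarrow> real" where
  "hgt_rel x n k z = wedge (hs_word.T2 x n k - 1) (z - hs_word.B1 x n k)"

text \<open>The scale of the rescaled tiles: also \<open>k\<^sup>2 * gap1\<close> converges.\<close>

locale hs_seq0 = hs_seq +
  fixes ea :: real
  assumes lim_kk_g1: "(\<lambda>j. k j * (k j * g1 j)) \<longlonglongrightarrow> ea"
begin

text \<open>
  \<open>eb\<close> is the limit of \<open>k\<^sup>2 * gap2\<close>.  The other quantities are, up to the factor \<open>8 * c\<close>, limits of
  differences of height: \<open>wid\<close> is that of \<open>B1\<close> over \<open>B2\<close> and of \<open>T2\<close> over \<open>T1\<close>, \<open>N\<close> that of \<open>T2\<close> over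
  \<open>B1\<close>, \<open>qm\<close> that of \<open>C1\<close> over \<open>B1\<close> and of \<open>T1\<close> over \<open>C3\<close>, and \<open>qp\<close> that of \<open>C2\<close> over \<open>B2\<close> and of \<open>T2\<close>
  over \<open>C4\<close>.
\<close>

definition "eb = ea + real n / (real n - 1) * De"
definition "wid = c * De / (real n - 1)"
definition "N = s + c * (ea + eb)"
definition "qm = (s - c * De) / (4 * c\<^sup>2)"
definition "qp = (s + c * De) / (4 * c\<^sup>2)"

lemma ga0: "ga = 0"
  by (rule LIMSEQ_unique[OF lim_k_g1 unscale[OF lim_kk_g1]])

lemma zeros: "hs_seq.kap n 0 = 0" "hs_seq.nu n 0 = 0"
proof -
  have "kap = 0" "nu = 0" unfolding kap_def nu_def by (simp_all add: ga0)
  thus "hs_seq.kap n 0 = 0" "hs_seq.nu n 0 = 0" by (simp_all only: ga0)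
qed

lemma lim_kk_g2: "(\<lambda>j. k j * (k j * g2 j)) \<longlonglongrightarrow> eb"
proof -
  have "(\<lambda>j. k j * (k j * g1 j) + real n / (real n - 1) * (k j * (k j * D j))) \<longlonglongrightarrow> eb"
    unfolding eb_def by (intro tendsto_add tendsto_mult tendsto_const lim_kk_g1 lim_kk_D)
  thus ?thesis by (simp add: relations(5) algebra_simps)
qed

lemma expn_steps:
  "expn (\<lambda>j. complex_of_real (M1 j) * cis (- (g1 j + D j)) + cis (A1 j)) 1 1 (5 * c) (- (c * De * 3 / 2) - 2 * c * ea)"
  "expn (\<lambda>j. complex_of_real (M2 j) * cis 0 + cis (A2 j)) 1 1 (3 * c) (- (c * De / 2))"
  "expn (\<lambda>j. complex_of_real (M3 j) * cis (g2 j - D j) + cis (A3 j)) 1 1 c (2 * c * (eb - De) + c * De / 2)"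
  "expn (\<lambda>j. complex_of_real (M2 j) * cis (tw j) + cis (A4 j)) 1 1 (3 * c) (2 * c * (De / (real n - 1)) - c * De / 2)"
proof -
  have "(\<lambda>j. k j * (k j * (- (g1 j + D j)))) \<longlonglongrightarrow> - (ea + De)"
    using tendsto_minus[OF tendsto_add[OF lim_kk_g1 lim_kk_D]] by (simp add: algebra_simps)
  from expn_add[OF expn_part[OF lim_M(1) this] expn_edge[OF lim_k_A(1)]]
  show "expn (\<lambda>j. complex_of_real (M1 j) * cis (- (g1 j + D j)) + cis (A1 j)) 1 1 (5 * c) (- (c * De * 3 / 2) - 2 * c * ea)"
    by (simp add: ga0 zeros algebra_simps)
  have "(\<lambda>j. k j * (k j * 0)) \<longlonglongrightarrow> 0" by simp
  from expn_add[OF expn_part[OF lim_M(2) this] expn_edge[OF lim_k_A(2)]]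
  show "expn (\<lambda>j. complex_of_real (M2 j) * cis 0 + cis (A2 j)) 1 1 (3 * c) (- (c * De / 2))"
    by (simp add: ga0 zeros algebra_simps)
  have "(\<lambda>j. k j * (k j * (g2 j - D j))) \<longlonglongrightarrow> eb - De"
    using tendsto_diff[OF lim_kk_g2 lim_kk_D] by (simp add: algebra_simps)
  from expn_add[OF expn_part[OF lim_M(3) this] expn_edge[OF lim_k_A(3)]]
  show "expn (\<lambda>j. complex_of_real (M3 j) * cis (g2 j - D j) + cis (A3 j)) 1 1 c (2 * c * (eb - De) + c * De / 2)"
    by (simp add: ga0 zeros algebra_simps)
  from expn_add[OF expn_part[OF lim_M(2) lim_kk_tw] expn_edge[OF lim_k_A(4)]]
  show "expn (\<lambda>j. complex_of_real (M2 j) * cis (tw j) + cis (A4 j)) 1 1 (3 * c) (2 * c * (De / (real n - 1)) - c * De / 2)"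
    by (simp add: ga0 zeros algebra_simps)
qed

lemma lim_off:
  "(\<lambda>j. k j * (A1 j - fst (X j))) \<longlonglongrightarrow> De / 2"
  "(\<lambda>j. k j * (A2 j - snd (X j))) \<longlonglongrightarrow> - (De / 2)"
  "(\<lambda>j. k j * (A3 j - g1 j - fst (X j))) \<longlonglongrightarrow> De / 2"
  "(\<lambda>j. k j * (A4 j - g2 j - snd (X j))) \<longlonglongrightarrow> - (De / 2)"
  using tendsto_diff[OF lim_k_A(1) lim_k_angle(1)] tendsto_diff[OF lim_k_A(2) lim_k_angle(2)]
    tendsto_diff[OF tendsto_diff[OF lim_k_A(3) lim_k_g1] lim_k_angle(1)]
    tendsto_diff[OF tendsto_diff[OF lim_k_A(4) lim_k_g2] lim_k_angle(2)]
  by (simp_all add: ga0 zeros algebra_simps)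

definition "rv V j = hs_word.rot (X j) n (K j) (V (X j) n (K j) - hs_word.B1 (X j) n (K j))"

lemma rv_step:
  "rv hs_word.B2 j = complex_of_real (M2 j) * cis 0 + cis (A2 j)"
  "rv hs_word.T1 j = rv hs_word.B2 j + (complex_of_real (M3 j) * cis (g2 j - D j) + cis (A3 j))"
  "rv hs_word.T2 j = rv hs_word.T1 j + (complex_of_real (M2 j) * cis (tw j) + cis (A4 j))"
  "rv hs_word.C1 j = - (complex_of_real (leg2 (X j)) * cis (A1 j - fst (X j)))"
  "rv hs_word.C2 j = rv hs_word.B2 j + - (complex_of_real (leg1 (X j)) * cis (A2 j - snd (X j)))"
  "rv hs_word.C3 j = rv hs_word.T1 j + complex_of_real (leg2 (X j)) * cis (A3 j - g1 j - fst (X j))"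
  "rv hs_word.C4 j = rv hs_word.T2 j + complex_of_real (leg1 (X j)) * cis (A4 j - g2 j - snd (X j))"
  "vec_d j = rv hs_word.T2 j + (complex_of_real (M1 j) * cis (- (g1 j + D j)) + cis (A1 j))"
  unfolding polar_all[symmetric] rv_def vec_d_def hs_word.rot_add[symmetric] by simp_all

lemma hgt_rel_rv: "hgt_rel (X j) n (K j) (V (X j) n (K j)) = wedge (vec_d j) (rv V j)"
  by (simp add: hgt_rel_def vec_d_def rv_def hs_word.wedge_rot)

text \<open>
  All heights are relative to \<open>B1\<close>, so that only the expansions of the parts from \<open>B1\<close> onwards and
  of \<open>d\<close> enter.
\<close>

lemma critical_heights:
  "(\<lambda>j. hgt_rel (X j) n (K j) (hs_word.B2 (X j) n (K j))) \<longlonglongrightarrow> 8 * c * (- wid)"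
  "(\<lambda>j. hgt_rel (X j) n (K j) (hs_word.T1 (X j) n (K j))) \<longlonglongrightarrow> 8 * c * (N - wid)"
  "(\<lambda>j. hgt_rel (X j) n (K j) (hs_word.T2 (X j) n (K j))) \<longlonglongrightarrow> 8 * c * N"
  "(\<lambda>j. hgt_rel (X j) n (K j) (hs_word.C1 (X j) n (K j))) \<longlonglongrightarrow> 8 * c * qm"
  "(\<lambda>j. hgt_rel (X j) n (K j) (hs_word.C2 (X j) n (K j))) \<longlonglongrightarrow> 8 * c * (qp - wid)"
  "(\<lambda>j. hgt_rel (X j) n (K j) (hs_word.C3 (X j) n (K j))) \<longlonglongrightarrow> 8 * c * (N - wid - qm)"
  "(\<lambda>j. hgt_rel (X j) n (K j) (hs_word.C4 (X j) n (K j))) \<longlonglongrightarrow> 8 * c * (N - qp)"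
proof -
  have n1: "real n - 1 \<noteq> 0" "real n \<noteq> 0" using n by simp_all
  have c0: "c \<noteq> 0" using lam_bounds by simp
  have B2: "expn (rv hs_word.B2) 1 1 (3 * c) (- (c * De / 2))"
    using expn_steps(2) by (simp add: rv_step(1)[abs_def])
  note T1 = expn_add[OF B2 expn_steps(3), folded rv_step(2)]
  note T2 = expn_add[OF T1 expn_steps(4), folded rv_step(3)]
  note d = expn_add[OF T2 expn_steps(1), folded rv_step(8)]
  define g where "g = 2 * c * (eb - ea - 2 * De + De / (real n - 1))"
  have d': "expn vec_d 4 4 (12 * c) g"
    using d by (simp add: g_def algebra_simps)
  define q where "q = 1 / (real n - 1)"
  have "real n / (real n - 1) = 1 + q" using n1 by (simp add: q_def field_simps)
  hence eb': "eb = ea + (1 + q) * De" by (simp only: eb_def)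
  have q: "De / (real n - 1) = q * De" by (simp add: q_def)
  have wid: "wid = c * (q * De)" by (simp add: wid_def q_def)
  have g: "g = 2 * c * (2 * (q * De) - De)"
    unfolding g_def eb' q by (simp add: algebra_simps)
  note C1 = expn_minus[OF expn_off[OF lim_off(1) lim_leg(2)], folded rv_step(4)]
  note C2 = expn_add[OF B2 expn_minus[OF expn_off[OF lim_off(2) lim_leg(1)]], folded rv_step(5)]
  note C3 = expn_add[OF T1 expn_off[OF lim_off(3) lim_leg(2)], folded rv_step(6)]
  note C4 = expn_add[OF T2 expn_off[OF lim_off(4) lim_leg(1)], folded rv_step(7)]
  show "(\<lambda>j. hgt_rel (X j) n (K j) (hs_word.B2 (X j) n (K j))) \<longlonglongrightarrow> 8 * c * (- wid)"
    using expn_wedge[OF d' B2] unfolding hgt_rel_rv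
    by (rule tendsto_eq_rhs) (use c0 in \<open>simp add: q g wid field_simps\<close>)
  have "expn (rv hs_word.T1) 2 2 (4 * c) (2 * c * (eb - De))" using T1 by (simp add: algebra_simps)
  from expn_wedge[OF d' this]
  show "(\<lambda>j. hgt_rel (X j) n (K j) (hs_word.T1 (X j) n (K j))) \<longlonglongrightarrow> 8 * c * (N - wid)"
    unfolding hgt_rel_rv
    by (rule tendsto_eq_rhs) (use c0 in \<open>simp add: q g wid N_def eb' field_simps\<close>)
  have "expn (rv hs_word.T2) 3 3 (7 * c) (2 * c * (eb - De) + 2 * c * (De / (real n - 1)) - c * De / 2)"
    using T2 by (simp add: algebra_simps)
  from expn_wedge[OF d' this]
  show "(\<lambda>j. hgt_rel (X j) n (K j) (hs_word.T2 (X j) n (K j))) \<longlonglongrightarrow> 8 * c * N"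
    unfolding hgt_rel_rv
    by (rule tendsto_eq_rhs) (use c0 in \<open>simp add: q g N_def eb' field_simps\<close>)
  have "expn (rv hs_word.C1) 0 0 (- (1 / (2 * c))) (- (De / (4 * c)))" using C1 by simp
  from expn_wedge[OF d' this]
  show "(\<lambda>j. hgt_rel (X j) n (K j) (hs_word.C1 (X j) n (K j))) \<longlonglongrightarrow> 8 * c * qm"
    unfolding hgt_rel_rv
    by (rule tendsto_eq_rhs) (use c0 in \<open>simp add: q qm_def field_simps power2_eq_square\<close>)
  have "expn (rv hs_word.C2) 1 1 (3 * c - 1 / (2 * c)) (De / (4 * c) - c * De / 2)" using C2 by simp
  from expn_wedge[OF d' this]
  show "(\<lambda>j. hgt_rel (X j) n (K j) (hs_word.C2 (X j) n (K j))) \<longlonglongrightarrow> 8 * c * (qp - wid)"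
    unfolding hgt_rel_rv
    by (rule tendsto_eq_rhs) (use c0 in \<open>simp add: q g wid qp_def field_simps power2_eq_square\<close>)
  have "expn (rv hs_word.C3) 2 2 (4 * c + 1 / (2 * c)) (2 * c * (eb - De) + De / (4 * c))"
    using C3 by (simp add: algebra_simps)
  from expn_wedge[OF d' this]
  show "(\<lambda>j. hgt_rel (X j) n (K j) (hs_word.C3 (X j) n (K j))) \<longlonglongrightarrow> 8 * c * (N - wid - qm)"
    unfolding hgt_rel_rv
    by (rule tendsto_eq_rhs) (use c0 in \<open>simp add: q g wid qm_def N_def eb' field_simps power2_eq_square\<close>)
  have "expn (rv hs_word.C4) 3 3 (7 * c + 1 / (2 * c))
     (2 * c * (eb - De) + 2 * c * (De / (real n - 1)) - c * De / 2 - De / (4 * c))"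
    using C4 by (simp add: algebra_simps)
  from expn_wedge[OF d' this]
  show "(\<lambda>j. hgt_rel (X j) n (K j) (hs_word.C4 (X j) n (K j))) \<longlonglongrightarrow> 8 * c * (N - qp)"
    unfolding hgt_rel_rv
    by (rule tendsto_eq_rhs) (use c0 in \<open>simp add: q g qp_def N_def eb' field_simps power2_eq_square\<close>)
qed

end

section \<open>Heights inside the fans\<close>

lemma sin_ge_base: "0 \<le> b \<Longrightarrow> b \<le> t \<Longrightarrow> t \<le> pi - b \<Longrightarrow> sin b \<le> sin t" for b t :: real
proof (cases "t \<le> pi / 2")
  case True
  assume "0 \<le> b" "b \<le> t"
  thus ?thesis using True by (intro sin_monotone_2pi_le) auto
next
  case False
  assume "0 \<le> b" "b \<le> t" "t \<le> pi - b"
  hence "sin b \<le> sin (pi - t)" using False by (intro sin_monotone_2pi_le) auto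
  thus ?thesis by simp
qed

text \<open>
  An apex, at the distance \<open>sin y / sin (x + y)\<close> from the pivot and at the angle \<open>x\<close> from a long
  edge, is deeper than the end of this edge exactly while the direction \<open>u\<close> of the edge is at most
  \<open>y\<close>: for \<open>u = y\<close> the opposite side of the triangle is parallel to the line.
\<close>

lemma leg_compare:
  assumes "0 < x" "0 < y" "x + y < pi" "0 \<le> u" "u < pi"
  shows "u \<le> y \<Longrightarrow> sin u \<le> sin y / sin (x + y) * sin (u + x)"
    and "y \<le> u \<Longrightarrow> sin y / sin (x + y) * sin (u + x) \<le> sin u"
proof -
  have p: "sin (x + y) > 0" "sin x > 0" using assms by (auto intro!: sin_gt_zero)
  have e: "sin y * sin (u + x) - sin u * sin (x + y) = sin x * sin (y - u)"
    by (simp add: sin_add sin_diff algebra_simps)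
  { assume "u \<le> y"
    hence "sin (y - u) \<ge> 0" using assms by (intro sin_ge_zero) auto
    hence "sin u * sin (x + y) \<le> sin y * sin (u + x)" using e p by (smt (verit) mult_nonneg_nonneg)
    thus "sin u \<le> sin y / sin (x + y) * sin (u + x)" using p by (simp add: field_simps) }
  { assume "y \<le> u"
    hence "sin (u - y) \<ge> 0" using assms by (intro sin_ge_zero) auto
    moreover have "sin (y - u) = - sin (u - y)" by (metis minus_diff_eq sin_minus)
    ultimately have "sin y * sin (u + x) \<le> sin u * sin (x + y)"
      using e p by (smt (verit) mult_nonneg_nonneg mult_minus_right)
    thus "sin y / sin (x + y) * sin (u + x) \<le> sin u" using p by (simp add: field_simps) }
qed

lemma leg_bounds:
  assumes "0 < x" "0 < y" "x + y \<le> pi / 2"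
  shows "0 < sin y / sin (x + y)" "sin y / sin (x + y) \<le> 1"
proof -
  have "0 < sin y" "0 < sin (x + y)" using assms by (auto intro!: sin_gt_zero)
  moreover have "sin y \<le> sin (x + y)" using assms by (intro sin_monotone_2pi_le) auto
  ultimately show "0 < sin y / sin (x + y)" "sin y / sin (x + y) \<le> 1" by simp_all
qed

text \<open>
  A fan of angle \<open>pi - r\<close> whose entering edge has direction \<open>u\<close>.  The left-hand sides are the depths,
  below the pivot, of the entering vertex and of the first apex, the right-hand sides those of the
  vertices of the fan.  If \<open>u\<close> is at most half of \<open>r\<close> and at most the angle \<open>y\<close>, then the fan stays
  at least as deep as its entering vertex, and, from there on, as its first apex.
\<close>

lemma fan_shape:
  fixes x y u r :: real
  defines "l \<equiv> sin y / sin (x + y)"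
  assumes x: "0 < x" "0 < y" "x + y \<le> pi / 2" and N: "2 * real N * x = pi - r" "N \<ge> 1"
    and u: "0 < u" "2 * u \<le> r" "u \<le> y" "u \<le> r - y" "2 * u + 3 * x \<le> pi"
  shows "i \<le> N \<Longrightarrow> sin u \<le> sin (u + 2 * real i * x)"
    and "i < N \<Longrightarrow> sin u \<le> l * sin (u + (2 * real i + 1) * x)"
    and "1 \<le> i \<Longrightarrow> i \<le> N \<Longrightarrow> l * sin (u + x) \<le> sin (u + 2 * real i * x)"
    and "i < N \<Longrightarrow> l * sin (u + x) \<le> l * sin (u + (2 * real i + 1) * x)"
proof -
  have l: "0 < l" "l \<le> 1" using leg_bounds[OF x] by (simp_all add: l_def)
  have Nx: "x \<le> real N * x" using N(2) x by simp
  have ub: "i \<le> N \<Longrightarrow> real i * x \<le> real N * x" for i using x by (simp add: mult_right_mono)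
  have ub': "i < N \<Longrightarrow> (real i + 1) * x \<le> real N * x" for i
    using x by (intro mult_right_mono) auto
  have ux: "u + x \<le> pi / 2" using Nx N(1) u(2) by argo
  show "sin u \<le> sin (u + 2 * real i * x)" if "i \<le> N"
  proof (rule sin_ge_base)
    show "u + 2 * real i * x \<le> pi - u" using ub[OF that] N(1) u(2) by argo
  qed (use u x in auto)
  show 4: "l * sin (u + x) \<le> l * sin (u + (2 * real i + 1) * x)" if "i < N" for i
  proof (intro mult_left_mono sin_ge_base)
    show "u + (2 * real i + 1) * x \<le> pi - (u + x)"
      using ub'[OF that] N(1) u(2) by (simp add: algebra_simps)
    show "u + x \<le> u + (2 * real i + 1) * x" using x by (simp add: algebra_simps)
  qed (use u x l in auto)
  have "sin u \<le> l * sin (u + x)"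
    unfolding l_def by (rule leg_compare(1)) (use x u pi_gt_zero in auto)
  thus "sin u \<le> l * sin (u + (2 * real i + 1) * x)" if "i < N" using 4[OF that] by linarith
  show "l * sin (u + x) \<le> sin (u + 2 * real i * x)" if i: "1 \<le> i" "i \<le> N"
  proof -
    define v where "v = r - u"
    have "r + 2 * x \<le> pi" using Nx N(1) by argo
    hence v: "u \<le> v" "y \<le> v" "v < pi" "u + v + 2 * x \<le> pi"
      using u x by (auto simp: v_def)
    have "sin (u + x) \<le> sin (v + x)" by (rule sin_ge_base) (use u x v in auto)
    hence "l * sin (u + x) \<le> l * sin (v + x)" using l by simp
    also have "\<dots> \<le> sin v" unfolding l_def by (rule leg_compare(2)) (use x u v pi_gt_zero in auto)
    finally have A: "l * sin (u + x) \<le> sin v" .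
    have s0: "0 \<le> sin (u + x)" by (rule sin_ge_zero) (use u x ux pi_gt_zero in auto)
    have "sin (u + x) \<le> sin (u + 2 * x)" by (rule sin_ge_base) (use u x in auto)
    moreover have "l * sin (u + x) \<le> 1 * sin (u + x)" using l s0 by (intro mult_right_mono) auto
    ultimately have B: "l * sin (u + x) \<le> sin (u + 2 * x)" by simp
    have t1: "u + 2 * x \<le> u + 2 * real i * x" using i x by simp
    have t2: "u + 2 * real i * x \<le> pi - v" using ub[OF i(2)] N(1) unfolding v_def by argo
    show ?thesis
    proof (cases "v \<le> u + 2 * x")
      case True
      have "sin v \<le> sin (u + 2 * real i * x)" by (rule sin_ge_base) (use True t1 t2 u v in auto)
      thus ?thesis using A by linarith
    next
      case False
      have "sin (u + 2 * x) \<le> sin (u + 2 * real i * x)" by (rule sin_ge_base) (use False t1 t2 u v x in auto)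
      thus ?thesis using B by linarith
    qed
  qed
qed

context
  fixes x y r t phi :: real and N :: nat and P :: complex
  assumes x: "0 < x" "0 < y" "x + y \<le> pi / 2" and N: "2 * real N * x = pi - r" "N \<ge> 1"
begin

abbreviation (input) "fan_ok u \<equiv> 0 < u \<and> 2 * u \<le> r \<and> u \<le> y \<and> u \<le> r - y \<and> 2 * u + 3 * x \<le> pi"

text \<open>
  For a fan that hangs below a top, the bounds refer to what comes first, the entering vertex and the
  first apex; a fan that stands on a bottom, as in \<open>bottom_fan\<close>, is its mirror image, so that the
  bounds refer to the exit vertex and to the last apex.
\<close>

lemma top_fan:
  assumes u: "fan_ok (t - phi)"
  shows "z \<in> fan P (sin y / sin (x + y)) t x N N \<Longrightarrow> hgt phi z \<le> hgt phi P - sin (t - phi)"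
    and "z \<in> fan P (sin y / sin (x + y)) t x N N \<Longrightarrow>
      hgt phi z \<le> hgt phi (P - complex_of_real (sin y / sin (x + y)) * cis (t + x))"
    and "hgt phi (P + cis (t - r)) \<le> hgt phi P - sin (t - phi)"
    and "hgt phi (P + cis (t - r)) \<le> hgt phi (P - complex_of_real (sin y / sin (x + y)) * cis (t + x))"
proof -
  let ?l = "sin y / sin (x + y)"
  note F = fan_shape[OF x N, of "t - phi"]
  have h: "hgt phi (P - cis (t + 2 * (real i + 1) * x)) = hgt phi P - sin (t - phi + 2 * real (Suc i) * x)"
    "hgt phi (P - complex_of_real ?l * cis (t + (2 * real i + 1) * x)) = hgt phi P - ?l * sin (t - phi + (2 * real i + 1) * x)"
    "hgt phi (P - complex_of_real ?l * cis (t + x)) = hgt phi P - ?l * sin (t - phi + x)" for i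
    unfolding hgt_diff hgt_real hgt_cis by (simp_all add: algebra_simps)
  have e: "hgt phi (P + cis (t - r)) = hgt phi P - sin (t - phi + 2 * real N * x)"
  proof -
    have "sin (t - phi + (pi - r)) = - sin (t - r - phi)" by (simp add: sin_add sin_diff cos_diff cos_add algebra_simps)
    thus ?thesis unfolding hgt_add hgt_cis N(1) by simp
  qed
  { assume "z \<in> fan P ?l t x N N"
    then consider i where "i < N" "z = P - cis (t + 2 * (real i + 1) * x)"
      | i where "i < N" "z = P - complex_of_real ?l * cis (t + (2 * real i + 1) * x)"
      unfolding fan_def by blast
    hence "hgt phi z \<le> hgt phi P - sin (t - phi)
      \<and> hgt phi z \<le> hgt phi (P - complex_of_real ?l * cis (t + x))"
    proof cases
      case 1
      thus ?thesis unfolding 1(2) h using F(1)[of "Suc i"] F(3)[of "Suc i"] u by simp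
    next
      case 2
      thus ?thesis unfolding 2(2) h using F(2)[of i] F(4)[of i] u by simp
    qed }
  thus "z \<in> fan P ?l t x N N \<Longrightarrow> hgt phi z \<le> hgt phi P - sin (t - phi)"
    "z \<in> fan P ?l t x N N \<Longrightarrow> hgt phi z \<le> hgt phi (P - complex_of_real ?l * cis (t + x))"
    by blast+
  show "hgt phi (P + cis (t - r)) \<le> hgt phi P - sin (t - phi)"
    unfolding e using F(1)[of N] u by simp
  show "hgt phi (P + cis (t - r)) \<le> hgt phi (P - complex_of_real ?l * cis (t + x))"
    unfolding e h using F(3)[of N] u N by simp
qed

lemma bottom_fan:
  assumes u: "fan_ok (t + r - phi)"
  shows "z \<in> fan P (sin y / sin (x + y)) t (- x) N N \<Longrightarrow> hgt phi (P + cis (t + r)) \<le> hgt phi z"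
    and "z \<in> fan P (sin y / sin (x + y)) t (- x) (N - 1) N \<Longrightarrow>
      hgt phi (P + complex_of_real (sin y / sin (x + y)) * cis (t + r + x)) \<le> hgt phi z"
    and "hgt phi (P + cis (t + r)) \<le> hgt phi (P - cis t)"
    and "hgt phi (P + complex_of_real (sin y / sin (x + y)) * cis (t + r + x)) \<le> hgt phi (P - cis t)"
proof -
  let ?l = "sin y / sin (x + y)" let ?u = "t + r - phi"
  note F = fan_shape[OF x N, of ?u]
  have h1: "hgt phi (P - cis (t + 2 * (real i + 1) * - x)) = hgt phi P + sin (?u + 2 * real (N - Suc i) * x)" if "i < N" for i
  proof -
    have a: "t + 2 * (real i + 1) * - x - phi = (?u + 2 * real (N - Suc i) * x) - pi"
      using that N(1) by (simp add: of_nat_diff algebra_simps)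
    show ?thesis unfolding hgt_diff hgt_cis a by (simp add: sin_diff)
  qed
  have h2: "hgt phi (P - complex_of_real ?l * cis (t + (2 * real i + 1) * - x)) = hgt phi P + ?l * sin (?u + (2 * real (N - Suc i) + 1) * x)" if "i < N" for i
  proof -
    have a: "t + (2 * real i + 1) * - x - phi = (?u + (2 * real (N - Suc i) + 1) * x) - pi"
      using that N(1) by (simp add: of_nat_diff algebra_simps)
    show ?thesis unfolding hgt_diff hgt_cis hgt_real a by (simp add: sin_diff)
  qed
  have h3: "hgt phi (P - cis t) = hgt phi P + sin (?u + 2 * real N * x)"
  proof -
    have a: "t - phi = (?u + 2 * real N * x) - pi" using N(1) by (simp add: algebra_simps)
    show ?thesis unfolding hgt_diff hgt_cis a by (simp add: sin_diff)
  qed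
  have h4: "hgt phi (P + cis (t + r)) = hgt phi P + sin ?u"
    "hgt phi (P + complex_of_real ?l * cis (t + r + x)) = hgt phi P + ?l * sin (?u + x)"
    unfolding hgt_add hgt_cis hgt_real by (simp_all add: algebra_simps)
  { assume "z \<in> fan P ?l t (- x) N N"
    then consider i where "i < N" "z = P - cis (t + 2 * (real i + 1) * - x)"
      | i where "i < N" "z = P - complex_of_real ?l * cis (t + (2 * real i + 1) * - x)"
      unfolding fan_def by blast
    thus "hgt phi (P + cis (t + r)) \<le> hgt phi z"
    proof cases
      case 1
      show ?thesis unfolding 1(2) h1[OF 1(1)] h4 using F(1)[of "N - Suc i"] u 1(1) by simp
    next
      case 2
      show ?thesis unfolding 2(2) h2[OF 2(1)] h4 using F(2)[of "N - Suc i"] u 2(1) by simp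
    qed }
  { assume "z \<in> fan P ?l t (- x) (N - 1) N"
    then consider i where "i < N - 1" "z = P - cis (t + 2 * (real i + 1) * - x)"
      | i where "i < N" "z = P - complex_of_real ?l * cis (t + (2 * real i + 1) * - x)"
      unfolding fan_def by blast
    thus "hgt phi (P + complex_of_real ?l * cis (t + r + x)) \<le> hgt phi z"
    proof cases
      case 1
      hence i: "i < N" by simp
      show ?thesis unfolding 1(2) h1[OF i] h4 using F(3)[of "N - Suc i"] u 1(1) by simp
    next
      case 2
      show ?thesis unfolding 2(2) h2[OF 2(1)] h4 using F(4)[of "N - Suc i"] u 2(1) by simp
    qed }
  show "hgt phi (P + cis (t + r)) \<le> hgt phi (P - cis t)"
    unfolding h3 h4 using F(1)[of N] u by simp
  show "hgt phi (P + complex_of_real ?l * cis (t + r + x)) \<le> hgt phi (P - cis t)"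
    unfolding h3 h4 using F(3)[of N] u N by simp
qed

end

text \<open>
  In a wide fan of angle \<open>pi - g\<close>, with \<open>g\<close> close to 0, all vertices are compared with a single apex:
  the last one below a top, and the first one above a bottom.  Its edge from the pivot makes a smaller
  angle with the line than all others, and it is shorter than the long edges.
\<close>

lemma wide_top_fan:
  fixes x y g t phi :: real
  defines "l \<equiv> sin y / sin (x + y)"
  assumes x: "0 < x" "0 < y" "x + y \<le> pi / 2" and n: "2 * real n * x = pi - g" "n \<ge> 1"
    and u: "0 < t - phi" "t - phi \<le> g + x" "g \<le> 2 * (t - phi)"
  shows "z \<in> fan P l t x (n - 1) n \<Longrightarrow> hgt phi z \<le> hgt phi (P + complex_of_real l * cis (t - g - x))"
proof -
  have l: "0 < l" "l \<le> 1" using leg_bounds[OF x] by (simp_all add: l_def)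
  define u where "u = t - phi"
  define e where "e = g + x - u"
  have e: "0 \<le> e" "e \<le> u + x" using u by (auto simp: e_def u_def)
  have "x \<le> real n * x" using n(2) x by simp
  hence e2: "e \<le> pi" using u x n(1) unfolding e_def u_def by argo
  have h: "hgt phi (P + complex_of_real l * cis (t - g - x)) = hgt phi P - l * sin e"
  proof -
    have "t - g - x - phi = - e" by (simp add: e_def u_def)
    thus ?thesis unfolding hgt_add hgt_real hgt_cis by simp
  qed
  have ub: "i < n \<Longrightarrow> (real i + 1) * x \<le> real n * x" for i
    using x by (intro mult_right_mono) auto
  have s0: "0 \<le> sin e" by (rule sin_ge_zero) (use e e2 in auto)
  assume "z \<in> fan P l t x (n - 1) n"
  then consider i where "i < n - 1" "z = P - cis (t + 2 * (real i + 1) * x)"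
    | i where "i < n" "z = P - complex_of_real l * cis (t + (2 * real i + 1) * x)"
    unfolding fan_def by blast
  moreover have i0: "0 \<le> real i * x" for i using x by simp
  ultimately show ?thesis
  proof cases
    case 1
    have "(real i + 1 + 1) * x \<le> real n * x" using ub[of "Suc i"] 1(1) by simp
    moreover have m: "2 * (real i + 1) * x = 2 * (real i * x) + 2 * x" by (simp add: algebra_simps)
    have "e \<le> u + 2 * (real i + 1) * x" unfolding m using e i0[of i] x by linarith
    ultimately have "sin e \<le> sin (u + 2 * (real i + 1) * x)"
      using e x n(1) by (intro sin_ge_base) (auto simp: e_def algebra_simps)
    moreover have "l * sin e \<le> 1 * sin e" using l s0 by (intro mult_right_mono) auto
    ultimately show ?thesis unfolding h 1(2) hgt_diff hgt_cis by (simp add: u_def algebra_simps)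
  next
    case 2
    have m: "(2 * real i + 1) * x = 2 * (real i * x) + x" by (simp add: algebra_simps)
    have "e \<le> u + (2 * real i + 1) * x" unfolding m using e i0[of i] x by linarith
    hence "sin e \<le> sin (u + (2 * real i + 1) * x)"
      using e x n(1) ub[OF 2(1)] by (intro sin_ge_base) (auto simp: e_def algebra_simps)
    hence "l * sin e \<le> l * sin (u + (2 * real i + 1) * x)" using l by simp
    thus ?thesis unfolding h 2(2) hgt_diff hgt_real hgt_cis by (simp add: u_def algebra_simps)
  qed
qed

lemma wide_bottom_fan:
  fixes x y g t phi :: real
  defines "l \<equiv> sin y / sin (x + y)"
  assumes x: "0 < x" "0 < y" "x + y \<le> pi / 2" and n: "2 * real n * x = pi - g" "n \<ge> 1"
    and u: "0 < t - phi" "t - phi \<le> x" "x \<le> g + 2 * (t - phi)"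
  shows "z \<in> fan P l t (- x) n n \<Longrightarrow> hgt phi (P - complex_of_real l * cis (t - x)) \<le> hgt phi z"
proof -
  have l: "0 < l" "l \<le> 1" using leg_bounds[OF x] by (simp_all add: l_def)
  define u where "u = t - phi"
  define e where "e = x - u"
  have e: "0 \<le> e" "2 * e \<le> g + x" using u by (auto simp: e_def u_def)
  have h: "hgt phi (P - complex_of_real l * cis (t - x)) = hgt phi P + l * sin e"
  proof -
    have "t - x - phi = - e" by (simp add: e_def u_def)
    thus ?thesis unfolding hgt_diff hgt_real hgt_cis by simp
  qed
  have ub: "i < n \<Longrightarrow> (real i + 1) * x \<le> real n * x" for i
    using x by (intro mult_right_mono) auto
  have s0: "0 \<le> sin e" by (rule sin_ge_zero) (use e u x in \<open>auto simp: e_def u_def\<close>)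
  assume "z \<in> fan P l t (- x) n n"
  then consider i where "i < n" "z = P - cis (t + 2 * (real i + 1) * - x)"
    | i where "i < n" "z = P - complex_of_real l * cis (t + (2 * real i + 1) * - x)"
    unfolding fan_def by blast
  moreover have i0: "0 \<le> real i * x" for i using x by simp
  ultimately show ?thesis
  proof cases
    case 1
    have "sin e \<le> sin (e + (2 * real i + 1) * x)"
      using e x n(1) i0[of i] ub[OF 1(1)] by (intro sin_ge_base) (auto simp: algebra_simps)
    moreover have "l * sin e \<le> 1 * sin e" using l s0 by (intro mult_right_mono) auto
    moreover have a: "t + 2 * (real i + 1) * - x - phi = - (e + (2 * real i + 1) * x)"
      by (simp add: e_def u_def algebra_simps)
    ultimately show ?thesis unfolding h 1(2) unfolding hgt_diff hgt_cis a sin_minus by linarith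
  next
    case 2
    have "sin e \<le> sin (e + 2 * real i * x)"
      using e x n(1) i0[of i] ub[OF 2(1)] by (intro sin_ge_base) (auto simp: algebra_simps)
    hence "l * sin e \<le> l * sin (e + 2 * real i * x)" using l by simp
    moreover have a: "t + (2 * real i + 1) * - x - phi = - (e + 2 * real i * x)"
      by (simp add: e_def u_def algebra_simps)
    ultimately show ?thesis unfolding h 2(2) unfolding hgt_diff hgt_real hgt_cis a sin_minus by linarith
  qed
qed

lemma dec_chain:
  fixes f :: "nat \<Rightarrow> real"
  assumes "\<And>j. j < m \<Longrightarrow> f (Suc j) \<le> f j" "i \<le> m"
  shows "f m \<le> f i"
  using assms(2)
proof (induction rule: inc_induct)
  case (step j)
  thus ?case using assms(1)[of j] by simp
qed simp

context hs_word
begin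

text \<open>
  The directions of all up edges, relative to the direction \<open>phi\<close> of the path, lie between \<open>lo\<close> and
  \<open>hi\<close>.  The upper bounds on \<open>hi\<close> make the fans satisfy the hypotheses of \<open>fan_shape\<close>, so that the
  zigzag never rises from one top to the next; the lower bound \<open>lo\<close> serves the wide fans.
\<close>

definition descending :: "real \<Rightarrow> real \<Rightarrow> real \<Rightarrow> bool" where
  "descending phi lo hi \<longleftrightarrow>
     0 < lo \<and> hi \<le> fst x \<and> hi \<le> snd x \<and> 2 * hi \<le> turn1 \<and> 2 * hi \<le> turn2 \<and>
     hi \<le> turn1 - snd x \<and> hi \<le> turn2 - fst x \<and> 2 * hi + 3 * fst x \<le> pi \<and> 2 * hi + 3 * snd x \<le> pi \<and>
     hi \<le> gap1 + fst x \<and> hi \<le> gap2 + snd x \<and> gap1 \<le> 2 * lo \<and> gap2 \<le> 2 * lo \<and>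
     fst x \<le> gap1 + 2 * lo \<and> snd x \<le> gap2 + 2 * lo \<and>
     (\<forall>j\<le>k + 2. lo \<le> pi + real j * drift - phi \<and> pi + real j * drift - phi \<le> hi) \<and>
     (\<forall>j\<le>k + 1. lo \<le> th1 - real j * drift - phi \<and> th1 - real j * drift - phi \<le> hi) \<and>
     (\<forall>j\<le>k. lo \<le> th2 + real j * drift - phi \<and> th2 + real j * drift - phi \<le> hi) \<and>
     (\<forall>j\<le>k + 1. lo \<le> th3 - real j * drift - phi \<and> th3 - real j * drift - phi \<le> hi)"

context
  fixes phi lo hi c :: real
  assumes x: "x \<in> obtuse_params" and n: "n \<ge> 3" and desc: "descending phi lo hi"
    and level: "hgt phi (T2 - 1) = 0"
    and tops: "c < hgt phi T1" "c < hgt phi T2" "c < hgt phi C1" "c < hgt phi C2"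
    and bots: "hgt phi B1 < c" "hgt phi B2 < c" "hgt phi C3 < c" "hgt phi C4 < c"
begin

lemma angles_pos: "0 < fst x" "0 < snd x" "fst x + snd x \<le> pi / 2" "snd x + fst x \<le> pi / 2"
  using obtuse_paramsD[OF x] by auto

lemma legs: "leg2 x = sin (snd x) / sin (fst x + snd x)" "leg1 x = sin (fst x) / sin (snd x + fst x)"
  by (simp_all add: leg1_def leg2_def add.commute)

lemma leg_identities:
  "cis t - complex_of_real (leg1 x) * cis (t + snd x) = complex_of_real (leg2 x) * cis (t - fst x)"
  "cis t - complex_of_real (leg2 x) * cis (t + fst x) = complex_of_real (leg1 x) * cis (t - snd x)"
proof -
  have 1: "complex_of_real (leg2 x) * cis (fst x) = 1 - complex_of_real (leg1 x) * cis (- snd x)"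
    using apex_from_1[of x] apex_from_2[OF x] by simp
  from arg_cong[OF this, of cnj]
  have 2: "complex_of_real (leg2 x) * cis (- fst x) = 1 - complex_of_real (leg1 x) * cis (snd x)"
    by (simp add: cis_cnj)
  have "cis t * (complex_of_real (leg2 x) * cis (- fst x)) = cis t - complex_of_real (leg1 x) * (cis t * cis (snd x))"
    unfolding 2 by (simp add: algebra_simps)
  thus "cis t - complex_of_real (leg1 x) * cis (t + snd x) = complex_of_real (leg2 x) * cis (t - fst x)"
    by (simp add: cis_mult mult.left_commute[of "cis t"])
  have "cis t * (complex_of_real (leg2 x) * cis (fst x)) = cis t - complex_of_real (leg1 x) * (cis t * cis (- snd x))"
    unfolding 1 by (simp add: algebra_simps)
  thus "cis t - complex_of_real (leg2 x) * cis (t + fst x) = complex_of_real (leg1 x) * cis (t - snd x)"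
    by (simp add: cis_mult mult.left_commute[of "cis t"])
qed

lemma N1: "2 * real (n - 1) * fst x = pi - turn1" "n - 1 \<ge> 1" "2 * real (n - 1) * snd x = pi - turn2"
  "2 * real n * fst x = pi - gap1" "2 * real n * snd x = pi - gap2" "n \<ge> 1" "n - 1 - 1 = n - 2"
  using turns[OF x n] n by auto

lemma ok:
  assumes "lo \<le> u \<and> u \<le> hi"
  shows "0 < u \<and> 2 * u \<le> turn1 \<and> u \<le> snd x \<and> u \<le> turn1 - snd x \<and> 2 * u + 3 * fst x \<le> pi"
    and "0 < u \<and> 2 * u \<le> turn2 \<and> u \<le> fst x \<and> u \<le> turn2 - fst x \<and> 2 * u + 3 * snd x \<le> pi"
    and "0 < u" "u \<le> gap1 + fst x" "gap1 \<le> 2 * u" "u \<le> fst x" "fst x \<le> gap1 + 2 * u"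
    and "u \<le> gap2 + snd x" "gap2 \<le> 2 * u" "u \<le> snd x" "snd x \<le> gap2 + 2 * u"
  using assms desc unfolding descending_def by auto

lemmas top1 = top_fan[OF angles_pos(1,2,3) N1(1,2) ok(1), folded legs]
lemmas top2 = top_fan[OF angles_pos(2,1,4) N1(3,2) ok(2), folded legs]
lemmas bot1 = bottom_fan[OF angles_pos(1,2,3) N1(1,2) ok(1), folded legs, unfolded N1(7)]
lemmas bot2 = bottom_fan[OF angles_pos(2,1,4) N1(3,2) ok(2), folded legs, unfolded N1(7)]

lemma good:
  "j \<le> k + 2 \<Longrightarrow> lo \<le> pi + real j * drift - phi \<and> pi + real j * drift - phi \<le> hi"
  "j \<le> k + 1 \<Longrightarrow> lo \<le> th1 - real j * drift - phi \<and> th1 - real j * drift - phi \<le> hi"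
  "j \<le> k \<Longrightarrow> lo \<le> th2 + real j * drift - phi \<and> th2 + real j * drift - phi \<le> hi"
  "j \<le> k + 1 \<Longrightarrow> lo \<le> th3 - real j * drift - phi \<and> th3 - real j * drift - phi \<le> hi"
  using desc unfolding descending_def by blast+

lemma good_E: "lo \<le> E1 - phi \<and> E1 - phi \<le> hi" "lo \<le> E2 - phi \<and> E2 - phi \<le> hi"
  "lo \<le> E3 - phi \<and> E3 - phi \<le> hi" "lo \<le> E4 - phi \<and> E4 - phi \<le> hi"
  using good(1)[of "k + 2"] good(2)[of "k + 1"] good(3)[of k] good(4)[of "k + 1"]
  by (simp_all add: E1_def E2_def E3_def E4_def add.commute)

lemma turn_sums:
  "pi + real j * drift - turn1 + turn2 = pi + real (Suc j) * drift"
  "th1 - real j * drift - turn2 + turn1 = th1 - real (Suc j) * drift"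
  "th2 + real j * drift - turn1 + turn2 = th2 + real (Suc j) * drift"
  "th3 - real j * drift - turn2 + turn1 = th3 - real (Suc j) * drift"
  by (simp_all add: drift_def algebra_simps)

text \<open>
  In each part, the bottoms are not higher than a critical bottom at its start, and the tops are not
  lower than a critical top at its end; wide fans are controlled by their critical apex.  In part 1
  these are \<open>C4\<close>, translated back by one period, and \<open>C1\<close>.
\<close>

lemma part1_holds: "part1 (\<lambda>z. c < hgt phi z) (\<lambda>z. hgt phi z < c)"
proof -
  have ent: "p1 (Suc j) - cis (pi + real (Suc j) * drift) = q1 j" for j
    by (simp add: p1_def q1_def zig_Suc add.commute)
  have q: "q1 j = p1 j + cis (pi + real j * drift - turn1)" for j by (simp add: q1_def)
  have p: "q1 j + cis (pi + real (Suc j) * drift) = p1 (Suc j)" for j by (simp add: ent[symmetric])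
  have A: "p1 0 - complex_of_real (leg2 x) * cis (pi + fst x) = C4 - (T2 - 1)"
  proof -
    have "E4 - gap2 = pi"
      by (simp add: E4_def th3_def E3_def th2_def E2_def th1_def E1_def algebra_simps)
    hence "C4 = T2 + complex_of_real (leg1 x) * cis (pi - snd x)" by (simp add: C4_def)
    moreover have "complex_of_real (leg1 x) * cis (pi - snd x) = - 1 - complex_of_real (leg2 x) * cis (pi + fst x)"
      using leg_identities(2)[of pi] by simp
    ultimately show ?thesis by (simp add: p1_def)
  qed
  hence A': "hgt phi (p1 0 - complex_of_real (leg2 x) * cis (pi + fst x)) < c"
    using bots level by (simp add: hgt_diff)
  have B: "hgt phi (q1 j) < c \<and> (\<forall>z\<in>fan (p1 j) (leg2 x) (pi + real j * drift) (fst x) (n - 1) (n - 1). hgt phi z < c)"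
    if "j \<le> k + 1" for j
    using that
  proof (induction j)
    case 0
    have g: "lo \<le> pi + real 0 * drift - phi \<and> pi + real 0 * drift - phi \<le> hi" by (rule good(1)) simp
    show ?case using A' top1(2,4)[OF g, where P = "p1 0"] unfolding q[of 0] by fastforce
  next
    case (Suc j)
    have g: "lo \<le> pi + real (Suc j) * drift - phi \<and> pi + real (Suc j) * drift - phi \<le> hi"
      by (rule good(1)) (use Suc in simp)
    have e: "hgt phi (p1 (Suc j)) - sin (pi + real (Suc j) * drift - phi) = hgt phi (q1 j)"
      unfolding ent[symmetric] hgt_diff hgt_cis ..
    have "hgt phi (q1 j) < c" using Suc by simp
    thus ?case using top1(1,3)[OF g, where P = "p1 (Suc j)"] unfolding q[of "Suc j"] e by fastforce
  qed
  have T: "hgt phi (p1 (Suc j)) \<le> hgt phi (p1 j)"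
    "\<forall>z\<in>fan (q1 j) (leg1 x) (pi + real j * drift - turn1) (- snd x) (n - 1) (n - 1). hgt phi (p1 (Suc j)) \<le> hgt phi z"
    if "j \<le> k" for j
  proof -
    have g: "lo \<le> pi + real j * drift - turn1 + turn2 - phi \<and> pi + real j * drift - turn1 + turn2 - phi \<le> hi"
      unfolding turn_sums by (rule good(1)) (use that in simp)
    show "hgt phi (p1 (Suc j)) \<le> hgt phi (p1 j)"
      using bot2(3)[OF g, where P = "q1 j"] unfolding turn_sums p by (simp add: q)
    show "\<forall>z\<in>fan (q1 j) (leg1 x) (pi + real j * drift - turn1) (- snd x) (n - 1) (n - 1). hgt phi (p1 (Suc j)) \<le> hgt phi z"
      using bot2(1)[OF g, where P = "q1 j"] unfolding turn_sums p by blast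
  qed
  have g: "lo \<le> pi + real (Suc k) * drift - turn1 + turn2 - phi \<and> pi + real (Suc k) * drift - turn1 + turn2 - phi \<le> hi"
    unfolding turn_sums by (rule good(1)) simp
  have E: "pi + real (Suc (Suc k)) * drift = E1" by (simp add: E1_def algebra_simps)
  have C: "q1 (Suc k) + complex_of_real (leg1 x) * cis (E1 + snd x) = C1"
    using leg_identities(1)[of E1] by (simp add: C1_def B1_def algebra_simps)
  have r: "real k + 1 = real (Suc k)" by simp
  have L: "hgt phi C1 \<le> hgt phi (p1 (Suc k))"
    "\<forall>z\<in>fan (q1 (Suc k)) (leg1 x) (pi + real (Suc k) * drift - turn1) (- snd x) (n - 2) (n - 1). hgt phi C1 \<le> hgt phi z"
    using bot2(4)[OF g, where P = "q1 (Suc k)"] bot2(2)[OF g, where P = "q1 (Suc k)"]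
    unfolding turn_sums E C by (simp add: q, blast)
  have P: "c < hgt phi (p1 j)" if "j \<le> k + 1" for j
    using dec_chain[of "Suc k" "\<lambda>j. hgt phi (p1 j)" j] T(1) L(1) tops(3) that by fastforce
  show ?thesis unfolding part1_def r
    using B P T(2) L(2) tops(3) by (fastforce dest: spec)
qed

lemma part2_holds: "part2 (\<lambda>z. c < hgt phi z) (\<lambda>z. hgt phi z < c)"
proof -
  have q: "q2 j = p2 j + cis (th1 - real j * drift)" for j by (simp add: q2_def)
  have p: "p2 (Suc j) = q2 j + cis (th1 - real j * drift - turn2)" for j by (simp add: p2_def q2_def zag_Suc)
  have W: "\<forall>z\<in>fan B1 (leg2 x) E1 (- fst x) n n. hgt phi C1 \<le> hgt phi z"
    using wide_bottom_fan[OF angles_pos(1,2,3) N1(4,6) ok(3)[OF good_E(1)] ok(6)[OF good_E(1)] ok(7)[OF good_E(1)],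
        folded legs, of _ B1] unfolding C1_def by blast
  have B: "hgt phi (p2 (Suc j)) \<le> hgt phi (p2 j)"
    "\<forall>z\<in>fan (q2 j) (leg1 x) (th1 - real j * drift) (snd x) (n - 1) (n - 1). hgt phi z \<le> hgt phi (p2 j)"
    if "j \<le> k" for j
  proof -
    have g: "lo \<le> th1 - real j * drift - phi \<and> th1 - real j * drift - phi \<le> hi"
      by (rule good(2)) (use that in simp)
    have e: "hgt phi (q2 j) - sin (th1 - real j * drift - phi) = hgt phi (p2 j)"
      unfolding q hgt_add hgt_cis by simp
    show "hgt phi (p2 (Suc j)) \<le> hgt phi (p2 j)" using top2(3)[OF g, where P = "q2 j"] unfolding e p .
    show "\<forall>z\<in>fan (q2 j) (leg1 x) (th1 - real j * drift) (snd x) (n - 1) (n - 1). hgt phi z \<le> hgt phi (p2 j)"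
      using top2(1)[OF g, where P = "q2 j"] unfolding e by blast
  qed
  have P: "hgt phi (p2 j) < c" if "j \<le> Suc k" for j
    using that
  proof (induction j)
    case 0 show ?case using bots by (simp add: p2_def)
  next
    case (Suc j) thus ?case using B(1)[of j] by simp
  qed
  have T: "hgt phi (q2 (Suc j)) \<le> hgt phi (q2 j)"
    "\<forall>z\<in>fan (p2 (Suc j)) (leg2 x) (th1 - real j * drift - turn2) (- fst x) (n - 1) (n - 1). hgt phi (q2 (Suc j)) \<le> hgt phi z"
    if "j < k" for j
  proof -
    have g: "lo \<le> th1 - real j * drift - turn2 + turn1 - phi \<and> th1 - real j * drift - turn2 + turn1 - phi \<le> hi"
      unfolding turn_sums by (rule good(2)) (use that in simp)
    show "hgt phi (q2 (Suc j)) \<le> hgt phi (q2 j)"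
      using bot1(3)[OF g, where P = "p2 (Suc j)"] unfolding turn_sums q[symmetric] by (simp add: p)
    show "\<forall>z\<in>fan (p2 (Suc j)) (leg2 x) (th1 - real j * drift - turn2) (- fst x) (n - 1) (n - 1). hgt phi (q2 (Suc j)) \<le> hgt phi z"
      using bot1(1)[OF g, where P = "p2 (Suc j)"] unfolding turn_sums q[symmetric] by blast
  qed
  have g: "lo \<le> th1 - real k * drift - turn2 + turn1 - phi \<and> th1 - real k * drift - turn2 + turn1 - phi \<le> hi"
    unfolding turn_sums by (rule good(2)) simp
  have E: "th1 - real (Suc k) * drift = E2" by (simp add: E2_def algebra_simps)
  have C: "p2 (Suc k) + complex_of_real (leg2 x) * cis (E2 + fst x) = C2"
    using leg_identities(2)[of E2] by (simp add: C2_def B2_def algebra_simps)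
  have L: "hgt phi C2 \<le> hgt phi (q2 k)"
    "\<forall>z\<in>fan (p2 (Suc k)) (leg2 x) (th1 - real k * drift - turn2) (- fst x) (n - 2) (n - 1). hgt phi C2 \<le> hgt phi z"
    using bot1(4)[OF g, where P = "p2 (Suc k)"] bot1(2)[OF g, where P = "p2 (Suc k)"]
    unfolding turn_sums E C by (simp add: p, blast)
  have Q: "c < hgt phi (q2 j)" if "j \<le> k" for j
    using dec_chain[of k "\<lambda>j. hgt phi (q2 j)" j] T(1) L(1) tops(4) that by fastforce
  show ?thesis unfolding part2_def
  proof (intro conjI allI impI ballI)
    show "hgt phi B1 < c" by (rule bots)
    show "c < hgt phi z" if "z \<in> fan B1 (leg2 x) E1 (- fst x) n n" for z
      using W that tops(3) by fastforce
    show "c < hgt phi (q2 j)" "hgt phi (p2 (Suc j)) < c" if "j \<le> k" for j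
      using Q P that by simp_all
    show "hgt phi z < c" if "j \<le> k" "z \<in> fan (q2 j) (leg1 x) (th1 - real j * drift) (snd x) (n - 1) (n - 1)" for j z
      using B(2)[OF that(1)] that P[of j] by fastforce
    show "c < hgt phi z" if "j < k" "z \<in> fan (p2 (Suc j)) (leg2 x) (th1 - real j * drift - turn2) (- fst x) (n - 1) (n - 1)" for j z
      using T(2)[OF that(1)] that Q[of "Suc j"] by fastforce
    show "c < hgt phi z" if "z \<in> fan (p2 (Suc k)) (leg2 x) (th1 - real k * drift - turn2) (- fst x) (n - 2) (n - 1)" for z
      using L(2) that tops(4) by fastforce
  qed
qed

lemma part3_holds: "part3 (\<lambda>z. c < hgt phi z) (\<lambda>z. hgt phi z < c)"
proof -
  have q: "q3 j = p3 j + cis (th2 + real j * drift - turn1)" for j by (simp add: q3_def)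
  have p: "p3 (Suc j) = q3 j + cis (th2 + real (Suc j) * drift)" for j
    by (simp add: p3_def q3_def zig_Suc add.commute)
  have W: "\<forall>z\<in>fan B2 (leg1 x) E2 (- snd x) n n. hgt phi C2 \<le> hgt phi z"
    using wide_bottom_fan[OF angles_pos(2,1,4) N1(5,6) ok(3)[OF good_E(2)] ok(10)[OF good_E(2)] ok(11)[OF good_E(2)],
        folded legs, of _ B2] unfolding C2_def by blast
  have V: "\<forall>z\<in>fan T1 (leg2 x) E3 (fst x) (n - 1) n. hgt phi z \<le> hgt phi C3"
    using wide_top_fan[OF angles_pos(1,2,3) N1(4,6) ok(3)[OF good_E(3)] ok(4)[OF good_E(3)] ok(5)[OF good_E(3)],
        folded legs, of _ T1] unfolding C3_def by blast
  have B: "hgt phi (q3 j) < c \<and> (\<forall>z\<in>fan (p3 j) (leg2 x) (th2 + real j * drift) (fst x) (n - 1) (n - 1). hgt phi z < c)"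
    if "j < k" for j
    using that
  proof (induction j)
    case 0
    have g: "lo \<le> th2 + real 0 * drift - phi \<and> th2 + real 0 * drift - phi \<le> hi" by (rule good(3)) simp
    have e: "hgt phi (p3 0) - sin (th2 + real 0 * drift - phi) = hgt phi B2"
      by (simp add: p3_def hgt_add hgt_cis)
    show ?case using bots(2) top1(1,3)[OF g, where P = "p3 0"] unfolding q[of 0] e by fastforce
  next
    case (Suc j)
    have g: "lo \<le> th2 + real (Suc j) * drift - phi \<and> th2 + real (Suc j) * drift - phi \<le> hi"
      by (rule good(3)) (use Suc in simp)
    have e: "hgt phi (p3 (Suc j)) - sin (th2 + real (Suc j) * drift - phi) = hgt phi (q3 j)"
      unfolding p hgt_add hgt_cis by simp
    have "hgt phi (q3 j) < c" using Suc by simp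
    thus ?case using top1(1,3)[OF g, where P = "p3 (Suc j)"] unfolding q[of "Suc j"] e by fastforce
  qed
  have T: "hgt phi (p3 (Suc j)) \<le> hgt phi (p3 j)"
    "\<forall>z\<in>fan (q3 j) (leg1 x) (th2 + real j * drift - turn1) (- snd x) (n - 1) (n - 1). hgt phi (p3 (Suc j)) \<le> hgt phi z"
    if "j < k" for j
  proof -
    have g: "lo \<le> th2 + real j * drift - turn1 + turn2 - phi \<and> th2 + real j * drift - turn1 + turn2 - phi \<le> hi"
      unfolding turn_sums by (rule good(3)) (use that in simp)
    show "hgt phi (p3 (Suc j)) \<le> hgt phi (p3 j)"
      using bot2(3)[OF g, where P = "q3 j"] unfolding turn_sums p[symmetric] by (simp add: q)
    show "\<forall>z\<in>fan (q3 j) (leg1 x) (th2 + real j * drift - turn1) (- snd x) (n - 1) (n - 1). hgt phi (p3 (Suc j)) \<le> hgt phi z"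
      using bot2(1)[OF g, where P = "q3 j"] unfolding turn_sums p[symmetric] by blast
  qed
  have P: "c < hgt phi (p3 j)" if "j \<le> k" for j
    using dec_chain[of k "\<lambda>j. hgt phi (p3 j)" j] T(1) tops(1) that unfolding T1_def by fastforce
  show ?thesis unfolding part3_def
  proof (intro conjI allI impI ballI)
    show "hgt phi B2 < c" "c < hgt phi T1" by (rule bots tops)+
    show "c < hgt phi z" if "z \<in> fan B2 (leg1 x) E2 (- snd x) n n" for z
      using W that tops(4) by fastforce
    show "c < hgt phi (p3 j)" "hgt phi (q3 j) < c" if "j < k" for j
      using P B that by simp_all
    show "hgt phi z < c" if "j < k" "z \<in> fan (p3 j) (leg2 x) (th2 + real j * drift) (fst x) (n - 1) (n - 1)" for j z
      using B[OF that(1)] that by blast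
    show "c < hgt phi z" if "j < k" "z \<in> fan (q3 j) (leg1 x) (th2 + real j * drift - turn1) (- snd x) (n - 1) (n - 1)" for j z
      using T(2)[OF that(1)] that P[of "Suc j"] by fastforce
    show "hgt phi z < c" if "z \<in> fan T1 (leg2 x) E3 (fst x) (n - 1) n" for z
      using V that bots(3) by fastforce
  qed
qed

lemma part4_holds: "part4 (\<lambda>z. c < hgt phi z) (\<lambda>z. hgt phi z < c)"
proof -
  have q: "q4 j = p4 j + cis (th3 - real j * drift)" for j by (simp add: q4_def)
  have p: "p4 (Suc j) = q4 j + cis (th3 - real j * drift - turn2)" for j by (simp add: p4_def q4_def zag_Suc)
  have V: "\<forall>z\<in>fan T2 (leg1 x) E4 (snd x) (n - 1) n. hgt phi z \<le> hgt phi C4"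
    using wide_top_fan[OF angles_pos(2,1,4) N1(5,6) ok(3)[OF good_E(4)] ok(8)[OF good_E(4)] ok(9)[OF good_E(4)],
        folded legs, of _ T2] unfolding C4_def by blast
  have C: "q4 0 - complex_of_real (leg1 x) * cis (th3 - real 0 * drift + snd x) = C3"
    using leg_identities(1)[of th3] by (simp add: C3_def q4_def p4_def th3_def algebra_simps)
  have B: "hgt phi (p4 (Suc j)) < c \<and> (\<forall>z\<in>fan (q4 j) (leg1 x) (th3 - real j * drift) (snd x) (n - 1) (n - 1). hgt phi z < c)"
    if "j \<le> k" for j
    using that
  proof (induction j)
    case 0
    have g: "lo \<le> th3 - real 0 * drift - phi \<and> th3 - real 0 * drift - phi \<le> hi" by (rule good(4)) simp
    show ?case using bots(3) top2(2,4)[OF g, where P = "q4 0"] unfolding p[of 0] C by fastforce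
  next
    case (Suc j)
    have g: "lo \<le> th3 - real (Suc j) * drift - phi \<and> th3 - real (Suc j) * drift - phi \<le> hi"
      by (rule good(4)) (use Suc in simp)
    have e: "hgt phi (q4 (Suc j)) - sin (th3 - real (Suc j) * drift - phi) = hgt phi (p4 (Suc j))"
      unfolding q hgt_add hgt_cis by simp
    have "hgt phi (p4 (Suc j)) < c" using Suc by simp
    thus ?case using top2(1,3)[OF g, where P = "q4 (Suc j)"] unfolding p[of "Suc j"] e by fastforce
  qed
  define f where "f j = (if j \<le> k then q4 j else T2)" for j
  have f: "p4 (Suc j) + cis (th3 - real (Suc j) * drift) = f (Suc j)" if "j \<le> k" for j
  proof (cases "j = k")
    case True
    have "th3 - real (Suc k) * drift = E4" by (simp add: E4_def algebra_simps)
    thus ?thesis using True by (simp add: f_def T2_def)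
  next
    case False
    thus ?thesis using that q[of "Suc j"] by (simp add: f_def)
  qed
  have T: "hgt phi (f (Suc j)) \<le> hgt phi (f j)"
    "\<forall>z\<in>fan (p4 (Suc j)) (leg2 x) (th3 - real j * drift - turn2) (- fst x) (n - 1) (n - 1). hgt phi (f (Suc j)) \<le> hgt phi z"
    if "j \<le> k" for j
  proof -
    have g: "lo \<le> th3 - real j * drift - turn2 + turn1 - phi \<and> th3 - real j * drift - turn2 + turn1 - phi \<le> hi"
      unfolding turn_sums by (rule good(4)) (use that in simp)
    have fj: "f j = q4 j" using that by (simp add: f_def)
    show "hgt phi (f (Suc j)) \<le> hgt phi (f j)"
      using bot1(3)[OF g, where P = "p4 (Suc j)"] unfolding turn_sums f[OF that] fj by (simp add: p)
    show "\<forall>z\<in>fan (p4 (Suc j)) (leg2 x) (th3 - real j * drift - turn2) (- fst x) (n - 1) (n - 1). hgt phi (f (Suc j)) \<le> hgt phi z"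
      using bot1(1)[OF g, where P = "p4 (Suc j)"] unfolding turn_sums f[OF that] by blast
  qed
  have F: "c < hgt phi (f j)" if "j \<le> Suc k" for j
  proof -
    have "hgt phi (f (Suc k)) \<le> hgt phi (f j)"
      by (rule dec_chain[of "Suc k" "\<lambda>j. hgt phi (f j)"]) (use T(1) that in auto)
    thus ?thesis using tops(2) by (simp add: f_def)
  qed
  show ?thesis unfolding part4_def
  proof (intro conjI allI impI ballI)
    show "c < hgt phi T2" by (rule tops)
    show "c < hgt phi (q4 j)" "hgt phi (p4 (Suc j)) < c" if "j \<le> k" for j
      using F[of j] B[of j] that by (simp_all add: f_def)
    show "hgt phi z < c" if "j \<le> k" "z \<in> fan (q4 j) (leg1 x) (th3 - real j * drift) (snd x) (n - 1) (n - 1)" for j z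
      using B[OF that(1)] that by blast
    show "c < hgt phi z" if "j \<le> k" "z \<in> fan (p4 (Suc j)) (leg2 x) (th3 - real j * drift - turn2) (- fst x) (n - 1) (n - 1)" for j z
      using T(2)[OF that(1)] that F[of "Suc j"] by fastforce
    show "hgt phi z < c" if "z \<in> fan T2 (leg1 x) E4 (snd x) (n - 1) n" for z
      using V that bots(4) by fastforce
  qed
qed

end

text \<open>
  A line between the four critical bottoms and the four critical tops exists, and it separates
  all bottoms from all tops.
\<close>

lemma descending_in_tile:
  assumes x: "x \<in> obtuse_params" and n: "n \<ge> 3" and desc: "descending phi lo hi"
    and d: "T2 - 1 = complex_of_real r * cis phi" "r > 0"
    and crit: "\<And>V W. V \<in> {T1, T2, C1, C2} \<Longrightarrow> W \<in> {B1, B2, C3, C4} \<Longrightarrow> hgt phi W < hgt phi V"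
  shows "x \<in> orbit_tile (word_W n k)"
proof -
  define m where "m = min (min (hgt phi T1) (hgt phi T2)) (min (hgt phi C1) (hgt phi C2))"
  define m' where "m' = max (max (hgt phi B1) (hgt phi B2)) (max (hgt phi C3) (hgt phi C4))"
  have "m' < m" using crit by (simp add: m_def m'_def)
  then obtain c where c: "m' < c" "c < m" using dense by blast
  have level: "hgt phi (T2 - 1) = 0"
    unfolding d hgt_real hgt_cis by simp
  have tb: "c < hgt phi T1" "c < hgt phi T2" "c < hgt phi C1" "c < hgt phi C2"
    "hgt phi B1 < c" "hgt phi B2 < c" "hgt phi C3 < c" "hgt phi C4 < c"
    using c by (simp_all add: m_def m'_def)
  have e: "(\<lambda>z. r * c < wedge (T2 - 1) z) = (\<lambda>z. c < hgt phi z)" "(\<lambda>z. wedge (T2 - 1) z < r * c) = (\<lambda>z. hgt phi z < c)"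
    unfolding d(1) wedge_hgt using d(2) by auto
  show ?thesis
    unfolding tile_iff_parts[OF x n] Let_def
    by (intro exI[of _ "r * c"], unfold e)
       (intro conjI part1_holds[OF x n desc level tb] part2_holds[OF x n desc level tb]
          part3_holds[OF x n desc level tb] part4_holds[OF x n desc level tb])
qed

end

section \<open>The quadrilateral\<close>

definition lam :: "nat \<Rightarrow> real" where "lam n = pi / (2 * real n)"

text \<open>
  In the affine coordinates \<open>(quad_D, quad_P)\<close>, the vertices of the quadrilateral are \<open>(-1, 1)\<close>,
  \<open>(1, 1)\<close>, \<open>(0, 0)\<close> and \<open>(0, quad_p)\<close>.  The coordinates are proportional to the limits \<open>wid\<close> and \<open>N\<close>
  of differences of height.
\<close>

definition quad_p :: "nat \<Rightarrow> real" where
  "quad_p n = (real n - 1) / (2 * (cos (lam n))\<^sup>2)"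

definition quad_P :: "nat \<Rightarrow> real \<times> real \<Rightarrow> real" where
  "quad_P n y = real n - 1 - real n * (fst y + snd y)"

definition quad_D :: "real \<times> real \<Rightarrow> real" where
  "quad_D y = fst y - snd y"

lemma cos_lam:
  assumes "n \<ge> 3"
  shows "0 < lam n" "lam n \<le> pi / 6" "0 < cos (lam n)" "0 < sin (lam n)"
proof -
  show l: "0 < lam n" using assms by (simp add: lam_def)
  show l': "lam n \<le> pi / 6" unfolding lam_def using assms by (intro divide_left_mono) auto
  show "0 < cos (lam n)" by (rule cos_gt_zero_pi) (use l l' pi_gt_zero in auto)
  show "0 < sin (lam n)" by (rule sin_gt_zero) (use l l' pi_gt_zero in auto)
qed

lemma mu_coef_alt:
  assumes "n \<ge> 3" shows "(real n - 1) * (1 - mu_coef n) = quad_p n"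
proof -
  have c: "cos (lam n) \<noteq> 0" using cos_lam[OF assms] by simp
  have "(tan (lam n))\<^sup>2 = 1 / (cos (lam n))\<^sup>2 - 1"
    using c sin_cos_squared_add[of "lam n"] by (simp add: tan_def power_divide field_simps)
  hence "1 - mu_coef n = 1 / (2 * (cos (lam n))\<^sup>2)"
    unfolding mu_coef_def lam_def[symmetric] by (simp add: field_simps)
  thus ?thesis by (simp add: quad_p_def)
qed

lemma quad_p_ge_1: "n \<ge> 3 \<Longrightarrow> quad_p n \<ge> 1"
proof -
  assume n: "n \<ge> 3"
  have "(cos (lam n))\<^sup>2 \<le> 1" using cos_lam[OF n] by (simp add: power_le_one)
  moreover have "(cos (lam n))\<^sup>2 > 0" using cos_lam[OF n] by simp
  moreover have "2 \<le> real n - 1" using n by simp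
  ultimately show ?thesis unfolding quad_p_def by (simp add: field_simps)
qed

definition half :: "real \<Rightarrow> real \<Rightarrow> real \<Rightarrow> (real \<times> real) set" where
  "half a b g = {y. (a, b) \<bullet> y \<le> g}"

lemma in_half: "y \<in> half a b g \<longleftrightarrow> a * fst y + b * snd y \<le> g"
  by (cases y) (simp add: half_def)

lemma half_props:
  "convex (half a b g)" "closed (half a b g)"
  "a + b \<noteq> 0 \<Longrightarrow> interior (half a b g) = {y. a * fst y + b * snd y < g}"
proof -
  show "convex (half a b g)" unfolding half_def by (rule convex_halfspace_le)
  show "closed (half a b g)" unfolding half_def by (rule closed_halfspace_le)
  assume "a + b \<noteq> 0"
  hence "(a, b) \<noteq> 0" by (auto simp: zero_prod_def)
  hence "interior (half a b g) = {y. (a, b) \<bullet> y < g}" unfolding half_def by (rule interior_halfspace_le)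
  thus "interior (half a b g) = {y. a * fst y + b * snd y < g}" by (auto simp: inner_prod_def)
qed

definition quad_half :: "nat \<Rightarrow> (real \<times> real) set" where
  "quad_half n = half (real n + 1) (real n - 1) (real n - 1) \<inter> half (real n - 1) (real n + 1) (real n - 1)
     \<inter> (half (- real n - (1 - quad_p n)) (- real n + (1 - quad_p n)) (quad_p n - (real n - 1))
     \<inter> half (- real n + (1 - quad_p n)) (- real n - (1 - quad_p n)) (quad_p n - (real n - 1)))"

lemma in_quad_half:
  "y \<in> quad_half n \<longleftrightarrow> quad_D y \<le> quad_P n y \<and> - quad_D y \<le> quad_P n y
     \<and> quad_P n y \<le> (1 - quad_D y) * quad_p n + quad_D y
     \<and> quad_P n y \<le> (1 + quad_D y) * quad_p n - quad_D y"
  unfolding quad_half_def Int_iff in_half quad_P_def quad_D_def by (auto simp: algebra_simps)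

lemma in_interior_quad_half:
  assumes "n \<ge> 3"
  shows "y \<in> interior (quad_half n) \<longleftrightarrow> quad_D y < quad_P n y \<and> - quad_D y < quad_P n y
     \<and> quad_P n y < (1 - quad_D y) * quad_p n + quad_D y
     \<and> quad_P n y < (1 + quad_D y) * quad_p n - quad_D y"
proof -
  have "interior (quad_half n) = {y. (real n + 1) * fst y + (real n - 1) * snd y < real n - 1}
    \<inter> {y. (real n - 1) * fst y + (real n + 1) * snd y < real n - 1}
    \<inter> ({y. (- real n - (1 - quad_p n)) * fst y + (- real n + (1 - quad_p n)) * snd y < quad_p n - (real n - 1)}
    \<inter> {y. (- real n + (1 - quad_p n)) * fst y + (- real n - (1 - quad_p n)) * snd y < quad_p n - (real n - 1)})"
    unfolding quad_half_def interior_Int using assms by (subst half_props(3), simp)+ simp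
  thus ?thesis unfolding quad_P_def quad_D_def by (auto simp: algebra_simps)
qed

text \<open>
  A point of the intersection of the half planes is a convex combination of the vertex on its side
  of the diagonal \<open>D = 0\<close>, with weight \<open>\<bar>D\<bar>\<close>, and of a point of this diagonal.
\<close>

lemma Q_quad_eq:
  assumes n: "n \<ge> 3" shows "Q_quad n = quad_half n"
proof
  let ?v1 = "(- 1 / real n, 1 - 1 / real n)" let ?v2 = "(1 - 1 / real n, - 1 / real n)"
  let ?v3 = "(a_coef n, a_coef n)" let ?v4 = "(mu_coef n * a_coef n, mu_coef n * a_coef n)"
  have n0: "real n > 0" using n by simp
  have a: "real n * (2 * a_coef n) = real n - 1" using n0 by (simp add: a_coef_def field_simps)
  have "quad_P n ?v4 = real n - 1 - mu_coef n * (real n * (2 * a_coef n))"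
    by (simp add: quad_P_def algebra_simps)
  hence P4: "quad_P n ?v4 = quad_p n" unfolding a mu_coef_alt[OF n, symmetric] by (simp add: algebra_simps)
  have P: "quad_P n ?v1 = 1" "quad_P n ?v2 = 1" "quad_P n ?v3 = 0" "quad_P n ?v4 = quad_p n"
    "quad_D ?v1 = -1" "quad_D ?v2 = 1" "quad_D ?v3 = 0" "quad_D ?v4 = 0"
    using n0 P4 by (simp_all add: quad_P_def quad_D_def a_coef_def field_simps)
  have p: "quad_p n \<ge> 1" by (rule quad_p_ge_1[OF n])
  have conv: "convex (quad_half n)" unfolding quad_half_def by (intro convex_Int half_props)
  show "Q_quad n \<subseteq> quad_half n"
  proof -
    have "?v1 \<in> quad_half n" "?v2 \<in> quad_half n" "?v3 \<in> quad_half n" "?v4 \<in> quad_half n"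
      unfolding in_quad_half P using p by simp_all
    thus ?thesis unfolding Q_quad_def by (intro hull_minimal conv) blast
  qed
  have vs: "?v1 \<in> Q_quad n" "?v2 \<in> Q_quad n" "?v3 \<in> Q_quad n" "?v4 \<in> Q_quad n"
    unfolding Q_quad_def by (rule hull_inc; simp)+
  have cQ: "convex (Q_quad n)" unfolding Q_quad_def by (rule convex_convex_hull)
  show "quad_half n \<subseteq> Q_quad n"
  proof
    fix y assume y: "y \<in> quad_half n"
    define D where "D = quad_D y" define p where "p = quad_p n"
    have h: "D \<le> quad_P n y" "- D \<le> quad_P n y" "quad_P n y \<le> (1 - D) * p + D" "quad_P n y \<le> (1 + D) * p - D"
      using y unfolding in_quad_half D_def p_def by auto
    have p1: "p > 0" using quad_p_ge_1[OF n] by (simp add: p_def)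
    define w where "w = (if D \<ge> 0 then ?v2 else ?v1)"
    have w: "w \<in> Q_quad n" "quad_P n w = 1" "quad_D w = (if D \<ge> 0 then 1 else - 1)"
      using vs P by (auto simp: w_def)
    define t where "t = \<bar>D\<bar>"
    have tP: "t \<le> quad_P n y" "quad_P n y \<le> (1 - t) * p + t" using h by (auto simp: t_def abs_if)
    have "0 \<le> (1 - t) * p" using tP by linarith
    hence t: "0 \<le> t" "t \<le> 1" using p1 by (auto simp: t_def zero_le_mult_iff)
    define r where "r = (if t = 1 then 0 else (quad_P n y - t) / ((1 - t) * p))"
    have r: "0 \<le> r" "r \<le> 1" "(1 - t) * p * r = quad_P n y - t"
      using tP t p1 by (auto simp: r_def field_simps)
    define m where "m = (1 - r) *\<^sub>R ?v3 + r *\<^sub>R ?v4"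
    have m: "m \<in> Q_quad n" unfolding m_def using r vs cQ by (intro convexD_alt) auto
    have "(1 - t) *\<^sub>R m + t *\<^sub>R w \<in> Q_quad n" using t m w cQ by (intro convexD_alt) auto
    moreover have "(1 - t) *\<^sub>R m + t *\<^sub>R w = y"
    proof -
      have lin: "quad_P n ((1 - a) *\<^sub>R u + a *\<^sub>R v) = (1 - a) * quad_P n u + a * quad_P n v"
        "quad_D ((1 - a) *\<^sub>R u + a *\<^sub>R v) = (1 - a) * quad_D u + a * quad_D v" for a u v
        by (simp_all add: quad_P_def quad_D_def algebra_simps)
      have 1: "quad_P n ((1 - t) *\<^sub>R m + t *\<^sub>R w) = quad_P n y"
        unfolding lin m_def w(2) P using r(3) by (simp add: p_def algebra_simps)
      have 2: "quad_D ((1 - t) *\<^sub>R m + t *\<^sub>R w) = quad_D y"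
        unfolding lin m_def w(3) P by (simp add: t_def D_def[symmetric] abs_if)
      have "fst u = ((real n - 1 - quad_P n u) / real n + quad_D u) / 2"
        "snd u = ((real n - 1 - quad_P n u) / real n - quad_D u) / 2" for u
        using n0 by (simp_all add: quad_P_def quad_D_def field_simps)
      thus ?thesis using 1 2 by (metis prod_eqI)
    qed
    ultimately show "y \<in> Q_quad n" by simp
  qed
qed

lemma interior_Q_nonempty:
  assumes n: "n \<ge> 3" shows "interior (Q_quad n) \<noteq> {}"
proof -
  let ?y = "((real n - 1 - quad_p n / 2) / (2 * real n), (real n - 1 - quad_p n / 2) / (2 * real n))"
  have "quad_D ?y = 0" by (simp add: quad_D_def)
  moreover have "quad_P n ?y = quad_p n / 2" using n by (simp add: quad_P_def field_simps)
  ultimately have "?y \<in> interior (quad_half n)"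
    using quad_p_ge_1[OF n] by (simp add: in_interior_quad_half[OF n])
  thus ?thesis unfolding Q_quad_eq[OF n] by blast
qed

lemma compact_Q: "compact (Q_quad n)"
  unfolding Q_quad_def by (intro finite_imp_compact_convex_hull) simp

lemma convex_Q: "convex (Q_quad n)"
  unfolding Q_quad_def by (rule convex_convex_hull)

section \<open>Limits of points of the tiles\<close>

lemma zeta_alt: "zeta n = 2 * (real n - 1) * cos (lam n) / sin (lam n)"
  by (simp add: zeta_def lam_def cot_def)

lemma zeta_pos: "n \<ge> 3 \<Longrightarrow> zeta n > 0"
  using cos_lam[of n] by (simp add: zeta_alt)

lemma scaled_angles:
  assumes n: "n \<ge> 3" and k: "k > 0"
  shows "fst x = lam n + fst (S_map n k x) / (zeta n * (real k)\<^sup>2)"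
    "snd x = lam n + snd (S_map n k x) / (zeta n * (real k)\<^sup>2)"
    "(real k)\<^sup>2 * hs_word.gap1 x n = - (2 * real n / zeta n) * fst (S_map n k x)"
    "(real k)\<^sup>2 * hs_word.gap2 x n = - (2 * real n / zeta n) * snd (S_map n k x)"
    "(real k)\<^sup>2 * hs_word.drift x n = 2 * (real n - 1) / zeta n * (fst (S_map n k x) - snd (S_map n k x))"
proof -
  have z: "zeta n * (real k)\<^sup>2 \<noteq> 0" "zeta n \<noteq> 0" "(real k)\<^sup>2 \<noteq> 0" "real n \<noteq> 0"
    using zeta_pos[OF n] k n by auto
  have y: "fst (S_map n k x) = zeta n * (real k)\<^sup>2 * (fst x - lam n)"
    "snd (S_map n k x) = zeta n * (real k)\<^sup>2 * (snd x - lam n)"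
    by (simp_all add: S_map_def V_pt_def lam_def)
  show "fst x = lam n + fst (S_map n k x) / (zeta n * (real k)\<^sup>2)"
    "snd x = lam n + snd (S_map n k x) / (zeta n * (real k)\<^sup>2)"
    unfolding y using z by simp_all
  have p: "pi = 2 * real n * lam n" using n by (simp add: lam_def)
  show "(real k)\<^sup>2 * hs_word.gap1 x n = - (2 * real n / zeta n) * fst (S_map n k x)"
    "(real k)\<^sup>2 * hs_word.gap2 x n = - (2 * real n / zeta n) * snd (S_map n k x)"
    unfolding y hs_word.gap1_def hs_word.gap2_def p using z by (simp_all add: field_simps)
  show "(real k)\<^sup>2 * hs_word.drift x n = 2 * (real n - 1) / zeta n * (fst (S_map n k x) - snd (S_map n k x))"
    unfolding y hs_word.drift_def hs_word.turn1_def hs_word.turn2_def using z by (simp add: field_simps)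
qed

lemma hs_seq0_scaled:
  assumes n: "n \<ge> 3" and K: "filterlim K at_top sequentially"
    and lim: "(\<lambda>j. S_map n (K j) (X j)) \<longlonglongrightarrow> y"
  shows "hs_seq0 n X K 0 (2 * (real n - 1) / zeta n * quad_D y) (- (2 * real n / zeta n) * fst y)"
proof -
  have K0: "eventually (\<lambda>j. K j > 0) sequentially"
    using K[unfolded filterlim_at_top, rule_format, of 1] by eventually_elim simp
  have ki: "(\<lambda>j. 1 / real (K j)) \<longlonglongrightarrow> 0"
    by (rule tendsto_divide_0[OF tendsto_const])
       (rule filterlim_at_top_imp_at_infinity[OF filterlim_compose[OF filterlim_real_sequentially K]])
  have f: "(\<lambda>j. - (2 * real n / zeta n) * fst (S_map n (K j) (X j))) \<longlonglongrightarrow> - (2 * real n / zeta n) * fst y"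
    by (intro tendsto_mult tendsto_const tendsto_fst lim)
  have g: "(\<lambda>j. (real (K j))\<^sup>2 * hs_word.gap1 (X j) n) \<longlonglongrightarrow> - (2 * real n / zeta n) * fst y"
    by (rule Lim_transform_eventually[OF f]) (use K0 in eventually_elim, simp only: scaled_angles(3)[OF n])
  have "(\<lambda>j. 2 * (real n - 1) / zeta n * (fst (S_map n (K j) (X j)) - snd (S_map n (K j) (X j))))
    \<longlonglongrightarrow> 2 * (real n - 1) / zeta n * quad_D y"
    unfolding quad_D_def by (intro tendsto_mult tendsto_const tendsto_fst tendsto_snd tendsto_diff lim)
  hence d: "(\<lambda>j. (real (K j))\<^sup>2 * hs_word.drift (X j) n) \<longlonglongrightarrow> 2 * (real n - 1) / zeta n * quad_D y"
    by (rule Lim_transform_eventually) (use K0 in eventually_elim, simp only: scaled_angles(5)[OF n])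
  have "(\<lambda>j. (real (K j))\<^sup>2 * hs_word.gap1 (X j) n * (1 / real (K j))) \<longlonglongrightarrow> - (2 * real n / zeta n) * fst y * 0"
    by (intro tendsto_mult g ki)
  hence "(\<lambda>j. (real (K j))\<^sup>2 * hs_word.gap1 (X j) n * (1 / real (K j))) \<longlonglongrightarrow> 0" by simp
  hence "(\<lambda>j. real (K j) * hs_word.gap1 (X j) n) \<longlonglongrightarrow> 0"
    by (rule Lim_transform_eventually) (use K0 in eventually_elim, simp add: power2_eq_square)
  with n K d have h: "hs_seq n X K 0 (2 * (real n - 1) / zeta n * quad_D y)" by (simp add: hs_seq_def)
  show ?thesis
    unfolding hs_seq0_def hs_seq0_axioms_def hs_seq.k_def[OF h] hs_seq.g1_def[OF h]
    using h g by (simp add: power2_eq_square mult.assoc)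
qed

text \<open>
  The factor \<open>zeta\<close> of the dilation is such that \<open>cos (lam n) / zeta n\<close> equals
  \<open>sin (lam n) / (2 * (n - 1))\<close>; this makes all the limits multiples of the same number \<open>f\<close>.
\<close>

lemma limit_values:
  assumes n: "n \<ge> 3" and h: "hs_seq0 n X K 0 (2 * (real n - 1) / zeta n * quad_D y) (- (2 * real n / zeta n) * fst y)"
  defines "De \<equiv> 2 * (real n - 1) / zeta n * quad_D y" and "ea \<equiv> - (2 * real n / zeta n) * fst y"
    and "f \<equiv> sin (lam n) / (real n - 1)"
  shows "f > 0" "hs_seq.c n > 0" "hs_seq0.N n De ea = f * quad_P n y" "hs_seq0.wid n De = f * quad_D y"
    "hs_seq0.qm n De = f * (quad_p n * (1 - quad_D y) / 2)" "hs_seq0.qp n De = f * (quad_p n * (1 + quad_D y) / 2)"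
    "hs_seq.c n * De = sin (lam n) * quad_D y" "hs_seq.s n = sin (lam n)" "hs_seq.c n = cos (lam n)"
    "hs_seq.lam n = lam n"
proof -
  note h0 = h[folded De_def ea_def]
  have hs: "hs_seq n X K 0 De" using h0 by (simp add: hs_seq0_def)
  have n1: "real n - 1 > 0" using n by simp
  note cs = cos_lam[OF n]
  show f: "f > 0" using cs n1 by (simp add: f_def)
  show lam: "hs_seq.lam n = lam n" by (simp add: hs_seq.lam_def[OF hs] lam_def)
  show c: "hs_seq.c n = cos (lam n)" and s: "hs_seq.s n = sin (lam n)"
    by (simp_all add: hs_seq.c_def[OF hs] hs_seq.s_def[OF hs] lam)
  show "hs_seq.c n > 0" using cs c by simp
  have cz: "cos (lam n) / zeta n = sin (lam n) / (2 * (real n - 1))"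
    unfolding zeta_alt using cs n1 by (simp add: field_simps)
  have "cos (lam n) * De = cos (lam n) / zeta n * (2 * (real n - 1) * quad_D y)" by (simp add: De_def)
  also have "\<dots> = sin (lam n) * quad_D y" unfolding cz using n1 by (simp add: field_simps)
  finally show cD: "hs_seq.c n * De = sin (lam n) * quad_D y" unfolding c .
  show "hs_seq0.wid n De = f * quad_D y"
    unfolding hs_seq0.wid_def[OF h0] cD by (simp add: f_def)
  have f': "sin (lam n) = f * (real n - 1)" using n1 by (simp add: f_def)
  have q: "quad_p n = (real n - 1) / (2 * (cos (lam n))\<^sup>2)" by (simp add: quad_p_def)
  show "hs_seq0.qm n De = f * (quad_p n * (1 - quad_D y) / 2)" "hs_seq0.qp n De = f * (quad_p n * (1 + quad_D y) / 2)"
    unfolding hs_seq0.qm_def[OF h0] hs_seq0.qp_def[OF h0] cD s unfolding c q f'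
    using cs n1 by (simp_all add: field_simps)
  have eb: "hs_seq0.eb n De ea = - (2 * real n / zeta n) * snd y"
    unfolding hs_seq0.eb_def[OF h0] unfolding De_def ea_def quad_D_def using n1 zeta_pos[OF n] by (simp add: field_simps)
  have "cos (lam n) * (ea + hs_seq0.eb n De ea) = - (cos (lam n) / zeta n) * (2 * real n * (fst y + snd y))"
    unfolding eb unfolding ea_def by (simp add: algebra_simps)
  also have "\<dots> = - f * real n * (fst y + snd y)" unfolding cz f_def using n1 by (simp add: field_simps)
  finally show "hs_seq0.N n De ea = f * quad_P n y"
    unfolding hs_seq0.N_def[OF h0] s c using f' by (simp add: quad_P_def algebra_simps)
qed

lemma orbit_tile_obtuse: "x \<in> orbit_tile W \<Longrightarrow> x \<in> obtuse_params"
  by (simp add: orbit_tile_def)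

lemma tile_critical:
  assumes n: "n \<ge> 3" and x: "x \<in> orbit_tile (word_W n k)"
    and V: "V \<in> {hs_word.T1, hs_word.T2, hs_word.C1, hs_word.C2}"
    and W: "W \<in> {hs_word.B1, hs_word.B2, hs_word.C3, hs_word.C4}"
  shows "0 < wedge (hs_word.T2 x n k - 1) (V x n k - W x n k)"
proof -
  obtain c where c: "hs_word.part2 x n k (\<lambda>z. c < wedge (hs_word.T2 x n k - 1) z) (\<lambda>z. wedge (hs_word.T2 x n k - 1) z < c)"
    "hs_word.part3 x n k (\<lambda>z. c < wedge (hs_word.T2 x n k - 1) z) (\<lambda>z. wedge (hs_word.T2 x n k - 1) z < c)"
    "hs_word.part4 x n k (\<lambda>z. c < wedge (hs_word.T2 x n k - 1) z) (\<lambda>z. wedge (hs_word.T2 x n k - 1) z < c)"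
    using x unfolding hs_word.tile_iff_parts[OF orbit_tile_obtuse[OF x] n] Let_def by blast
  have "c < wedge (hs_word.T2 x n k - 1) (V x n k)" "wedge (hs_word.T2 x n k - 1) (W x n k) < c"
    using hs_word.critical_vertices(1)[OF n c(1)] hs_word.critical_vertices(2)[OF n c(2)]
      hs_word.critical_vertices(3)[OF n c(3)] V W by auto
  thus ?thesis by (simp add: wedge_diff_right)
qed

lemma hgt_rel_diff: "hgt_rel x n k z - hgt_rel x n k w = wedge (hs_word.T2 x n k - 1) (z - w)"
  by (simp add: hgt_rel_def wedge_diff_right)

text \<open>
  Weak inequalities between heights survive in the limit; the four pairs \<open>T1\<close> and \<open>B1\<close>, \<open>T2\<close> and \<open>B2\<close>,
  \<open>C1\<close> and \<open>C3\<close>, \<open>C2\<close> and \<open>C4\<close> give the four sides.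
\<close>

lemma limit_in_Q:
  assumes n: "n \<ge> 3" and K: "filterlim K at_top sequentially"
    and lim: "(\<lambda>j. S_map n (K j) (X j)) \<longlonglongrightarrow> y"
    and tile: "\<And>j. X j \<in> orbit_tile (word_W n (K j))"
  shows "y \<in> Q_quad n"
proof -
  note h = hs_seq0_scaled[OF n K lim]
  define f where "f = sin (lam n) / (real n - 1)"
  note v = limit_values[OF n h, folded f_def]
  let ?h = "\<lambda>V j. hgt_rel (X j) n (K j) (V (X j) n (K j))"
  have le: "a \<le> b" if "W \<in> {hs_word.B1, hs_word.B2, hs_word.C3, hs_word.C4}" "?h W \<longlonglongrightarrow> 8 * hs_seq.c n * a"
    "V \<in> {hs_word.T1, hs_word.T2, hs_word.C1, hs_word.C2}" "?h V \<longlonglongrightarrow> 8 * hs_seq.c n * b" for V W a b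
  proof -
    have "8 * hs_seq.c n * a \<le> 8 * hs_seq.c n * b"
    proof (rule LIMSEQ_le[OF that(2,4)], intro exI allI impI)
      fix j
      show "?h W j \<le> ?h V j" using tile_critical[OF n tile that(3,1), of j] hgt_rel_diff by (smt (verit))
    qed
    thus ?thesis using v(2) by simp
  qed
  note ch = hs_seq0.critical_heights[OF h, unfolded v(3-6)]
  have B1: "?h hs_word.B1 \<longlonglongrightarrow> 8 * hs_seq.c n * 0" by (simp add: hgt_rel_def)
  have "0 \<le> f * quad_P n y - f * quad_D y" by (rule le[where W = hs_word.B1 and V = hs_word.T1, OF _ B1 _ ch(2)]) simp_all
  moreover have "- (f * quad_D y) \<le> f * quad_P n y" by (rule le[where W = hs_word.B2 and V = hs_word.T2, OF _ ch(1) _ ch(3)]) simp_all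
  moreover have "f * quad_P n y - f * quad_D y - f * (quad_p n * (1 - quad_D y) / 2) \<le> f * (quad_p n * (1 - quad_D y) / 2)"
    by (rule le[where W = hs_word.C3 and V = hs_word.C1, OF _ ch(6) _ ch(4)]) simp_all
  moreover have "f * quad_P n y - f * (quad_p n * (1 + quad_D y) / 2) \<le> f * (quad_p n * (1 + quad_D y) / 2) - f * quad_D y"
    by (rule le[where W = hs_word.C4 and V = hs_word.C2, OF _ ch(7) _ ch(5)]) simp_all
  ultimately have "f * quad_D y \<le> f * quad_P n y" "f * (- quad_D y) \<le> f * quad_P n y"
    "f * quad_P n y \<le> f * ((1 - quad_D y) * quad_p n + quad_D y)"
    "f * quad_P n y \<le> f * ((1 + quad_D y) * quad_p n - quad_D y)"
    by (simp_all add: field_simps)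
  hence "y \<in> quad_half n" using v(1) unfolding in_quad_half by (simp only: mult_le_cancel_left_pos)
  thus ?thesis by (simp add: Q_quad_eq[OF n])
qed

text \<open>
  If \<open>k\<^sup>2 * gap1\<close> is unbounded on the tiles, then \<open>coarse_confinement\<close> provides a subsequence to which
  \<open>gap_not_large\<close> applies.
\<close>

lemma tiles_bounded:
  assumes n: "n \<ge> 3"
  shows "\<exists>M k0. \<forall>k\<ge>k0. \<forall>x\<in>orbit_tile (word_W n k). norm (S_map n k x) \<le> M"
proof -
  have "\<exists>m. \<forall>k\<ge>m. \<forall>x\<in>orbit_tile (word_W n k). \<bar>(real k)\<^sup>2 * hs_word.gap1 x n\<bar> \<le> real m"
  proof (rule ccontr)
    assume "\<not> ?thesis"
    hence "\<forall>m. \<exists>k x. k \<ge> m \<and> x \<in> orbit_tile (word_W n k) \<and> real m < \<bar>(real k)\<^sup>2 * hs_word.gap1 x n\<bar>"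
      by (meson not_le)
    then obtain K X where KX: "\<And>m. K m \<ge> m" "\<And>m. X m \<in> orbit_tile (word_W n (K m))"
      "\<And>m. real m < \<bar>(real (K m))\<^sup>2 * hs_word.gap1 (X m) n\<bar>" by metis
    define K' X' where "K' m = K (m + 20)" and "X' m = X (m + 20)" for m
    have K20: "K' m \<ge> 20" for m using KX(1)[of "m + 20"] by (simp add: K'_def)
    have Km: "K' m \<ge> m" for m using KX(1)[of "m + 20"] by (simp add: K'_def)
    have tile: "X' m \<in> orbit_tile (word_W n (K' m))" for m using KX(2) by (simp add: K'_def X'_def)
    have big: "real m < \<bar>(real (K' m))\<^sup>2 * hs_word.gap1 (X' m) n\<bar>" for m
      using KX(3)[of "m + 20"] by (simp add: K'_def X'_def)
    define F where "F m = (real (K' m) * hs_word.gap1 (X' m) n, (real (K' m))\<^sup>2 * hs_word.drift (X' m) n)" for m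
    have "norm (F m) \<le> 310 + 108" for m
    proof -
      note cc = hs_word.coarse_confinement[OF orbit_tile_obtuse[OF tile] n tile K20, of m]
      have k: "real (K' m) > 0" using K20[of m] by simp
      have "\<bar>fst (F m)\<bar> \<le> 310" using cc(2) k by (simp add: F_def abs_mult field_simps)
      moreover have "\<bar>snd (F m)\<bar> \<le> 108" using cc(1) k by (simp add: F_def abs_mult field_simps)
      moreover have "norm (F m) \<le> \<bar>fst (F m)\<bar> + \<bar>snd (F m)\<bar>"
        using norm_Pair_le[of "fst (F m)" "snd (F m)"] by simp
      ultimately show ?thesis by linarith
    qed
    hence "bounded (range F)" by (intro boundedI[of _ "310 + 108"]) auto
    then obtain l r where r: "strict_mono r" "(F \<circ> r) \<longlonglongrightarrow> l"
      using bounded_imp_convergent_subsequence[of F] by blast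
    have rinf: "filterlim r at_top sequentially" by (rule filterlim_subseq[OF r(1)])
    have "filterlim K' at_top sequentially"
      by (rule filterlim_at_top_mono[OF filterlim_ident]) (simp add: Km)
    hence Kr: "filterlim (\<lambda>j. K' (r j)) at_top sequentially" by (rule filterlim_compose[OF _ rinf])
    have h: "hs_seq n (\<lambda>j. X' (r j)) (\<lambda>j. K' (r j)) (fst l) (snd l)"
      unfolding hs_seq_def using n Kr tendsto_fst[OF r(2)] tendsto_snd[OF r(2)] by (simp add: F_def o_def)
    have "filterlim (\<lambda>m. \<bar>(real (K' m))\<^sup>2 * hs_word.gap1 (X' m) n\<bar>) at_top sequentially"
      by (rule filterlim_at_top_mono[OF filterlim_real_sequentially]) (use big in \<open>auto intro!: always_eventually less_imp_le\<close>)
    from filterlim_compose[OF this rinf]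
    have large: "filterlim (\<lambda>j. \<bar>(real (K' (r j)))\<^sup>2 * hs_word.gap1 (X' (r j)) n\<bar>) at_top sequentially" .
    show False
    proof (rule hs_seq.gap_not_large[OF h])
      show "0 < wedge (hs_word.T2 (X' (r j)) n (K' (r j)) - 1) (hs_word.T1 (X' (r j)) n (K' (r j)) - hs_word.B1 (X' (r j)) n (K' (r j)))" for j
        by (rule tile_critical[OF n tile]) simp_all
      show "0 < wedge (hs_word.T2 (X' (r j)) n (K' (r j)) - 1) (hs_word.C1 (X' (r j)) n (K' (r j)) - hs_word.C3 (X' (r j)) n (K' (r j)))" for j
        by (rule tile_critical[OF n tile]) simp_all
      show "filterlim (\<lambda>j. \<bar>hs_seq.k (\<lambda>j. K' (r j)) j * (hs_seq.k (\<lambda>j. K' (r j)) j * hs_seq.g1 n (\<lambda>j. X' (r j)) j)\<bar>) at_top sequentially"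
        using large by (simp add: hs_seq.k_def[OF h] hs_seq.g1_def[OF h] power2_eq_square mult.assoc)
    qed
  qed
  then obtain m where m: "\<And>k x. k \<ge> m \<Longrightarrow> x \<in> orbit_tile (word_W n k) \<Longrightarrow> \<bar>(real k)\<^sup>2 * hs_word.gap1 x n\<bar> \<le> real m"
    by blast
  define M1 where "M1 = zeta n / (2 * real n) * real m"
  define M2 where "M2 = zeta n / (2 * (real n - 1)) * 108"
  have "norm (S_map n k x) \<le> 2 * M1 + M2" if k: "k \<ge> max m 20" and x: "x \<in> orbit_tile (word_W n k)" for k x
  proof -
    have k0: "k > 0" "k \<ge> m" "k \<ge> 20" using k by auto
    define y where "y = S_map n k x"
    note sa = scaled_angles[OF n k0(1), of x, folded y_def]
    have z: "zeta n > 0" by (rule zeta_pos[OF n])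
    have n1: "real n > 0" "real n - 1 > 0" using n by simp_all
    have "2 * real n / zeta n * \<bar>fst y\<bar> \<le> real m"
      using m[OF k0(2) x] unfolding sa(3) using z n1 by (simp add: abs_mult)
    hence f: "\<bar>fst y\<bar> \<le> M1" using z n1 by (simp add: M1_def field_simps)
    have "\<bar>(real k)\<^sup>2 * hs_word.drift x n\<bar> \<le> 108"
      using hs_word.coarse_confinement(1)[OF orbit_tile_obtuse[OF x] n x k0(3)] k0 by (simp add: abs_mult field_simps)
    hence "2 * (real n - 1) / zeta n * \<bar>fst y - snd y\<bar> \<le> 108"
      unfolding sa(5) using z n1 by (simp add: abs_mult)
    hence g: "\<bar>fst y - snd y\<bar> \<le> M2" using z n1 by (simp add: M2_def field_simps)
    have "norm y \<le> \<bar>fst y\<bar> + \<bar>snd y\<bar>" using norm_Pair_le[of "fst y" "snd y"] by simp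
    thus ?thesis using f g unfolding y_def by linarith
  qed
  thus ?thesis by blast
qed

section \<open>Points over the interior of the quadrilateral\<close>

lemma polar_arctan: "Re z > 0 \<Longrightarrow> z = complex_of_real (cmod z) * cis (arctan (Im z / Re z))"
proof -
  assume r: "Re z > 0"
  define t where "t = Im z / Re z"
  have s: "sqrt (1 + t\<^sup>2) > 0" by (simp add: add_pos_nonneg)
  have "(cmod z)\<^sup>2 = (Re z * sqrt (1 + t\<^sup>2))\<^sup>2"
    using r by (simp add: cmod_power2 t_def power_mult_distrib field_simps)
  hence "cmod z = Re z * sqrt (1 + t\<^sup>2)" using r s by (simp add: power2_eq_iff_nonneg)
  thus ?thesis using r s by (simp add: complex_eq_iff cos_arctan sin_arctan t_def[symmetric])
     (simp add: t_def)
qed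

lemma between_endpoints:
  fixes a d :: real
  assumes "0 \<le> i" "i \<le> m" "lo \<le> a" "a \<le> hi" "lo \<le> a + m * d" "a + m * d \<le> hi"
  shows "lo \<le> a + i * d \<and> a + i * d \<le> hi"
proof (cases "d \<ge> 0")
  case True
  hence "0 \<le> i * d" "i * d \<le> m * d" using assms by (auto intro: mult_right_mono)
  thus ?thesis using assms by linarith
next
  case False
  hence "m * d \<le> i * d" "i * d \<le> 0" using assms by (auto intro: mult_right_mono_neg simp: mult_nonneg_nonpos)
  thus ?thesis using assms by linarith
qed

context hs_seq0
begin

text \<open>
  The direction of \<open>d\<close>, relative to \<open>psi\<close>: the four extra edges make \<open>d\<close> rise by \<open>4 * s\<close> over the length
  \<open>8 * c * k\<close>.  So the parts themselves descend relative to \<open>d\<close>.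
\<close>

definition "tilt j = arctan (Im (vec_d j) / Re (vec_d j))"

lemma lim_vec_d: "(\<lambda>j. Re (vec_d j) / k j) \<longlonglongrightarrow> 8 * c" "(\<lambda>j. Im (vec_d j)) \<longlonglongrightarrow> 4 * s"
proof -
  have B2: "expn (rv hs_word.B2) 1 1 (3 * c) (- (c * De / 2))"
    using expn_steps(2) by (simp add: rv_step(1)[abs_def])
  note T1 = expn_add[OF B2 expn_steps(3), folded rv_step(2)]
  note T2 = expn_add[OF T1 expn_steps(4), folded rv_step(3)]
  have d: "expn vec_d (1 + 1 + 1 + 1) (1 + 1 + 1 + 1) (3 * c + c + 3 * c + 5 * c)
      (- (c * De / 2) + (2 * c * (eb - De) + c * De / 2) + (2 * c * (De / (real n - 1)) - c * De / 2)
        + (- (c * De * 3 / 2) - 2 * c * ea))"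
    using expn_add[OF T2 expn_steps(1), folded rv_step(8)] .
  have r: "(\<lambda>j. Re (vec_d j) - 8 * c * k j) \<longlonglongrightarrow> 3 * c + c + 3 * c + 5 * c"
    and i: "(\<lambda>j. k j * (Im (vec_d j) - 4 * s)) \<longlonglongrightarrow>
      - (c * De / 2) + (2 * c * (eb - De) + c * De / 2) + (2 * c * (De / (real n - 1)) - c * De / 2)
        + (- (c * De * 3 / 2) - 2 * c * ea)"
    using d unfolding expn_def by simp_all
  show "(\<lambda>j. Re (vec_d j) / k j) \<longlonglongrightarrow> 8 * c" by (rule ratio[OF r])
  show "(\<lambda>j. Im (vec_d j)) \<longlonglongrightarrow> 4 * s" by (rule lim_from_k[OF i])
qed

lemma vec_d_pos: "eventually (\<lambda>j. Re (vec_d j) > 0) sequentially"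
proof -
  have "eventually (\<lambda>j. Re (vec_d j) / k j > 0) sequentially"
    using order_tendstoD(1)[OF lim_vec_d(1), of 0] lam_bounds by simp
  thus ?thesis using k_pos by eventually_elim (simp add: zero_less_divide_iff)
qed

lemma lim_k_tilt: "(\<lambda>j. k j * tilt j) \<longlonglongrightarrow> s / (2 * c)"
proof -
  have "(\<lambda>j. Im (vec_d j) / (Re (vec_d j) / k j)) \<longlonglongrightarrow> 4 * s / (8 * c)"
    using lam_bounds by (intro tendsto_divide lim_vec_d) simp
  hence q: "(\<lambda>j. k j * (Im (vec_d j) / Re (vec_d j))) \<longlonglongrightarrow> s / (2 * c)"
    by (simp add: field_simps)
  have "(\<lambda>j. k j * (arctan (Im (vec_d j) / Re (vec_d j)) - arctan 0)) \<longlonglongrightarrow> inverse (1 + 0\<^sup>2) * (s / (2 * c))"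
    by (rule scaled_deriv[OF DERIV_arctan _ unscale[OF q]]) (use q in simp)
  thus ?thesis by (simp add: tilt_def)
qed

lemma lim_kk_D': "(\<lambda>j. k j * ((k j + h) * D j)) \<longlonglongrightarrow> De"
proof -
  have "(\<lambda>j. k j * (k j * D j) + h * (k j * D j)) \<longlonglongrightarrow> De + h * 0"
    by (intro tendsto_intros lim_kk_D lim_k_D)
  thus ?thesis by (simp add: algebra_simps)
qed

lemma ev_above: "(\<lambda>j. k j * (f j - lam)) \<longlonglongrightarrow> l \<Longrightarrow> - y < l \<Longrightarrow> eventually (\<lambda>j. lam - y / k j \<le> f j) sequentially"
proof -
  assume "(\<lambda>j. k j * (f j - lam)) \<longlonglongrightarrow> l" "- y < l"
  hence "eventually (\<lambda>j. - y < k j * (f j - lam)) sequentially" by (rule order_tendstoD)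
  thus ?thesis using k_pos by eventually_elim (simp add: field_simps)
qed

lemma ev_below: "(\<lambda>j. k j * (f j - lam)) \<longlonglongrightarrow> l \<Longrightarrow> l < - y \<Longrightarrow> eventually (\<lambda>j. f j \<le> lam - y / k j) sequentially"
proof -
  assume "(\<lambda>j. k j * (f j - lam)) \<longlonglongrightarrow> l" "l < - y"
  hence "eventually (\<lambda>j. k j * (f j - lam) < - y) sequentially" by (rule order_tendstoD)
  thus ?thesis using k_pos by eventually_elim (simp add: field_simps)
qed

text \<open>
  Relative to \<open>d\<close>, the directions of the up edges are \<open>lam - s / (2 * c * k)\<close> plus a deviation of at
  most \<open>\<bar>De\<bar> / (2 * k)\<close> that comes from the drift along a part, while the angles of the triangle differ
  from \<open>lam\<close> by \<open>o(1 / k)\<close>.  Under the hypothesis there is room for a bound \<open>hi = lam - y / k\<close>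
  between the two.  For the lower bound, any fixed number between \<open>lam / 2\<close> and \<open>lam\<close> would do.
\<close>

lemma eventually_descending:
  assumes De: "\<bar>c * De\<bar> < s"
  shows "eventually (\<lambda>j. \<exists>hi. hs_word.descending (X j) n (K j) (hs_word.psi (X j) n (K j) + tilt j) (3 / 4 * lam) hi) sequentially"
proof -
  define si where "si = s / (2 * c)"
  \<comment> \<open>half of the available margin\<close>
  define y where "y = (si - \<bar>De\<bar> / 2) / 2"
  have c0: "c > 0" using lam_bounds by simp
  have "c * \<bar>De\<bar> < s" using De c0 by (simp add: abs_mult)
  hence "\<bar>De\<bar> / 2 < si" using c0 by (simp add: si_def field_simps)
  hence y: "y > 0" "De / 2 - si < - y" "- (De / 2) - si < - y" "- si - De / 2 < - y"
    by (auto simp: y_def field_simps abs_less_iff)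
  have A: "(\<lambda>j. k j * (A1 j - lam)) \<longlonglongrightarrow> De / 2" "(\<lambda>j. k j * (A2 j - lam)) \<longlonglongrightarrow> - (De / 2)"
    "(\<lambda>j. k j * (A3 j - lam)) \<longlonglongrightarrow> De / 2" "(\<lambda>j. k j * (A4 j - lam)) \<longlonglongrightarrow> - (De / 2)"
    using lim_k_A by (simp_all add: ga0 zeros)
  have E: "(\<lambda>j. k j * (A1 j - tilt j - lam)) \<longlonglongrightarrow> De / 2 - si" "(\<lambda>j. k j * (A2 j - tilt j - lam)) \<longlonglongrightarrow> - (De / 2) - si"
    "(\<lambda>j. k j * (A3 j - tilt j - lam)) \<longlonglongrightarrow> De / 2 - si" "(\<lambda>j. k j * (A4 j - tilt j - lam)) \<longlonglongrightarrow> - (De / 2) - si"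
    using A[THEN tendsto_diff, OF lim_k_tilt] by (simp_all add: si_def algebra_simps)
  have F: "(\<lambda>j. k j * (A1 j - tilt j + (k j + 2) * - D j - lam)) \<longlonglongrightarrow> - si - De / 2"
    "(\<lambda>j. k j * (A2 j - tilt j + (k j + 1) * D j - lam)) \<longlonglongrightarrow> De / 2 - si"
    "(\<lambda>j. k j * (A3 j - tilt j + k j * - D j - lam)) \<longlonglongrightarrow> - si - De / 2"
    "(\<lambda>j. k j * (A4 j - tilt j + (k j + 1) * D j - lam)) \<longlonglongrightarrow> De / 2 - si"
    using tendsto_diff[OF E(1) lim_kk_D'[of 2]] tendsto_add[OF E(2) lim_kk_D'[of 1]]
      tendsto_diff[OF E(3) lim_kk_D'[of 0]] tendsto_add[OF E(4) lim_kk_D'[of 1]]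
    by (simp_all add: algebra_simps)
  have up: "eventually (\<lambda>j. f j \<le> lam - y / k j \<and> 3 / 4 * lam \<le> f j) sequentially"
    if "(\<lambda>j. k j * (f j - lam)) \<longlonglongrightarrow> l" "l < - y" for f l
  proof -
    have "f \<longlonglongrightarrow> lam" by (rule lim_from_k[OF that(1)])
    hence "eventually (\<lambda>j. 3 / 4 * lam < f j) sequentially"
      by (rule order_tendstoD) (use lam_bounds in simp)
    with ev_below[OF that] show ?thesis by eventually_elim simp
  qed
  have z: "- y < 0" using y by simp
  have a0: "(\<lambda>j. k j * (fst (X j) - lam)) \<longlonglongrightarrow> 0" "(\<lambda>j. k j * (snd (X j) - lam)) \<longlonglongrightarrow> 0"
    using lim_k_angle by (simp_all add: ga0)
  have g0: "(\<lambda>j. k j * g1 j) \<longlonglongrightarrow> 0" "(\<lambda>j. k j * g2 j) \<longlonglongrightarrow> 0"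
    using lim_k_g1 lim_k_g2 by (simp_all add: ga0)
  define t1 where "t1 j = hs_word.turn1 (X j) n" for j
  define t2 where "t2 j = hs_word.turn2 (X j) n" for j
  have "(\<lambda>j. (real n - 1) / real n * (k j * g1 j)) \<longlonglongrightarrow> (real n - 1) / real n * 0"
    "(\<lambda>j. (real n - 1) / real n * (k j * g2 j)) \<longlonglongrightarrow> (real n - 1) / real n * 0"
    by (intro tendsto_mult tendsto_const g0)+
  hence t0: "(\<lambda>j. k j * (t1 j - 2 * lam)) \<longlonglongrightarrow> 0" "(\<lambda>j. k j * (t2 j - 2 * lam)) \<longlonglongrightarrow> 0"
    unfolding t1_def t2_def relations by (simp_all add: algebra_simps)
  have th0: "(\<lambda>j. k j * (t1 j / 2 - lam)) \<longlonglongrightarrow> 0" "(\<lambda>j. k j * (t2 j / 2 - lam)) \<longlonglongrightarrow> 0"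
    using t0[THEN tendsto_divide, OF tendsto_const, of 2] by (simp_all add: field_simps)
  have td0: "(\<lambda>j. k j * (t1 j - snd (X j) - lam)) \<longlonglongrightarrow> 0" "(\<lambda>j. k j * (t2 j - fst (X j) - lam)) \<longlonglongrightarrow> 0"
    using tendsto_diff[OF t0(1) a0(2)] tendsto_diff[OF t0(2) a0(1)] by (simp_all add: algebra_simps)
  have ga0': "(\<lambda>j. k j * (g1 j + fst (X j) - lam)) \<longlonglongrightarrow> 0" "(\<lambda>j. k j * (g2 j + snd (X j) - lam)) \<longlonglongrightarrow> 0"
    using tendsto_add[OF g0(1) a0(1)] tendsto_add[OF g0(2) a0(2)] by (simp_all add: algebra_simps)
  have l0: "0 < lam" "5 * lam < pi" using lam_bounds pi_gt_zero by auto
  have lg: "eventually (\<lambda>j. g1 j < 3 / 2 * lam) sequentially" "eventually (\<lambda>j. g2 j < 3 / 2 * lam) sequentially"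
    using order_tendstoD(2)[OF lim_g(1), of "3 / 2 * lam"] order_tendstoD(2)[OF lim_g(2), of "3 / 2 * lam"] l0 by auto
  have lf: "eventually (\<lambda>j. fst (X j) - g1 j < 3 / 2 * lam) sequentially" "eventually (\<lambda>j. snd (X j) - g2 j < 3 / 2 * lam) sequentially"
    by (rule order_tendstoD(2)[OF tendsto_diff[OF lim_angle(1) lim_g(1)]], use l0 in simp)
       (rule order_tendstoD(2)[OF tendsto_diff[OF lim_angle(2) lim_g(2)]], use l0 in simp)
  have l5: "eventually (\<lambda>j. 2 * lam + 3 * fst (X j) < pi) sequentially" "eventually (\<lambda>j. 2 * lam + 3 * snd (X j) < pi) sequentially"
    by (rule order_tendstoD(2)[OF tendsto_add[OF tendsto_const tendsto_mult[OF tendsto_const lim_angle(1)]]], use l0 in simp)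
       (rule order_tendstoD(2)[OF tendsto_add[OF tendsto_const tendsto_mult[OF tendsto_const lim_angle(2)]]], use l0 in simp)
  show ?thesis
    using up[OF E(1) y(2)] up[OF E(2) y(3)] up[OF E(3) y(2)] up[OF E(4) y(3)]
      up[OF F(1) y(4)] up[OF F(2) y(2)] up[OF F(3) y(4)] up[OF F(4) y(2)]
      ev_above[OF a0(1) z] ev_above[OF a0(2) z] ev_above[OF th0(1) z] ev_above[OF th0(2) z]
      ev_above[OF td0(1) z] ev_above[OF td0(2) z] ev_above[OF ga0'(1) z] ev_above[OF ga0'(2) z]
      lg lf l5 k_pos
  proof eventually_elim
    case (elim j)
    define hi where "hi = lam - y / k j"
    have hl: "hi \<le> lam" using elim y by (simp add: hi_def)
    note e = elim[folded hi_def]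
    let ?phi = "hs_word.psi (X j) n (K j) + tilt j"
    have d: "D j = hs_word.drift (X j) n" "k j = real (K j)" "g1 j = hs_word.gap1 (X j) n" "g2 j = hs_word.gap2 (X j) n"
      by (simp_all add: D_def k_def g1_def g2_def)
    note ea = hs_word.edge_angles[of "X j" n "K j", folded A1_def A2_def A3_def A4_def]
    have p1: "pi + real i * hs_word.drift (X j) n - ?phi = (A1 j - tilt j) + (k j + 2 - real i) * - D j" for i
      unfolding ea(1)[symmetric] hs_word.E1_def d by (simp add: algebra_simps)
    have p2: "hs_word.th1 (X j) n (K j) - real i * hs_word.drift (X j) n - ?phi = (A2 j - tilt j) + (k j + 1 - real i) * D j" for i
      unfolding ea(2)[symmetric] hs_word.E2_def d by (simp add: algebra_simps)
    have p3: "hs_word.th2 (X j) n (K j) + real i * hs_word.drift (X j) n - ?phi = (A3 j - tilt j) + (k j - real i) * - D j" for i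
      unfolding ea(3)[symmetric] hs_word.E3_def d by (simp add: algebra_simps)
    have p4: "hs_word.th3 (X j) n (K j) - real i * hs_word.drift (X j) n - ?phi = (A4 j - tilt j) + (k j + 1 - real i) * D j" for i
      unfolding ea(4)[symmetric] hs_word.E4_def d by (simp add: algebra_simps)
    have "hs_word.descending (X j) n (K j) ?phi (3 / 4 * lam) hi"
      unfolding hs_word.descending_def
    proof (intro conjI allI impI)
      fix i
      { assume "i \<le> K j + 2"
        hence i: "0 \<le> k j + 2 - real i" "k j + 2 - real i \<le> k j + 2" by (auto simp: k_def)
        have "3 / 4 * lam \<le> A1 j - tilt j + (k j + 2 - real i) * - D j \<and> A1 j - tilt j + (k j + 2 - real i) * - D j \<le> hi"
          by (rule between_endpoints[OF i]) (use e in auto)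
        thus "3 / 4 * lam \<le> pi + real i * hs_word.drift (X j) n - ?phi" "pi + real i * hs_word.drift (X j) n - ?phi \<le> hi"
          unfolding p1 by auto }
      { assume "i \<le> K j + 1"
        hence i: "0 \<le> k j + 1 - real i" "k j + 1 - real i \<le> k j + 1" by (auto simp: k_def)
        have "3 / 4 * lam \<le> A2 j - tilt j + (k j + 1 - real i) * D j \<and> A2 j - tilt j + (k j + 1 - real i) * D j \<le> hi"
          "3 / 4 * lam \<le> A4 j - tilt j + (k j + 1 - real i) * D j \<and> A4 j - tilt j + (k j + 1 - real i) * D j \<le> hi"
          by (rule between_endpoints[OF i]; use e in auto)+
        thus "3 / 4 * lam \<le> hs_word.th1 (X j) n (K j) - real i * hs_word.drift (X j) n - ?phi"
          "hs_word.th1 (X j) n (K j) - real i * hs_word.drift (X j) n - ?phi \<le> hi"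
          "3 / 4 * lam \<le> hs_word.th3 (X j) n (K j) - real i * hs_word.drift (X j) n - ?phi"
          "hs_word.th3 (X j) n (K j) - real i * hs_word.drift (X j) n - ?phi \<le> hi"
          unfolding p2 p4 by auto }
      { assume "i \<le> K j"
        hence i: "0 \<le> k j - real i" "k j - real i \<le> k j" by (auto simp: k_def)
        have "3 / 4 * lam \<le> A3 j - tilt j + (k j - real i) * - D j \<and> A3 j - tilt j + (k j - real i) * - D j \<le> hi"
          by (rule between_endpoints[OF i]) (use e in auto)
        thus "3 / 4 * lam \<le> hs_word.th2 (X j) n (K j) + real i * hs_word.drift (X j) n - ?phi"
          "hs_word.th2 (X j) n (K j) + real i * hs_word.drift (X j) n - ?phi \<le> hi"
          unfolding p3 by auto }
    qed (use e hl l0 in \<open>auto simp: t1_def t2_def d\<close>)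
    thus ?case by blast
  qed
qed

end

text \<open>
  In the interior \<open>\<bar>quad_D y\<bar> < 1\<close>, which is the condition for the zigzags to descend.  Each of the
  four critical tops has to be compared with each of the four critical bottoms; in the limit, all
  of the sixteen inequalities are consequences of the four that define the quadrilateral.
\<close>

lemma eventually_in_tile:
  assumes n: "n \<ge> 3" and K: "filterlim K at_top sequentially"
    and lim: "(\<lambda>j. S_map n (K j) (X j)) \<longlonglongrightarrow> y" and y: "y \<in> interior (Q_quad n)"
  shows "eventually (\<lambda>j. X j \<in> orbit_tile (word_W n (K j))) sequentially"
proof -
  define f where "f = sin (lam n) / (real n - 1)"
  note h = hs_seq0_scaled[OF n K lim]
  interpret hs_seq0 n X K 0 "2 * (real n - 1) / zeta n * quad_D y" "- (2 * real n / zeta n) * fst y" by (rule h)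
  note v = limit_values[OF n h, folded f_def]
  note ch = critical_heights[unfolded v(3-6)]
  have i: "quad_D y < quad_P n y" "- quad_D y < quad_P n y"
    "quad_P n y < (1 - quad_D y) * quad_p n + quad_D y" "quad_P n y < (1 + quad_D y) * quad_p n - quad_D y"
    using y unfolding Q_quad_eq[OF n] in_interior_quad_half[OF n] by auto
  define N wd qm' qp' where "N = f * quad_P n y" and "wd = f * quad_D y"
    and "qm' = f * (quad_p n * (1 - quad_D y) / 2)" and "qp' = f * (quad_p n * (1 + quad_D y) / 2)"
  have f0: "f > 0" by (rule v)
  have s: "wd < N" "- wd < N" "N < 2 * qm' + wd" "N < 2 * qp' - wd"
  proof -
    have "f * quad_D y < f * quad_P n y" "f * (- quad_D y) < f * quad_P n y"
      "f * quad_P n y < f * ((1 - quad_D y) * quad_p n + quad_D y)"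
      "f * quad_P n y < f * ((1 + quad_D y) * quad_p n - quad_D y)"
      by (rule mult_strict_left_mono[OF i(1) f0] mult_strict_left_mono[OF i(2) f0]
          mult_strict_left_mono[OF i(3) f0] mult_strict_left_mono[OF i(4) f0])+
    thus "wd < N" "- wd < N" "N < 2 * qm' + wd" "N < 2 * qp' - wd"
      unfolding N_def wd_def qm'_def qp'_def by (simp_all add: field_simps)
  qed
  have "\<bar>quad_D y\<bar> < 1"
  proof -
    have "0 < (1 - quad_D y) * quad_p n" "0 < (1 + quad_D y) * quad_p n" using i by linarith+
    thus ?thesis using quad_p_ge_1[OF n] by (auto simp: zero_less_mult_iff abs_less_iff)
  qed
  hence "\<bar>c * (2 * (real n - 1) / zeta n * quad_D y)\<bar> < s"
    unfolding v(7,8) using cos_lam[OF n] by (simp add: abs_mult)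
  note desc = eventually_descending[OF this]
  have c0: "c > 0" by (rule v)
  let ?h = "\<lambda>V j. hgt_rel (X j) n (K j) (V (X j) n (K j))"
  have ev: "eventually (\<lambda>j. ?h W j < ?h V j) sequentially"
    if "?h W \<longlonglongrightarrow> 8 * c * a" "?h V \<longlonglongrightarrow> 8 * c * b" "a < b" for V W a b
  proof -
    have "8 * c * a < 8 * c * b" using that(3) c0 by simp
    from order_tendstoD(1)[OF tendsto_diff[OF that(2,1)], of 0] this
    have "eventually (\<lambda>j. 0 < ?h V j - ?h W j) sequentially" by simp
    thus ?thesis by eventually_elim simp
  qed
  note ch' = ch[folded N_def wd_def qm'_def qp'_def]
  have B1: "?h hs_word.B1 \<longlonglongrightarrow> 8 * c * 0" by (simp add: hgt_rel_def)
  have ob: "eventually (\<lambda>j. X j \<in> obtuse_params) sequentially"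
  proof -
    have l: "0 < hs_seq.lam n" "hs_seq.lam n + hs_seq.lam n < pi / 2" using lam_bounds pi_gt_zero by auto
    have "eventually (\<lambda>j. 0 < fst (X j)) sequentially" "eventually (\<lambda>j. 0 < snd (X j)) sequentially"
      "eventually (\<lambda>j. fst (X j) + snd (X j) < pi / 2) sequentially"
      by (rule order_tendstoD(1)[OF lim_angle(1) l(1)], rule order_tendstoD(1)[OF lim_angle(2) l(1)],
          rule order_tendstoD(2)[OF tendsto_add[OF lim_angle] l(2)])
    thus ?thesis by eventually_elim (auto simp: obtuse_params_def)
  qed
  note T1 = ev[where V = hs_word.T1, OF _ ch'(2)] and T2 = ev[where V = hs_word.T2, OF _ ch'(3)]
    and C1 = ev[where V = hs_word.C1, OF _ ch'(4)] and C2 = ev[where V = hs_word.C2, OF _ ch'(5)]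
  have evs: "eventually (\<lambda>j. ?h hs_word.B1 j < ?h hs_word.T1 j \<and> ?h hs_word.B1 j < ?h hs_word.T2 j \<and> ?h hs_word.B1 j < ?h hs_word.C1 j \<and> ?h hs_word.B1 j < ?h hs_word.C2 j) sequentially"
    "eventually (\<lambda>j. ?h hs_word.B2 j < ?h hs_word.T1 j \<and> ?h hs_word.B2 j < ?h hs_word.T2 j \<and> ?h hs_word.B2 j < ?h hs_word.C1 j \<and> ?h hs_word.B2 j < ?h hs_word.C2 j) sequentially"
    "eventually (\<lambda>j. ?h hs_word.C3 j < ?h hs_word.T1 j \<and> ?h hs_word.C3 j < ?h hs_word.T2 j \<and> ?h hs_word.C3 j < ?h hs_word.C1 j \<and> ?h hs_word.C3 j < ?h hs_word.C2 j) sequentially"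
    "eventually (\<lambda>j. ?h hs_word.C4 j < ?h hs_word.T1 j \<and> ?h hs_word.C4 j < ?h hs_word.T2 j \<and> ?h hs_word.C4 j < ?h hs_word.C1 j \<and> ?h hs_word.C4 j < ?h hs_word.C2 j) sequentially"
    using s by (intro eventually_conj T1[where W = hs_word.B1, OF B1] T2[where W = hs_word.B1, OF B1]
        C1[where W = hs_word.B1, OF B1] C2[where W = hs_word.B1, OF B1]
        T1[where W = hs_word.B2, OF ch'(1)] T2[where W = hs_word.B2, OF ch'(1)]
        C1[where W = hs_word.B2, OF ch'(1)] C2[where W = hs_word.B2, OF ch'(1)]
        T1[where W = hs_word.C3, OF ch'(6)] T2[where W = hs_word.C3, OF ch'(6)]
        C1[where W = hs_word.C3, OF ch'(6)] C2[where W = hs_word.C3, OF ch'(6)]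
        T1[where W = hs_word.C4, OF ch'(7)] T2[where W = hs_word.C4, OF ch'(7)]
        C1[where W = hs_word.C4, OF ch'(7)] C2[where W = hs_word.C4, OF ch'(7)]; linarith)+
  show ?thesis
    using desc vec_d_pos ob evs
  proof eventually_elim
    case (elim j)
    let ?phi = "hs_word.psi (X j) n (K j) + tilt j"
    from elim(1) obtain hi where hi: "hs_word.descending (X j) n (K j) ?phi (3 / 4 * hs_seq.lam n) hi" ..
    have vd: "vec_d j = complex_of_real (cmod (vec_d j)) * cis (tilt j)"
      unfolding tilt_def by (rule polar_arctan[OF elim(2)])
    have r: "cmod (vec_d j) > 0" using elim(2) by auto
    have "hs_word.T2 (X j) n (K j) - 1 = cis (hs_word.psi (X j) n (K j)) * vec_d j"
      unfolding vec_d_def hs_word.rot_def by (simp add: cis_mult flip: mult.assoc)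
    also have "\<dots> = complex_of_real (cmod (vec_d j)) * cis ?phi"
      by (subst vd) (simp add: cis_mult mult_ac add.commute)
    finally have d: "hs_word.T2 (X j) n (K j) - 1 = complex_of_real (cmod (vec_d j)) * cis ?phi" .
    have hh: "hgt_rel (X j) n (K j) z = cmod (vec_d j) * (hgt ?phi z - hgt ?phi (hs_word.B1 (X j) n (K j)))" for z
      unfolding hgt_rel_def d wedge_hgt hgt_diff ..
    have cmp: "hgt_rel (X j) n (K j) w < hgt_rel (X j) n (K j) z \<longleftrightarrow> hgt ?phi w < hgt ?phi z" for z w
      unfolding hh using r by simp
    show ?case
      by (rule hs_word.descending_in_tile[OF elim(3) n hi d r]) (use elim(4-7)[unfolded cmp] in auto)
  qed
qed

section \<open>Convergence of the rescaled tiles\<close>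

lemma S_map_surj:
  assumes n: "n \<ge> 3" and k: "k > 0"
  shows "S_map n k (V_pt n + (1 / (zeta n * (real k)\<^sup>2)) *\<^sub>R y) = y"
  using zeta_pos[OF n] k by (simp add: S_map_def)

text \<open>
  Otherwise some points of \<open>C\<close> that are not covered, for arbitrarily large \<open>k\<close>, accumulate at a point
  of \<open>C\<close>, which contradicts \<open>eventually_in_tile\<close>.
\<close>

lemma compact_eventually_covered:
  assumes n: "n \<ge> 3" and C: "compact C" "C \<subseteq> interior (Q_quad n)"
  shows "\<forall>\<^sub>F k in sequentially. C \<subseteq> S_map n k ` orbit_tile (word_W n k)"
proof (rule ccontr)
  assume "\<not> ?thesis"
  hence "\<forall>m. \<exists>k y. k \<ge> m \<and> y \<in> C \<and> y \<notin> S_map n k ` orbit_tile (word_W n k)"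
    unfolding eventually_sequentially by (meson subsetI)
  then obtain K Y where KY: "\<And>m. K m \<ge> m" "\<And>m. Y m \<in> C" "\<And>m. Y m \<notin> S_map n (K m) ` orbit_tile (word_W n (K m))"
    by metis
  obtain y r where r: "y \<in> C" "strict_mono r" "(Y \<circ> r) \<longlonglongrightarrow> y"
    using seq_compactE[OF C(1)[unfolded compact_eq_seq_compact_metric], of Y] KY(2) by metis
  define k where "k j = K (r j)" for j
  define X where "X j = V_pt n + (1 / (zeta n * (real (k j))\<^sup>2)) *\<^sub>R Y (r j)" for j
  have "filterlim K at_top sequentially"
    by (rule filterlim_at_top_mono[OF filterlim_ident]) (simp add: KY(1))
  hence kinf: "filterlim k at_top sequentially"
    unfolding k_def by (rule filterlim_compose[OF _ filterlim_subseq[OF r(2)]])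
  have k0: "eventually (\<lambda>j. k j > 0) sequentially"
    using kinf[unfolded filterlim_at_top, rule_format, of 1] by eventually_elim simp
  have "(\<lambda>j. S_map n (k j) (X j)) \<longlonglongrightarrow> y"
    by (rule Lim_transform_eventually[OF r(3)])
       (use k0 in eventually_elim, simp only: X_def S_map_surj[OF n] o_def)
  hence "eventually (\<lambda>j. X j \<in> orbit_tile (word_W n (k j))) sequentially"
    by (rule eventually_in_tile[OF n kinf]) (use r(1) C in blast)
  with k0 have "eventually (\<lambda>j. False) sequentially"
  proof eventually_elim
    case (elim j)
    hence "Y (r j) \<in> S_map n (k j) ` orbit_tile (word_W n (k j))"
      using S_map_surj[OF n elim(1), of "Y (r j)"] unfolding X_def[symmetric] by (metis imageI)
    thus ?case using KY(3) by (simp add: k_def)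
  qed
  thus False by simp
qed

lemma tile_eventually_near_Q:
  assumes n: "n \<ge> 3" and e: "e > 0"
  shows "\<forall>\<^sub>F k in sequentially. \<forall>z\<in>S_map n k ` orbit_tile (word_W n k). \<exists>q\<in>Q_quad n. dist z q < e"
proof (rule ccontr)
  assume "\<not> ?thesis"
  hence "\<forall>m. \<exists>k x. k \<ge> m \<and> x \<in> orbit_tile (word_W n k) \<and> (\<forall>q\<in>Q_quad n. e \<le> dist (S_map n k x) q)"
    by (simp add: eventually_sequentially not_less del: split_paired_Ex) blast
  then obtain K X where KX: "\<And>m. K m \<ge> m" "\<And>m. X m \<in> orbit_tile (word_W n (K m))"
    "\<And>m q. q \<in> Q_quad n \<Longrightarrow> e \<le> dist (S_map n (K m) (X m)) q"
    by metis
  obtain M k0 where M: "\<And>k x. k \<ge> k0 \<Longrightarrow> x \<in> orbit_tile (word_W n k) \<Longrightarrow> norm (S_map n k x) \<le> M"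
    using tiles_bounded[OF n] by blast
  define F where "F m = S_map n (K (m + k0)) (X (m + k0))" for m
  have "norm (F m) \<le> M" for m
    unfolding F_def by (rule M) (use KX(1)[of "m + k0"] KX(2) in auto)
  hence "bounded (range F)" by (intro boundedI[of _ M]) auto
  then obtain l r where r: "strict_mono r" "(F \<circ> r) \<longlonglongrightarrow> l"
    using bounded_imp_convergent_subsequence[of F] by blast
  define K' X' where "K' j = K (r j + k0)" and "X' j = X (r j + k0)" for j
  have "K' j \<ge> j" for j
    using KX(1)[of "r j + k0"] seq_suble[OF r(1), of j] by (simp add: K'_def)
  hence Kinf: "filterlim K' at_top sequentially"
    by (intro filterlim_at_top_mono[OF filterlim_ident]) simp
  have lim: "(\<lambda>j. S_map n (K' j) (X' j)) \<longlonglongrightarrow> l"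
    using r(2) by (simp add: F_def K'_def X'_def o_def)
  have "l \<in> Q_quad n"
    by (rule limit_in_Q[OF n Kinf lim]) (simp add: K'_def X'_def KX(2))
  hence "e \<le> dist (S_map n (K' j) (X' j)) l" for j unfolding K'_def X'_def by (rule KX(3))
  moreover have "eventually (\<lambda>j. dist (S_map n (K' j) (X' j)) l < e) sequentially"
    using lim e by (rule tendstoD)
  ultimately show False by (auto simp: eventually_sequentially not_less[symmetric])
qed

text \<open>
  The quadrilateral is covered by finitely many small balls whose centres lie in its interior, and
  these centres form a compact set.
\<close>

lemma Q_eventually_near_tile:
  assumes n: "n \<ge> 3" and e: "e > 0"
  shows "\<forall>\<^sub>F k in sequentially. \<forall>q\<in>Q_quad n. \<exists>z\<in>S_map n k ` orbit_tile (word_W n k). dist q z < e"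
proof -
  have "Q_quad n \<subseteq> (\<Union>z\<in>interior (Q_quad n). ball z e)"
  proof
    fix q assume "q \<in> Q_quad n"
    hence "q \<in> closure (interior (Q_quad n))"
      using convex_closure_interior[OF convex_Q interior_Q_nonempty[OF n]] closure_subset by blast
    then obtain z where "z \<in> interior (Q_quad n)" "dist z q < e"
      using e by (auto simp: closure_approachable)
    thus "q \<in> (\<Union>z\<in>interior (Q_quad n). ball z e)" by auto
  qed
  then obtain C where C: "C \<subseteq> interior (Q_quad n)" "finite C" "Q_quad n \<subseteq> (\<Union>z\<in>C. ball z e)"
    using compactE_image[OF compact_Q, of "interior (Q_quad n)" "\<lambda>z. ball z e"] by (metis open_ball)
  have "\<forall>\<^sub>F k in sequentially. C \<subseteq> S_map n k ` orbit_tile (word_W n k)"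
    by (rule compact_eventually_covered[OF n finite_imp_compact[OF C(2)] C(1)])
  thus ?thesis
  proof eventually_elim
    case (elim k)
    show ?case
    proof
      fix q assume "q \<in> Q_quad n"
      then obtain z where "z \<in> C" "dist z q < e" using C(3) by auto
      thus "\<exists>z\<in>S_map n k ` orbit_tile (word_W n k). dist q z < e"
        using elim by (auto simp: dist_commute)
    qed
  qed
qed

lemma hausdorff_dist_closure_le:
  fixes A B :: "'a::metric_space set"
  assumes "e > 0" and A: "\<And>z. z \<in> A \<Longrightarrow> \<exists>q\<in>B. dist z q < e" and B: "\<And>q. q \<in> B \<Longrightarrow> \<exists>z\<in>A. dist q z < e"
  shows "hausdorff_dist (closure A) B \<le> ennreal (2 * e)"
  unfolding hausdorff_dist_def
proof (intro max.boundedI SUP_least)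
  fix a assume "a \<in> closure A"
  then obtain z where z: "z \<in> A" "dist z a < e" using assms(1) by (auto simp: closure_approachable)
  obtain q where q: "q \<in> B" "dist z q < e" using A[OF z(1)] by blast
  have "dist a q \<le> 2 * e" using z q dist_triangle[of a q z] by (simp add: dist_commute)
  thus "(INF b\<in>B. ennreal (dist a b)) \<le> ennreal (2 * e)" by (intro INF_lower2[OF q(1)] ennreal_leI)
next
  fix q assume "q \<in> B"
  then obtain z where z: "z \<in> A" "dist q z < e" using B by blast
  have "z \<in> closure A" using z closure_subset by blast
  moreover have "ennreal (dist z q) \<le> ennreal (2 * e)"
    using z assms(1) by (intro ennreal_leI) (simp add: dist_commute)
  ultimately show "(INF a\<in>closure A. ennreal (dist a q)) \<le> ennreal (2 * e)" by (rule INF_lower2)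
qed

theorem theorem1p7:
  fixes n :: nat
  assumes "n \<ge> 3"
  shows "((\<lambda>k. hausdorff_dist (closure (S_map n k ` orbit_tile (word_W n k))) (Q_quad n))
            \<longlonglongrightarrow> 0) \<and>
         (\<forall>K. compact K \<and> K \<subseteq> interior (Q_quad n) \<longrightarrow>
            (\<forall>\<^sub>F k in sequentially. K \<subseteq> S_map n k ` orbit_tile (word_W n k)))"
proof (intro conjI allI impI)
  let ?h = "\<lambda>k. hausdorff_dist (closure (S_map n k ` orbit_tile (word_W n k))) (Q_quad n)"
  show "?h \<longlonglongrightarrow> 0"
  proof (rule order_tendstoI)
    fix a :: ennreal assume "0 < a"
    then obtain e where e: "e > 0" "ennreal (2 * e) < a"
    proof -
      obtain b where b: "0 < b" "b < a" using \<open>0 < a\<close> dense by blast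
      hence "b < top" by (meson less_le_trans top_greatest)
      hence "b = ennreal (enn2real b)" by simp
      moreover have "enn2real b > 0" using b(1) \<open>b < top\<close> by (simp add: enn2real_positive_iff)
      ultimately show ?thesis using that[of "enn2real b / 2"] b(2) by simp
    qed
    show "\<forall>\<^sub>F k in sequentially. ?h k < a"
      using tile_eventually_near_Q[OF assms e(1)] Q_eventually_near_tile[OF assms e(1)]
    proof eventually_elim
      case (elim k)
      have "?h k \<le> ennreal (2 * e)" by (rule hausdorff_dist_closure_le[OF e(1)]) (use elim in auto)
      thus ?case using e(2) by (rule le_less_trans)
    qed
  qed simp
  fix K assume "compact K \<and> K \<subseteq> interior (Q_quad n)"
  thus "\<forall>\<^sub>F k in sequentially. K \<subseteq> S_map n k ` orbit_tile (word_W n k)"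
    using compact_eventually_covered[OF assms] by blast
qed

end
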